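(* Let $k\ge0$ be an integer, let $(Y_s)_{s\in\mathbb{Z}}$ be i.i.d. real random variables and let $\xi(s)=\max\{Y_s,Y_{s+1},\ldots,Y_{s+k}\}$ for $s\in\mathbb{Z}$. Then, for every $\tau>0$, the point process of exceedances $$\Phi_n=\Big\{\frac in:\ \xi(S_i)>u_n^{(\tau)},\ 0\le i\le n\Big\}$$ converges in distribution, as $n\to\infty$, to a compound Poisson point process in $[0,1]$ of intensity $\theta\tau$, with $\theta=\frac{q}{k+1}$, and cluster size distribution $$\pi(j)=\frac1q\sum_{A}\big(\mathbb{P}(N(A)=j)-\mathbb{P}(N(A)=j+1)\big),\qquad j\ge1,$$ where the sum is over all sets $A\subset\mathbb{Z}$ consisting of $k+1$ consecutive integers with $0\in A$.
   Context: Random walk: $S_0=0$, $S_n=X_1+\cdots+X_n$ for $n\ge1$, where $(X_i)_{i\ge1}$ are independent with $\mathbb{P}(X_i=1)=p$, $\mathbb{P}(X_i=-1)=1-p$, $p\in(0,1)\setminus\{1/2\}$. The scenery $(\xi(s))_{s\in\mathbb{Z}}$ (equivalently $(Y_s)_{s\in\mathbb{Z}}$) is independent of $(X_i)_{i\ge1}$. Set $q=\mathbb{P}(S_i\ne0\ \forall i\ge1)$ (one has $q=|2p-1|$). For $A\subset\mathbb{Z}$, $N(A)=\#\{i\ge0:\ S_i\in A\}$ is the number of visits of the walk in $A$. Thresholds: it is assumed that for every $\tau>0$ there is a sequence $u_n=u_n^{(\tau)}$ with $n\,\mathbb{P}(\xi(0)>u_n)\to\tau$; these sequences are fixed. Compound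 Poisson point process in $[0,1]$ of intensity $\lambda>0$ and cluster size distribution $\pi$: a point process of the form $\{(x_j,n_j),\,j\ge1\}$ (a point at $x_j$ with multiplicity $n_j$), where $\{x_j\}$ is a stationary Poisson point process in $[0,1]$ of intensity $\lambda$ and $(n_j)$ are i.i.d. with distribution $\pi$, independent of the $x_j$'s. *)

theory Defs
  imports "HOL-Probability.Probability"
begin

section \<open>Independence of two random elements\<close>

text \<open>The library constant \<open>indep_var\<close> requires both random elements to have the same value type.\<close>

definition indep_elements ::
    "'a measure \<Rightarrow> 'b measure \<Rightarrow> ('a \<Rightarrow> 'b) \<Rightarrow> 'c measure \<Rightarrow> ('a \<Rightarrow> 'c) \<Rightarrow> bool" where
  "indep_elements M N f N' g \<longleftrightarrow>
     f \<in> measurable M N \<and> g \<in> measurable M N' \<and>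
     prob_space.indep_set M {f -` A \<inter> space M | A. A \<in> sets N} {g -` B \<inter> space M | B. B \<in> sets N'}"

section \<open>Point processes in the unit interval\<close>

text \<open>
  As [0,1] is compact, a locally finite point measure on it is a finite multiset of points.
  The vague topology is the initial topology for the maps sending a point measure m to the
  integral of f with respect to m, for f continuous on [0,1].
\<close>

definition vague_topology :: "real multiset topology" where
  "vague_topology =
     pullback_topology {m. set_mset m \<subseteq> {0..1}}
       (\<lambda>m. \<lambda>f\<in>{f. continuous_on {0..1} f}. \<Sum>x\<in>#m. f x)
       (product_topology (\<lambda>_. euclideanreal) {f. continuous_on {0..1} f})"

definition points_in :: "real multiset \<Rightarrow> real set \<Rightarrow> nat" where
  "points_in m B = size {#x \<in># m. x \<in> B#}"

definition point_process :: "'a measure \<Rightarrow> ('a \<Rightarrow> real multiset) \<Rightarrow> bool" where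
  "point_process M N \<longleftrightarrow>
     prob_space M \<and>
     (\<forall>\<omega>\<in>space M. set_mset (N \<omega>) \<subseteq> {0..1}) \<and>
     (\<forall>B\<in>sets borel. (\<lambda>\<omega>. points_in (N \<omega>) B) \<in> measurable M (count_space UNIV))"

definition converges_in_distribution ::
    "'a measure \<Rightarrow> (nat \<Rightarrow> 'a \<Rightarrow> real multiset) \<Rightarrow> 'b measure \<Rightarrow> ('b \<Rightarrow> real multiset) \<Rightarrow> bool" where
  "converges_in_distribution M \<Phi> M' \<Psi> \<longleftrightarrow>
     (\<forall>n. point_process M (\<Phi> n)) \<and> point_process M' \<Psi> \<and>
     (\<forall>g. continuous_map vague_topology euclideanreal g \<and> bounded (g ` topspace vague_topology) \<longrightarrow>
        (\<lambda>n. \<integral>\<omega>. g (\<Phi> n \<omega>) \<partial>M) \<longlonglongrightarrow> (\<integral>\<omega>. g (\<Psi> \<omega>) \<partial>M'))"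

text \<open>
  The Poisson probabilities are written out because the library distribution
  \<open>poisson_pmf\<close> is only specified for positive rates, and Lebesgue null sets B have rate 0.
\<close>

definition poisson_point_process :: "'a measure \<Rightarrow> real \<Rightarrow> ('a \<Rightarrow> real multiset) \<Rightarrow> bool" where
  "poisson_point_process M lam N \<longleftrightarrow>
     0 < lam \<and> point_process M N \<and>
     (\<forall>B\<in>sets borel. B \<subseteq> {0..1} \<longrightarrow>
        (\<forall>i. \<P>(\<omega> in M. points_in (N \<omega>) B = i) =
             (lam * measure lborel B) ^ i / fact i * exp (- (lam * measure lborel B)))) \<and>
     (\<forall>B :: nat \<Rightarrow> real set. range B \<subseteq> sets borel \<and> (\<forall>i. B i \<subseteq> {0..1}) \<and> disjoint_family B \<longrightarrow>
        prob_space.indep_vars M (\<lambda>_. count_space UNIV) (\<lambda>i \<omega>. points_in (N \<omega>) (B i)) UNIV)"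

text \<open>
  The points of the underlying Poisson process are \<open>x 0, \<dots>, x (K - 1)\<close>, where \<open>K\<close> is the
  (random) number of points; the values \<open>x j\<close> with \<open>j \<ge> K\<close> are irrelevant padding.
\<close>

definition compound_poisson_process ::
    "'a measure \<Rightarrow> real \<Rightarrow> (nat \<Rightarrow> real) \<Rightarrow> ('a \<Rightarrow> real multiset) \<Rightarrow> bool" where
  "compound_poisson_process M lam \<pi> \<Psi> \<longleftrightarrow>
     (\<exists>(K :: 'a \<Rightarrow> nat) (x :: nat \<Rightarrow> 'a \<Rightarrow> real) (m :: nat \<Rightarrow> 'a \<Rightarrow> nat).
        poisson_point_process M lam (\<lambda>\<omega>. image_mset (\<lambda>j. x j \<omega>) (mset_set {..<K \<omega>})) \<and>
        (\<forall>j. \<forall>\<omega>\<in>space M. 1 \<le> m j \<omega>) \<and>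
        (\<forall>j. \<forall>l\<ge>1. \<P>(\<omega> in M. m j \<omega> = l) = \<pi> l) \<and>
        prob_space.indep_vars M (\<lambda>_. count_space UNIV) m UNIV \<and>
        indep_elements M
          (count_space UNIV \<Otimes>\<^sub>M PiM UNIV (\<lambda>_. borel)) (\<lambda>\<omega>. (K \<omega>, \<lambda>j. x j \<omega>))
          (PiM UNIV (\<lambda>_. count_space UNIV)) (\<lambda>\<omega> j. m j \<omega>) \<and>
        (\<forall>\<omega>\<in>space M. \<Psi> \<omega> = (\<Sum>j<K \<omega>. replicate_mset (m j \<omega>) (x j \<omega>))))"

section \<open>Random walk in random scenery\<close>

definition walk :: "(nat \<Rightarrow> 'a \<Rightarrow> int) \<Rightarrow> nat \<Rightarrow> 'a \<Rightarrow> int" where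
  "walk X n \<omega> = (\<Sum>i=1..n. X i \<omega>)"

definition no_return_prob :: "'a measure \<Rightarrow> (nat \<Rightarrow> 'a \<Rightarrow> int) \<Rightarrow> real" where
  "no_return_prob M X = \<P>(\<omega> in M. \<forall>i\<ge>1. walk X i \<omega> \<noteq> 0)"

definition visits :: "(nat \<Rightarrow> 'a \<Rightarrow> int) \<Rightarrow> int set \<Rightarrow> 'a \<Rightarrow> enat" where
  "visits X A \<omega> =
     (if finite {i. walk X i \<omega> \<in> A} then enat (card {i. walk X i \<omega> \<in> A}) else \<infinity>)"

definition moving_max :: "(int \<Rightarrow> 'a \<Rightarrow> real) \<Rightarrow> nat \<Rightarrow> int \<Rightarrow> 'a \<Rightarrow> real" where
  "moving_max Y k s \<omega> = Max ((\<lambda>t. Y t \<omega>) ` {s..s + int k})"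

definition exceedances ::
    "(nat \<Rightarrow> 'a \<Rightarrow> int) \<Rightarrow> (int \<Rightarrow> 'a \<Rightarrow> real) \<Rightarrow> (nat \<Rightarrow> real) \<Rightarrow> nat \<Rightarrow> 'a \<Rightarrow> real multiset" where
  "exceedances X \<xi> u n \<omega> =
     image_mset (\<lambda>i. real i / real n) (mset_set {i. i \<le> n \<and> \<xi> (walk X i \<omega>) \<omega> > u n})"

definition cluster_size_distr :: "'a measure \<Rightarrow> (nat \<Rightarrow> 'a \<Rightarrow> int) \<Rightarrow> nat \<Rightarrow> nat \<Rightarrow> real" where
  "cluster_size_distr M X k j =
     1 / no_return_prob M X *
     (\<Sum>A | 0 \<in> A \<and> (\<exists>a. A = {a..a + int k}).
        \<P>(\<omega> in M. visits X A \<omega> = enat j) - \<P>(\<omega> in M. visits X A \<omega> = enat (j + 1)))"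

end

theory Submission
  imports Defs
begin

text \<open>
  Condition on the walk. Write \<open>p\<^sub>n = P(Y\<^sub>0 > u\<^sub>n)\<close>, so that \<open>n p\<^sub>n\<close> tends to \<open>\<tau> / (k + 1)\<close>. An
  exceedance of Y at s makes the process exceed \<open>u\<^sub>n\<close> exactly at the visits to the window
  \<open>{s - k..s}\<close>, and two nearby exceedances of Y are negligible. For weights w in [0,1) the conditional
  expectation of the product of w over the exceedance times is therefore close to
  \<open>exp (- p\<^sub>n Q\<^sub>n)\<close>, where \<open>Q\<^sub>n\<close> is the sum over all windows of 1 minus the product of w over the visits
  to the window. Telescoping that difference over the visits rewrites \<open>Q\<^sub>n\<close> as a sum over times i of
  functions of the walk after time i. By transience these are almost functions of finitely many steps,
  and a variance bound gives a law of large numbers for \<open>Q\<^sub>n / n\<close>.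

  The limit is expressed through \<open>R\<^sub>j\<close>, the sum of \<open>P(N(A) = j)\<close> over the windows A containing 0.
  Counting windows at their j-th visit from the end shows that \<open>R\<^sub>j\<close> is the density in time of the
  windows with at least j visits. Hence \<open>R\<^sub>j\<close> is decreasing in j, and \<open>R\<^sub>1 = q\<close> because the range of
  a nearest-neighbour walk is an interval, so \<open>\<pi>\<close> is a probability distribution.

  Taking w constant on the cells of a grid yields convergence of the joint generating functions of the
  cell counts, which implies convergence in the vague topology.
\<close>

section \<open>Convergence of generating functions\<close>

text \<open>An exceedance of the moving maximum counts once even if several \<open>Y\<close> in its
  range are large, which prevents a factorisation over sites. Counting with multiplicity restores
  it, at the price of an error of order \<open>n * (excess u)\<^sup>2\<close>, which vanishes
  because \<open>n * excess u\<close> converges. Weights stay strictly below 1, so geometric series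
  dominate every interchange of sum and integral. Tightness of the counts comes for free: the limit
  law has total mass 1. Transience is quantified by an exponential tilt t with E(t^X) < 1. A return
  to a bounded window at lag d then has probability at most a constant times a geometric term in d,
  whichever way the walk drifts. Since these bounds are summable over the horizon, expected window
  counts are linear in n up to a bounded error, and inequalities between counts pass to their
  slopes. A law of large numbers in L1 is enough, because exp(-x) is 1-Lipschitz on nonnegative x.
  In it the order of choices is: grid size L fixed, then horizon T, then n. The limit process is
  realised on an explicit product space: a Poisson number of uniform points with independent
  marks.\<close>

lemma power_series_coeff_tendsto:
  fixes a :: "nat \<Rightarrow> nat \<Rightarrow> real" and b :: "nat \<Rightarrow> real"
  assumes a: "\<And>n c. \<bar>a n c\<bar> \<le> 1" and b: "\<And>c. \<bar>b c\<bar> \<le> 1"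
    and lim: "\<And>z. 0 < z \<Longrightarrow> z < 1 \<Longrightarrow> (\<lambda>n. \<Sum>c. a n c * z ^ c) \<longlonglongrightarrow> (\<Sum>c. b c * z ^ c)"
  shows "(\<lambda>n. a n c) \<longlonglongrightarrow> b c"
proof (induction c rule: less_induct)
  case (less c)
  have sm: "summable (\<lambda>c. e c * z ^ c)" if "\<And>c. \<bar>e c\<bar> \<le> B" "0 < z" "z < 1"
    for e :: "nat \<Rightarrow> real" and z B :: real
  proof (rule summable_comparison_test')
    show "summable (\<lambda>c. B * z ^ c)" using that by (intro summable_mult summable_geometric) auto
    show "norm (e c * z ^ c) \<le> B * z ^ c" if "c \<ge> 0" for c
      using \<open>\<And>c. \<bar>e c\<bar> \<le> B\<close> \<open>0 < z\<close> by (auto simp: abs_mult intro!: mult_right_mono)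
  qed
  show ?case
  proof (rule LIMSEQ_I)
    fix \<epsilon> :: real assume \<epsilon>: "\<epsilon> > 0"
    \<comment> \<open>After division by \<open>z ^ c\<close>, the terms beyond \<open>c\<close>
      contribute at most \<open>4 * z\<close>. The bound \<open>\<epsilon> / 8\<close> makes this at
      most \<open>\<epsilon> / 2\<close>, and \<open>1 / 2\<close> gives
      \<open>1 / (1 - z) \<le> 2\<close>.\<close>
    define z where "z = min (1/2) (\<epsilon> / 8)"
    have z: "0 < z" "z < 1" "z \<le> 1/2" "z \<le> \<epsilon> / 8" using \<epsilon> by (auto simp: z_def)
    define D where "D n = (\<Sum>c. a n c * z ^ c) - (\<Sum>c. b c * z ^ c)" for n
    have D: "D \<longlonglongrightarrow> 0" unfolding D_def using lim[OF z(1,2)] by (simp add: LIM_zero)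
    \<comment> \<open>Contribution of the difference of the two series and of the coefficients below
      \<open>c\<close>, at the fixed \<open>z\<close>. It vanishes by \<open>D\<close> and by the
      induction hypothesis.\<close>
    define Q where "Q n = \<bar>D n - (\<Sum>i<c. (a n i - b i) * z ^ i)\<bar> / z ^ c" for n
    have "Q \<longlonglongrightarrow> \<bar>0 - (\<Sum>i<c. (b i - b i) * z ^ i)\<bar> / z ^ c"
      unfolding Q_def using z less by (intro tendsto_intros D) auto
    hence "Q \<longlonglongrightarrow> 0" by simp
    hence ev: "\<forall>\<^sub>F n in sequentially. Q n < \<epsilon> / 2" using \<epsilon> by (intro order_tendstoD) auto
    have main: "\<bar>a n c - b c\<bar> \<le> Q n + \<epsilon> / 2" for n
    proof -
      define e where "e i = a n i - b i" for i
      have e: "\<bar>e i\<bar> \<le> 2" for i using a[of n i] b[of i] by (simp add: e_def)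
      have De: "D n = (\<Sum>i. e i * z ^ i)"
        unfolding D_def e_def left_diff_distrib using sm[OF a z(1,2)] sm[OF b z(1,2)]
        by (simp add: suminf_diff)
      have s: "summable (\<lambda>i. e i * z ^ i)" by (rule sm[OF e z(1,2)])
      have "D n = (\<Sum>i. e (i + Suc c) * z ^ (i + Suc c)) + (\<Sum>i<Suc c. e i * z ^ i)"
        unfolding De by (rule suminf_split_initial_segment[OF s])
      hence eq: "e c * z ^ c = (D n - (\<Sum>i<c. e i * z ^ i)) - (\<Sum>i. e (i + Suc c) * z ^ (i + Suc c))"
        by simp
      have sg: "summable (\<lambda>i. 2 * z ^ Suc c * z ^ i)"
        using z by (intro summable_mult summable_geometric) auto
      have "\<bar>\<Sum>i. e (i + Suc c) * z ^ (i + Suc c)\<bar> \<le> (\<Sum>i. 2 * z ^ Suc c * z ^ i)"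
      proof -
        have bd: "norm (e (i + Suc c) * z ^ (i + Suc c)) \<le> 2 * z ^ Suc c * z ^ i" for i
        proof -
          have "\<bar>e (i + Suc c)\<bar> * z ^ (i + Suc c) \<le> 2 * z ^ (i + Suc c)"
            using e z by (intro mult_right_mono) auto
          thus ?thesis using z by (simp add: abs_mult power_add mult_ac)
        qed
        show ?thesis using summable_norm_comparison_test[of "\<lambda>i. e (i + Suc c) * z ^ (i + Suc c)" "\<lambda>i. 2 * z ^ Suc c * z ^ i"]
            norm_suminf_le[OF bd sg] by simp
      qed
      also have "\<dots> = 2 * z ^ Suc c * (1 / (1 - z))"
        using z by (subst suminf_mult) (auto simp: suminf_geometric intro!: summable_geometric)
      also have "\<dots> \<le> 2 * z ^ Suc c * 2" using z
        by (intro mult_left_mono) (auto simp: field_simps)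
      also have "\<dots> = z ^ c * (4 * z)" by simp
      also have "\<dots> \<le> z ^ c * (\<epsilon> / 2)" using z by (intro mult_left_mono) auto
      finally have tl: "\<bar>\<Sum>i. e (i + Suc c) * z ^ (i + Suc c)\<bar> \<le> z ^ c * (\<epsilon> / 2)" .
      have "\<bar>e c\<bar> * z ^ c = \<bar>e c * z ^ c\<bar>" using z by (simp add: abs_mult)
      also have "\<dots> \<le> \<bar>D n - (\<Sum>i<c. e i * z ^ i)\<bar> + z ^ c * (\<epsilon> / 2)"
        unfolding eq using tl by linarith
      also have "\<dots> = (Q n + \<epsilon> / 2) * z ^ c"
        unfolding Q_def e_def using z by (simp add: field_simps)
      finally show ?thesis using z by (simp add: e_def)
    qed
    from ev obtain N where "\<And>n. n \<ge> N \<Longrightarrow> Q n < \<epsilon> / 2" by (auto simp: eventually_sequentially)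
    thus "\<exists>N. \<forall>n\<ge>N. norm (a n c - b c) < \<epsilon>" using main by (intro exI[of _ N]) (smt (verit) real_norm_def field_sum_of_halves)
  qed
qed

text \<open>The condition \<open>0 \<le> B\<close> covers a non-integrable \<open>f\<close>, whose
  Bochner integral is 0 by convention.\<close>

lemma (in prob_space) abs_expectation_le:
  fixes f :: "'a \<Rightarrow> real"
  assumes f: "\<And>\<omega>. \<omega> \<in> space M \<Longrightarrow> \<bar>f \<omega>\<bar> \<le> B" and "0 \<le> B"
  shows "\<bar>expectation f\<bar> \<le> B"
proof (cases "integrable M f")
  case True
  have "\<bar>expectation f\<bar> \<le> expectation (\<lambda>\<omega>. \<bar>f \<omega>\<bar>)" by (rule integral_abs_bound)
  also have "\<dots> \<le> expectation (\<lambda>_. B)" using True f by (intro integral_mono) auto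
  finally show ?thesis by (simp add: prob_space)
qed (use \<open>0 \<le> B\<close> in \<open>simp add: not_integrable_integral_eq\<close>)

lemma (in prob_space) expectation_of_bool:
  assumes "{\<omega> \<in> space M. P \<omega>} \<in> events"
  shows "expectation (\<lambda>\<omega>. of_bool (P \<omega>)) = prob {\<omega> \<in> space M. P \<omega>}"
proof -
  have "expectation (\<lambda>\<omega>. of_bool (P \<omega>)) = expectation (indicator {\<omega> \<in> space M. P \<omega>})"
    by (intro Bochner_Integration.integral_cong) (auto simp: indicator_def)
  also have "\<dots> = prob {\<omega> \<in> space M. P \<omega>}"
    using assms by (subst Bochner_Integration.integral_indicator) (auto intro!: arg_cong[where f = prob])
  finally show ?thesis .
qed

text \<open>Sorting by the value of \<open>N\<close> gives a power series, and \<open>z ^ c\<close>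
  dominates its terms. The weight \<open>U\<close> carries the other coordinates when a multivariate
  generating function is expanded in one of its variables.\<close>

lemma (in prob_space) expectation_power_sums:
  fixes U :: "'a \<Rightarrow> real"
  assumes [measurable]: "U \<in> borel_measurable M" "N \<in> measurable M (count_space UNIV)"
    and U: "\<And>\<omega>. \<omega> \<in> space M \<Longrightarrow> 0 \<le> U \<omega> \<and> U \<omega> \<le> 1" and z: "0 \<le> z" "z < 1"
  shows "(\<lambda>c. expectation (\<lambda>\<omega>. U \<omega> * of_bool (N \<omega> = c)) * z ^ c) sums expectation (\<lambda>\<omega>. U \<omega> * z ^ N \<omega>)"
proof -
  let ?f = "\<lambda>c \<omega>. U \<omega> * of_bool (N \<omega> = c) * z ^ c"
  have bd: "\<bar>?f c \<omega>\<bar> \<le> z ^ c" if "\<omega> \<in> space M" for c \<omega>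
    using U[OF that] z by (auto simp: abs_mult mult_left_le_one_le)
  have int: "integrable M (?f c)" for c
    by (rule integrable_const_bound[where B = "z ^ c"]) (use bd in \<open>auto\<close>)
  have geo: "summable (\<lambda>c. z ^ c)" using z by (intro summable_geometric) auto
  have "(\<lambda>c. expectation (?f c)) sums expectation (\<lambda>\<omega>. \<Sum>c. ?f c \<omega>)"
  proof (rule sums_integral)
    show "AE \<omega> in M. summable (\<lambda>c. norm (?f c \<omega>))"
      by (rule AE_I2, rule summable_comparison_test'[OF geo]) (use bd in auto)
    show "summable (\<lambda>c. \<integral>\<omega>. norm (?f c \<omega>) \<partial>M)"
    proof (rule summable_comparison_test'[OF geo])
      fix c :: nat
      have "(\<integral>\<omega>. norm (?f c \<omega>) \<partial>M) \<le> (\<integral>\<omega>. z ^ c \<partial>M)"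
        by (rule integral_mono) (use int bd in \<open>auto\<close>)
      thus "norm (\<integral>\<omega>. norm (?f c \<omega>) \<partial>M) \<le> z ^ c" by (simp add: prob_space)
    qed
  qed (rule int)
  moreover have "(\<Sum>c. ?f c \<omega>) = U \<omega> * z ^ N \<omega>" for \<omega>
    by (subst suminf_finite[of "{N \<omega>}"]) auto
  ultimately show ?thesis by simp
qed

text \<open>Coefficients are extracted one coordinate at a time. With the other arguments frozen,
  the mixed functional is a one-variable power series whose coefficients are expectations in [0,1],
  so \<open>power_series_coeff_tendsto\<close> turns a power into an indicator.\<close>

lemma joint_pgf_tendsto:
  fixes N :: "nat \<Rightarrow> 'i \<Rightarrow> 'a \<Rightarrow> nat" and N' :: "'i \<Rightarrow> 'b \<Rightarrow> nat"
  assumes "prob_space M" "prob_space M'" and I: "finite I"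
    and meas[measurable]: "\<And>n l. N n l \<in> measurable M (count_space UNIV)"
      "\<And>l. N' l \<in> measurable M' (count_space UNIV)"
    and lim: "\<And>z :: 'i \<Rightarrow> real. (\<And>l. 0 \<le> z l \<and> z l < 1) \<Longrightarrow>
      (\<lambda>n. \<integral>\<omega>. (\<Prod>l\<in>I. z l ^ N n l \<omega>) \<partial>M) \<longlonglongrightarrow> (\<integral>\<omega>. (\<Prod>l\<in>I. z l ^ N' l \<omega>) \<partial>M')"
  shows "(\<lambda>n. measure M {\<omega> \<in> space M. \<forall>l\<in>I. N n l \<omega> = c l}) \<longlonglongrightarrow>
    measure M' {\<omega> \<in> space M'. \<forall>l\<in>I. N' l \<omega> = c l}"
proof -
  interpret M: prob_space M by fact
  interpret M': prob_space M' by fact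
  \<comment> \<open>Interpolates between the generating function (\<open>J\<close> empty) and the
    indicator of the event (\<open>J = I\<close>).\<close>
  define V where "V J z f = (\<Prod>l\<in>J. of_bool (f l = c l)) * (\<Prod>l\<in>I - J. z l ^ f l)"
    for J and z :: "'i \<Rightarrow> real" and f
  have "(\<lambda>n. \<integral>\<omega>. V J z (\<lambda>l. N n l \<omega>) \<partial>M) \<longlonglongrightarrow> (\<integral>\<omega>. V J z (\<lambda>l. N' l \<omega>) \<partial>M')"
    if "J \<subseteq> I" "\<And>l. 0 \<le> z l \<and> z l < 1" for J and z :: "'i \<Rightarrow> real"
    using finite_subset[OF that(1) I] that
  proof (induction J arbitrary: z rule: finite_induct)
    case empty
    then show ?case using lim[of z] by (simp add: V_def)
  next
    case (insert j J)
    define U :: "('i \<Rightarrow> nat) \<Rightarrow> real" where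
      "U f = (\<Prod>l\<in>J. of_bool (f l = c l)) * (\<Prod>l\<in>I - insert j J. z l ^ f l)" for f
    have U01: "0 \<le> U f \<and> U f \<le> 1" for f
      unfolding U_def using insert.prems(2)
      by (auto intro!: mult_nonneg_nonneg prod_nonneg mult_le_one prod_le_1 power_le_one simp: less_imp_le)
    have Vins: "V (insert j J) z f = U f * of_bool (f j = c j)" for f
      using insert.hyps by (simp add: V_def U_def mult_ac)
    have VJ: "V J (z(j := y)) f = U f * y ^ f j" for f y
    proof -
      have eq: "I - J = insert j (I - insert j J)" using insert by auto
      have "(\<Prod>l\<in>I - J. (z(j := y)) l ^ f l) = y ^ f j * (\<Prod>l\<in>I - insert j J. (z(j := y)) l ^ f l)"
        unfolding eq by (subst prod.insert) (use I in auto)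
      also have "(\<Prod>l\<in>I - insert j J. (z(j := y)) l ^ f l) = (\<Prod>l\<in>I - insert j J. z l ^ f l)"
        by (intro prod.cong) auto
      finally show ?thesis by (simp add: V_def U_def mult_ac)
    qed
    have U_meas: "(\<lambda>\<omega>. U (\<lambda>l. N n l \<omega>)) \<in> borel_measurable M" "(\<lambda>\<omega>. U (\<lambda>l. N' l \<omega>)) \<in> borel_measurable M'" for n
      unfolding U_def by measurable
    note [measurable] = U_meas
    have "(\<lambda>n. M.expectation (\<lambda>\<omega>. U (\<lambda>l. N n l \<omega>) * of_bool (N n j \<omega> = c j)))
      \<longlonglongrightarrow> M'.expectation (\<lambda>\<omega>. U (\<lambda>l. N' l \<omega>) * of_bool (N' j \<omega> = c j))"
    proof (rule power_series_coeff_tendsto)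
      show "\<bar>M.expectation (\<lambda>\<omega>. U (\<lambda>l. N n l \<omega>) * of_bool (N n j \<omega> = c))\<bar> \<le> 1" for n c
        using U01 by (intro M.abs_expectation_le) (auto simp: abs_mult mult_le_one)
      show "\<bar>M'.expectation (\<lambda>\<omega>. U (\<lambda>l. N' l \<omega>) * of_bool (N' j \<omega> = c))\<bar> \<le> 1" for c
        using U01 by (intro M'.abs_expectation_le) (auto simp: abs_mult mult_le_one)
      fix y :: real assume y: "0 < y" "y < 1"
      have "(\<Sum>c. M.expectation (\<lambda>\<omega>. U (\<lambda>l. N n l \<omega>) * of_bool (N n j \<omega> = c)) * y ^ c)
         = M.expectation (\<lambda>\<omega>. V J (z(j := y)) (\<lambda>l. N n l \<omega>))" for n
        unfolding VJ using y U01 by (intro sums_unique[symmetric] M.expectation_power_sums) auto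
      moreover have "(\<Sum>c. M'.expectation (\<lambda>\<omega>. U (\<lambda>l. N' l \<omega>) * of_bool (N' j \<omega> = c)) * y ^ c)
         = M'.expectation (\<lambda>\<omega>. V J (z(j := y)) (\<lambda>l. N' l \<omega>))"
        unfolding VJ using y U01 by (intro sums_unique[symmetric] M'.expectation_power_sums) auto
      moreover have "(\<lambda>n. \<integral>\<omega>. V J (z(j := y)) (\<lambda>l. N n l \<omega>) \<partial>M) \<longlonglongrightarrow> (\<integral>\<omega>. V J (z(j := y)) (\<lambda>l. N' l \<omega>) \<partial>M')"
        using insert y by (intro insert.IH) auto
      ultimately show "(\<lambda>n. \<Sum>c. M.expectation (\<lambda>\<omega>. U (\<lambda>l. N n l \<omega>) * of_bool (N n j \<omega> = c)) * y ^ c)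
        \<longlonglongrightarrow> (\<Sum>c. M'.expectation (\<lambda>\<omega>. U (\<lambda>l. N' l \<omega>) * of_bool (N' j \<omega> = c)) * y ^ c)"
        by simp
    qed
    thus ?case by (simp add: Vins)
  qed
  from this[of I "\<lambda>_. 0"]
  have *: "(\<lambda>n. \<integral>\<omega>. V I (\<lambda>_. 0) (\<lambda>l. N n l \<omega>) \<partial>M) \<longlonglongrightarrow> (\<integral>\<omega>. V I (\<lambda>_. 0) (\<lambda>l. N' l \<omega>) \<partial>M')"
    by simp
  have VI: "V I (\<lambda>_. 0) f = of_bool (\<forall>l\<in>I. f l = c l)" for f
    using I by (auto simp: V_def prod_zero_iff)
  have "(\<integral>\<omega>. of_bool (\<forall>l\<in>I. N n l \<omega> = c l) \<partial>M) = measure M {\<omega> \<in> space M. \<forall>l\<in>I. N n l \<omega> = c l}" for n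
    using I by (intro M.expectation_of_bool) measurable
  moreover have "(\<integral>\<omega>. of_bool (\<forall>l\<in>I. N' l \<omega> = c l) \<partial>M') = measure M' {\<omega> \<in> space M'. \<forall>l\<in>I. N' l \<omega> = c l}"
    using I by (intro M'.expectation_of_bool) measurable
  ultimately show ?thesis using * by (simp add: VI)
qed

section \<open>From point probabilities to bounded functions of the counts\<close>

lemma (in prob_space) expectation_finite_range_approx:
  fixes F :: "'b \<Rightarrow> real"
  assumes V[measurable]: "V \<in> measurable M (count_space UNIV)" 
    and F: "\<And>v. \<bar>F v\<bar> \<le> B" and S: "finite S"
  shows "\<bar>expectation (\<lambda>\<omega>. F (V \<omega>)) - (\<Sum>c\<in>S. F c * prob {\<omega> \<in> space M. V \<omega> = c})\<bar>
    \<le> B * (1 - (\<Sum>c\<in>S. prob {\<omega> \<in> space M. V \<omega> = c}))"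
proof -
  have ev: "{\<omega> \<in> space M. V \<omega> = c} \<in> events" for c by measurable
  have [measurable]: "(\<lambda>\<omega>. F (V \<omega>)) \<in> borel_measurable M" by (rule measurable_compose[OF V]) simp
  have int1: "integrable M (\<lambda>\<omega>. F (V \<omega>))"
    by (rule integrable_const_bound[where B = B]) (use F in auto)
  have int_ind: "integrable M (\<lambda>\<omega>. of_bool (V \<omega> = c) :: real)" for c
    by (rule integrable_const_bound[where B = 1]) auto
  have e: "expectation (\<lambda>\<omega>. of_bool (V \<omega> = c)) = prob {\<omega> \<in> space M. V \<omega> = c}" for c
    by (intro expectation_of_bool ev)
  have int2: "integrable M (\<lambda>\<omega>. \<Sum>c\<in>S. F c * of_bool (V \<omega> = c))"
    by (intro Bochner_Integration.integrable_sum integrable_mult_right int_ind)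
  have int3: "integrable M (\<lambda>\<omega>. B * (1 - (\<Sum>c\<in>S. of_bool (V \<omega> = c))))"
    by (intro Bochner_Integration.integrable_sum integrable_mult_right Bochner_Integration.integrable_diff int_ind) auto
  have s: "(\<Sum>c\<in>S. G c * of_bool (V \<omega> = c)) = of_bool (V \<omega> \<in> S) * G (V \<omega>)" for G :: "'b \<Rightarrow> real" and \<omega>
  proof -
    have "(\<Sum>c\<in>S. G c * of_bool (V \<omega> = c)) = (\<Sum>c\<in>S. if V \<omega> = c then G c else 0)"
      by (intro sum.cong) auto
    thus ?thesis using S by simp
  qed
  have "expectation (\<lambda>\<omega>. F (V \<omega>)) - (\<Sum>c\<in>S. F c * prob {\<omega> \<in> space M. V \<omega> = c})
      = expectation (\<lambda>\<omega>. F (V \<omega>) - (\<Sum>c\<in>S. F c * of_bool (V \<omega> = c)))"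
    using int1 int2 int_ind by (simp add: e Bochner_Integration.integral_sum)
  also have "\<bar>\<dots>\<bar> \<le> expectation (\<lambda>\<omega>. \<bar>F (V \<omega>) - (\<Sum>c\<in>S. F c * of_bool (V \<omega> = c))\<bar>)"
    by (rule integral_abs_bound)
  also have "\<dots> \<le> expectation (\<lambda>\<omega>. B * (1 - (\<Sum>c\<in>S. of_bool (V \<omega> = c))))"
  proof (rule integral_mono)
    show "integrable M (\<lambda>\<omega>. \<bar>F (V \<omega>) - (\<Sum>c\<in>S. F c * of_bool (V \<omega> = c))\<bar>)"
      using int1 int2 by auto
    show "\<bar>F (V \<omega>) - (\<Sum>c\<in>S. F c * of_bool (V \<omega> = c))\<bar> \<le> B * (1 - (\<Sum>c\<in>S. of_bool (V \<omega> = c)))" for \<omega>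
      using s[of F \<omega>] s[of "\<lambda>_. 1" \<omega>] F[of "V \<omega>"] by (auto simp: of_bool_def split: if_splits)
  qed (rule int3)
  also have "\<dots> = B * (1 - (\<Sum>c\<in>S. prob {\<omega> \<in> space M. V \<omega> = c}))"
    using int_ind by (simp add: e Bochner_Integration.integral_sum prob_space)
  finally show ?thesis .
qed

lemma countable_PiE_nat: "finite I \<Longrightarrow> countable (PiE I (\<lambda>_. UNIV :: nat set))"
  by (simp add: countable_PiE)

lemma measurable_restrict_nat:
  assumes "finite I" and [measurable]: "\<And>l. N l \<in> measurable M (count_space (UNIV :: nat set))"
  shows "(\<lambda>\<omega>. \<lambda>l\<in>I. N l \<omega>) \<in> measurable M (count_space UNIV)"
proof -
  have "(\<lambda>\<omega>. \<lambda>l\<in>I. N l \<omega>) \<in> measurable M (count_space (PiE I (\<lambda>_. UNIV)))"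
  proof (subst measurable_count_space_eq_countable[OF countable_PiE_nat[OF assms(1)]], safe)
    fix f assume "f \<in> PiE I (\<lambda>_. UNIV :: nat set)"
    hence "(\<lambda>\<omega>. \<lambda>l\<in>I. N l \<omega>) -` {f} \<inter> space M = {\<omega> \<in> space M. \<forall>l\<in>I. N l \<omega> = f l}"
      by (auto simp: PiE_def extensional_def restrict_def fun_eq_iff)
    also have "\<dots> \<in> sets M" using assms(1) by measurable
    finally show "(\<lambda>\<omega>. \<lambda>l\<in>I. N l \<omega>) -` {f} \<inter> space M \<in> sets M" .
  qed auto
  from measurable_compose[OF this, of "\<lambda>f. f" "count_space UNIV"] show ?thesis by simp
qed

text \<open>A finite box carries almost all of the limit mass. Since its finitely many point
  probabilities converge, the same box carries almost all of the mass for large \<open>n\<close>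
  too, so no mass escapes.\<close>

lemma joint_expectation_tendsto:
  fixes N :: "nat \<Rightarrow> 'i \<Rightarrow> 'a \<Rightarrow> nat" and N' :: "'i \<Rightarrow> 'b \<Rightarrow> nat" and F :: "('i \<Rightarrow> nat) \<Rightarrow> real"
  assumes "prob_space M" "prob_space M'" and I: "finite I"
    and meas[measurable]: "\<And>n l. N n l \<in> measurable M (count_space UNIV)"
      "\<And>l. N' l \<in> measurable M' (count_space UNIV)"
    and lim: "\<And>c. (\<lambda>n. measure M {\<omega> \<in> space M. \<forall>l\<in>I. N n l \<omega> = c l}) \<longlonglongrightarrow>
      measure M' {\<omega> \<in> space M'. \<forall>l\<in>I. N' l \<omega> = c l}"
    and F: "\<And>v. \<bar>F v\<bar> \<le> B"
  shows "(\<lambda>n. \<integral>\<omega>. F (\<lambda>l\<in>I. N n l \<omega>) \<partial>M) \<longlonglongrightarrow> (\<integral>\<omega>. F (\<lambda>l\<in>I. N' l \<omega>) \<partial>M')"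
proof -
  interpret M: prob_space M by fact
  interpret M': prob_space M' by fact
  have B: "0 \<le> B" using F[of undefined] by linarith
  define p where "p n c = M.prob {\<omega> \<in> space M. (\<lambda>l\<in>I. N n l \<omega>) = c}" for n c
  define p' where "p' c = M'.prob {\<omega> \<in> space M'. (\<lambda>l\<in>I. N' l \<omega>) = c}" for c
  define S where "S v = PiE I (\<lambda>_. {..v :: nat})" for v
  have fin: "finite (S v)" for v unfolding S_def using I by (intro finite_PiE) auto
  have eq: "(\<lambda>l\<in>I. f l) = c \<longleftrightarrow> (\<forall>l\<in>I. f l = c l)" if "c \<in> S v" for f c v
    using that by (auto simp: S_def PiE_def extensional_def restrict_def fun_eq_iff)
  have p: "(\<lambda>n. p n c) \<longlonglongrightarrow> p' c" if "c \<in> S v" for c v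
    unfolding p_def p'_def eq[OF that] by (rule lim)
  have mN: "(\<lambda>\<omega>. \<lambda>l\<in>I. N n l \<omega>) \<in> measurable M (count_space UNIV)" for n
    by (rule measurable_restrict_nat[OF I]) measurable
  have mN': "(\<lambda>\<omega>. \<lambda>l\<in>I. N' l \<omega>) \<in> measurable M' (count_space UNIV)"
    by (rule measurable_restrict_nat[OF I]) measurable
  note [measurable] = mN mN'
  have S1: "(\<lambda>v. \<Sum>c\<in>S v. p' c) \<longlonglongrightarrow> 1"
  proof -
    define A where "A v = {\<omega> \<in> space M'. (\<lambda>l\<in>I. N' l \<omega>) \<in> S v}" for v
    have Ap: "M'.prob (A v) = (\<Sum>c\<in>S v. p' c)" for v
    proof -
      have "A v = (\<Union>c\<in>S v. {\<omega> \<in> space M'. (\<lambda>l\<in>I. N' l \<omega>) = c})" by (auto simp: A_def)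
      thus ?thesis unfolding p'_def using fin
        by (auto intro!: M'.finite_measure_finite_Union simp: disjoint_family_on_def)
    qed
    have "(\<lambda>v. M'.prob (A v)) \<longlonglongrightarrow> M'.prob (\<Union>v. A v)"
    proof (rule M'.finite_Lim_measure_incseq)
      show "range A \<subseteq> M'.events" using measurable_sets[OF mN', of "S v" for v]
        by (auto simp: A_def vimage_def Int_def conj_commute)
      show "incseq A" unfolding incseq_def A_def S_def by (fastforce simp: PiE_iff)
    qed
    moreover have "(\<Union>v. A v) = space M'"
    proof -
      have "\<omega> \<in> A (Max ((\<lambda>l. N' l \<omega>) ` I))" if "\<omega> \<in> space M'" for \<omega>
        using that I by (auto simp: A_def S_def)
      thus ?thesis by (auto simp: A_def)
    qed
    ultimately show ?thesis by (simp add: Ap M'.prob_space)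
  qed
  show ?thesis
  proof (rule LIMSEQ_I)
    fix \<epsilon> :: real assume \<epsilon>: "\<epsilon> > 0"
    define \<delta> where "\<delta> = \<epsilon> / (4 * (B + 1))"
    have \<delta>: "\<delta> > 0" "B * \<delta> < \<epsilon> / 4" using \<epsilon> B by (auto simp: \<delta>_def field_simps)
    have "\<forall>\<^sub>F v in sequentially. (\<Sum>c\<in>S v. p' c) > 1 - \<delta>"
      using \<delta> by (intro order_tendstoD[OF S1]) auto
    then obtain v where v: "(\<Sum>c\<in>S v. p' c) > 1 - \<delta>" by (auto simp: eventually_sequentially)
    let ?E = "\<lambda>n. \<integral>\<omega>. F (\<lambda>l\<in>I. N n l \<omega>) \<partial>M" and ?E' = "\<integral>\<omega>. F (\<lambda>l\<in>I. N' l \<omega>) \<partial>M'"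
    have a: "\<bar>?E n - (\<Sum>c\<in>S v. F c * p n c)\<bar> \<le> B * (1 - (\<Sum>c\<in>S v. p n c))" for n
      unfolding p_def by (rule M.expectation_finite_range_approx[OF mN F fin])
    have b: "\<bar>?E' - (\<Sum>c\<in>S v. F c * p' c)\<bar> \<le> B * (1 - (\<Sum>c\<in>S v. p' c))"
      unfolding p'_def by (rule M'.expectation_finite_range_approx[OF mN' F fin])
    have "B * (1 - (\<Sum>c\<in>S v. p' c)) \<le> B * \<delta>" using v B by (intro mult_left_mono) auto
    with \<delta> have b': "B * (1 - (\<Sum>c\<in>S v. p' c)) < \<epsilon> / 4" by linarith
    have "(\<lambda>n. B * (1 - (\<Sum>c\<in>S v. p n c))) \<longlonglongrightarrow> B * (1 - (\<Sum>c\<in>S v. p' c))"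
      by (intro tendsto_intros p)
    hence e1: "\<forall>\<^sub>F n in sequentially. B * (1 - (\<Sum>c\<in>S v. p n c)) < \<epsilon> / 4"
      using b' by (intro order_tendstoD)
    have "(\<lambda>n. \<Sum>c\<in>S v. F c * p n c) \<longlonglongrightarrow> (\<Sum>c\<in>S v. F c * p' c)" by (intro tendsto_intros p)
    hence e2: "\<forall>\<^sub>F n in sequentially. dist (\<Sum>c\<in>S v. F c * p n c) (\<Sum>c\<in>S v. F c * p' c) < \<epsilon> / 4"
      using \<epsilon> by (intro tendstoD) auto
    have "\<forall>\<^sub>F n in sequentially. norm (?E n - ?E') < \<epsilon>"
      using e1 e2
    proof eventually_elim
      case (elim n)
      then show ?case using a[of n] b b' \<epsilon> unfolding dist_real_def real_norm_def by linarith
    qed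
    thus "\<exists>no. \<forall>n\<ge>no. norm (?E n - ?E') < \<epsilon>" by (simp add: eventually_sequentially)
  qed
qed

section \<open>Weak convergence of point processes in the unit interval\<close>

definition grid_index :: "nat \<Rightarrow> real \<Rightarrow> nat" where "grid_index L x = nat \<lfloor>real L * x\<rfloor>"
text \<open>Since g is uniformly continuous on configurations with a bounded number of points, testing
  against g reduces to testing against g composed with snap, which only depends on cell counts.\<close>

definition snap :: "nat \<Rightarrow> real multiset \<Rightarrow> real multiset" where
  "snap L m = image_mset (\<lambda>x. real (grid_index L x) / real L) m"

text \<open>For \<open>L > 0\<close> the unit interval meets the cells 0 to \<open>L\<close>, and
  cell \<open>L\<close> only in the point 1. Sums over cells therefore run over
  \<open>{..L}\<close>.\<close>

definition cell :: "nat \<Rightarrow> nat \<Rightarrow> real set" where "cell L l = {x. grid_index L x = l}"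

lemma measurable_grid_index [measurable]: "grid_index L \<in> measurable borel (count_space UNIV)"
  unfolding grid_index_def by measurable

lemma sets_cell [measurable]: "cell L l \<in> sets borel"
proof -
  have "cell L l = grid_index L -` {l} \<inter> space borel" by (auto simp: cell_def)
  also have "\<dots> \<in> sets borel" by measurable
  finally show ?thesis .
qed

lemma grid_index_le: "x \<in> {0..1} \<Longrightarrow> grid_index L x \<le> L"
proof -
  assume "x \<in> {0..1}"
  hence "real L * x \<le> real L * 1" by (intro mult_left_mono) auto
  hence "\<lfloor>real L * x\<rfloor> \<le> int L" by linarith
  thus ?thesis by (simp add: grid_index_def)
qed

lemma snap_close:
  assumes "x \<in> {0..1}" "L > 0"
  shows "real (grid_index L x) / real L \<in> {0..1}" "\<bar>real (grid_index L x) / real L - x\<bar> \<le> 1 / real L"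
proof -
  show "real (grid_index L x) / real L \<in> {0..1}" using grid_index_le[OF assms(1), of L] assms by (auto simp: field_simps)
  have "0 \<le> real L * x" using assms by auto
  hence "real (grid_index L x) = real_of_int \<lfloor>real L * x\<rfloor>" by (simp add: grid_index_def)
  hence "\<bar>real (grid_index L x) - real L * x\<bar> \<le> 1" by linarith
  hence "\<bar>real (grid_index L x) - real L * x\<bar> / real L \<le> 1 / real L" using assms by (intro divide_right_mono) auto
  also have "\<bar>real (grid_index L x) - real L * x\<bar> / real L = \<bar>(real (grid_index L x) - real L * x) / real L\<bar>"
    by simp
  also have "(real (grid_index L x) - real L * x) / real L = real (grid_index L x) / real L - x"
    using assms by (simp add: field_simps)
  finally show "\<bar>real (grid_index L x) / real L - x\<bar> \<le> 1 / real L" .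
qed

lemma points_in_simps [simp]:
  "points_in {#} B = 0" "points_in (add_mset x m) B = of_bool (x \<in> B) + points_in m B"
  "points_in (m + m') B = points_in m B + points_in m' B"
  by (auto simp: points_in_def)

lemma points_in_UNIV [simp]: "points_in m UNIV = size m" by (simp add: points_in_def)

lemma prod_points_in_cell:
  fixes z :: "nat \<Rightarrow> real"
  assumes "set_mset m \<subseteq> {0..1}"
  shows "(\<Prod>l\<in>{..L}. z l ^ points_in m (cell L l)) = (\<Prod>x\<in>#m. z (grid_index L x))"
  using assms
proof (induction m)
  case (add x m)
  have "(\<Prod>l\<in>{..L}. z l ^ of_bool (x \<in> cell L l)) = (\<Prod>l\<in>{..L}. if l = grid_index L x then z l else 1)"
    by (intro prod.cong) (auto simp: cell_def)
  also have "\<dots> = z (grid_index L x)" using grid_index_le[of x L] add.prems by simp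
  finally show ?case using add by (simp add: power_add prod.distrib)
qed simp

lemma snap_eq:
  assumes "set_mset m \<subseteq> {0..1}"
  shows "snap L m = (\<Sum>l\<in>{..L}. replicate_mset (points_in m (cell L l)) (real l / real L))"
  using assms
proof (induction m)
  case (add x m)
  have "(\<Sum>l\<in>{..L}. replicate_mset (of_bool (x \<in> cell L l)) (real l / real L)) =
      (\<Sum>l\<in>{..L}. if l = grid_index L x then {#real l / real L#} else {#})"
    by (intro sum.cong) (auto simp: cell_def)
  also have "\<dots> = {#real (grid_index L x) / real L#}" using grid_index_le[of x L] add.prems by simp
  finally have *: "(\<Sum>l\<in>{..L}. replicate_mset (of_bool (x \<in> cell L l)) (real l / real L)) =
    {#real (grid_index L x) / real L#}" .
  have "replicate_mset (a + b) y = replicate_mset a y + replicate_mset b y" for a b and y :: real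
    by (metis repeat_mset_distrib repeat_mset_replicate_mset mult.right_neutral)
  with * show ?case using add by (simp add: sum.distrib snap_def)
qed (simp add: snap_def)

lemma size_eq_sum_cells:
  assumes "set_mset m \<subseteq> {0..1}"
  shows "size m = (\<Sum>l\<in>{..L}. points_in m (cell L l))"
  using arg_cong[OF snap_eq[OF assms, of L], of size] by (simp add: snap_def size_multiset_sum)

lemma topspace_vague_topology: "topspace vague_topology = {m. set_mset m \<subseteq> {0..1}}"
  by (auto simp: vague_topology_def topspace_pullback_topology)

text \<open>Configurations of \<open>r\<close> points are parametrised by infinite sequences of
  which only the first \<open>r\<close> terms are read. For every \<open>r\<close> the domain is
  then the same compact metrizable cube.\<close>

lemma continuous_map_mset_vague:
  "continuous_map (subtopology euclidean (UNIV \<rightarrow> {0..1}))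
     vague_topology (\<lambda>x. mset (map x [0..<r]))"
  unfolding vague_topology_def
proof (rule continuous_map_pullback')
  show "topspace (subtopology euclidean (UNIV \<rightarrow> {0..1})) \<subseteq> (\<lambda>x. mset (map x [0..<r])) -` {m. set_mset m \<subseteq> {0..1 :: real}}"
    by auto
  show "continuous_map (top_of_set (UNIV \<rightarrow> {0..1}))
     (product_topology (\<lambda>_. euclideanreal) {f. continuous_on {0..1 :: real} f})
     ((\<lambda>m. \<lambda>f\<in>{f. continuous_on {0..1} f}. \<Sum>x\<in>#m. f x) \<circ> (\<lambda>x. mset (map x [0..<r])))"
    unfolding continuous_map_componentwise
  proof (intro conjI ballI)
    fix f :: "real \<Rightarrow> real" assume f: "f \<in> {f. continuous_on {0..1} f}"
    have "continuous_on (UNIV \<rightarrow> {0..1}) (\<lambda>x. \<Sum>i<r. f (x i))"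
    proof (intro continuous_intros)
      fix i
      show "continuous_on (UNIV \<rightarrow> {0..1}) (\<lambda>x. f (x i))"
        by (rule continuous_on_compose2[of "{0..1}" f]) (use f in \<open>auto intro!: continuous_on_product_then_coordinatewise continuous_on_id\<close>)
    qed
    moreover have "(\<Sum>y\<in>#mset (map x [0..<r]). f y) = (\<Sum>i<r. f (x i))" for x :: "nat \<Rightarrow> real"
      by (simp only: mset_map[symmetric] map_map sum_mset_sum_list comp_def interv_sum_list_conv_sum_set_nat
          set_upt lessThan_atLeast0)
    ultimately show "continuous_map (top_of_set (UNIV \<rightarrow> {0..1})) euclideanreal
       (\<lambda>x. ((\<lambda>m. \<lambda>f\<in>{f. continuous_on {0..1} f}. \<Sum>x\<in>#m. f x) \<circ> (\<lambda>x. mset (map x [0..<r]))) x f)"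
      using f by (simp del: mset_map)
  qed auto
qed

lemma tendsto_fun_iff:
  fixes f :: "'c \<Rightarrow> 'i \<Rightarrow> 'b :: topological_space"
  shows "(f \<longlongrightarrow> l) F \<longleftrightarrow> (\<forall>i. ((\<lambda>c. f c i) \<longlongrightarrow> l i) F)"
  by (simp add: limitin_componentwise flip: limitin_canonical_iff euclidean_product_topology)

text \<open>By compactness: counterexamples on ever finer grids have a convergent subsequence.
  Snapping moves each point by at most \<open>1 / L\<close>, so the snapped configurations have the
  same limit, which contradicts continuity of \<open>g\<close> there.\<close>

lemma vague_continuous_snap:
  assumes g: "continuous_map vague_topology euclideanreal g" and "\<epsilon> > 0"
  shows "\<exists>L0>0. \<forall>L\<ge>L0. \<forall>m. set_mset m \<subseteq> {0..1} \<and> size m = r \<longrightarrow> \<bar>g m - g (snap L m)\<bar> < \<epsilon>"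
proof (rule ccontr)
  assume "\<not> ?thesis"
  hence "\<forall>i. \<exists>L m. L \<ge> Suc i \<and> set_mset m \<subseteq> {0..1} \<and> size m = r \<and> \<bar>g m - g (snap L m)\<bar> \<ge> \<epsilon>"
    by (metis zero_less_Suc not_less)
  then obtain L m where L: "\<And>i. L i \<ge> Suc i" and m: "\<And>i. set_mset (m i) \<subseteq> {0..1}" "\<And>i. size (m i) = r"
    and far: "\<And>i. \<bar>g (m i) - g (snap (L i) (m i))\<bar> \<ge> \<epsilon>" by metis
  have "\<exists>x. x \<in> UNIV \<rightarrow> {0..1} \<and> mset (map x [0..<r]) = m i" for i
  proof -
    obtain xs where xs: "mset xs = m i" using ex_mset by blast
    have len: "length xs = r" using m(2)[of i] xs by (metis size_mset)
    \<comment> \<open>Padding with 0 keeps the sequence in the cube; coordinates from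
      \<open>r\<close> on are never read.\<close>
    let ?x = "\<lambda>j. if j < r then xs ! j else 0"
    have "map ?x [0..<r] = xs" using len by (auto intro!: nth_equalityI)
    moreover have "?x \<in> UNIV \<rightarrow> {0..1}" 
    proof (intro Pi_I)
      fix j show "?x j \<in> {0..1}"
      proof (cases "j < r")
        case True
        hence "xs ! j \<in> set_mset (m i)" using len xs by (metis nth_mem set_mset_mset)
        thus ?thesis using m(1)[of i] True by auto
      qed auto
    qed
    ultimately show ?thesis using xs by metis
  qed
  then obtain x where x: "\<And>i. x i \<in> UNIV \<rightarrow> {0..1}" "\<And>i. mset (map (x i) [0..<r]) = m i" by metis
  define y where "y i j = real (grid_index (L i) (x i j)) / real (L i)" for i j
  have Lpos: "L i > 0" for i using L[of i] by linarith
  have xi: "x i j \<in> {0..1}" for i j using x(1)[of i] by auto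
  have y1: "y i \<in> UNIV \<rightarrow> {0..1}" for i using snap_close(1)[OF xi Lpos] by (auto simp: y_def)
  have y2: "mset (map (y i) [0..<r]) = snap (L i) (m i)" for i
    unfolding x(2)[symmetric] snap_def y_def by (simp add: multiset.map_comp comp_def)
  have "compact (UNIV \<rightarrow> {0..1} :: (nat \<Rightarrow> real) set)"
  proof -
    have "compactin (product_topology (\<lambda>_. euclideanreal) UNIV) (PiE UNIV (\<lambda>_ :: nat. {0..1}))"
      by (subst compactin_PiE) auto
    thus ?thesis by (simp add: euclidean_product_topology PiE_UNIV_domain)
  qed
  hence "seq_compact (UNIV \<rightarrow> {0..1} :: (nat \<Rightarrow> real) set)" by (simp add: compact_eq_seq_compact_metric)
  then obtain l \<sigma> where l: "l \<in> UNIV \<rightarrow> {0..1}" and \<sigma>: "strict_mono \<sigma>" "(x \<circ> \<sigma>) \<longlonglongrightarrow> l"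
    using x(1) unfolding seq_compact_def by metis
  have lx: "(\<lambda>i. x (\<sigma> i) j) \<longlonglongrightarrow> l j" for j
    using \<sigma>(2) by (simp add: tendsto_fun_iff)
  have ly: "(\<lambda>i. y (\<sigma> i) j) \<longlonglongrightarrow> l j" for j
  proof -
    have "(\<lambda>i. y (\<sigma> i) j - x (\<sigma> i) j) \<longlonglongrightarrow> 0"
    proof (rule Lim_null_comparison)
      show "\<forall>\<^sub>F i in sequentially. norm (y (\<sigma> i) j - x (\<sigma> i) j) \<le> 1 / real (Suc i)"
      proof (intro always_eventually allI)
        fix i
        have "norm (y (\<sigma> i) j - x (\<sigma> i) j) \<le> 1 / real (L (\<sigma> i))"
          unfolding y_def real_norm_def by (rule snap_close(2)[OF xi Lpos])
        also have "\<dots> \<le> 1 / real (Suc i)"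
          using L[of "\<sigma> i"] seq_suble[OF \<sigma>(1), of i] by (intro divide_left_mono) auto
        finally show "norm (y (\<sigma> i) j - x (\<sigma> i) j) \<le> 1 / real (Suc i)" .
      qed
    qed (rule LIMSEQ_Suc[OF lim_1_over_n])
    from tendsto_add[OF this lx[of j]] show ?thesis by simp
  qed
  let ?G = "\<lambda>x. g (mset (map x [0..<r]))"
  have G: "continuous_on (UNIV \<rightarrow> {0..1}) ?G"
    using continuous_map_compose[OF continuous_map_mset_vague g] by (simp add: comp_def del: mset_map)
  have "(\<lambda>i. ?G (x (\<sigma> i))) \<longlonglongrightarrow> ?G l"
    by (rule continuous_on_tendsto_compose[OF G _ l]) (use \<sigma> x in \<open>auto simp: comp_def\<close>)
  moreover have "(\<lambda>i. ?G (y (\<sigma> i))) \<longlonglongrightarrow> ?G l"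
  proof (rule continuous_on_tendsto_compose[OF G _ l])
    show "(\<lambda>i. y (\<sigma> i)) \<longlonglongrightarrow> l" using ly by (simp add: tendsto_fun_iff)
  qed (use y1 in auto)
  ultimately have "(\<lambda>i. ?G (x (\<sigma> i)) - ?G (y (\<sigma> i))) \<longlonglongrightarrow> ?G l - ?G l" by (rule tendsto_diff)
  hence "(\<lambda>i. ?G (x (\<sigma> i)) - ?G (y (\<sigma> i))) \<longlonglongrightarrow> 0" by simp
  from tendstoD[OF this \<open>\<epsilon> > 0\<close>] obtain i where "\<bar>?G (x (\<sigma> i)) - ?G (y (\<sigma> i))\<bar> < \<epsilon>"
    by (auto simp: eventually_sequentially simp del: mset_map)
  thus False using far[of "\<sigma> i"] x(2)[of "\<sigma> i"] y2[of "\<sigma> i"] by (simp del: mset_map)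
qed

lemma point_processD:
  assumes "point_process M N"
  shows "prob_space M" "\<And>\<omega>. \<omega> \<in> space M \<Longrightarrow> set_mset (N \<omega>) \<subseteq> {0..1}"
    "\<And>B. B \<in> sets borel \<Longrightarrow> (\<lambda>\<omega>. points_in (N \<omega>) B) \<in> measurable M (count_space UNIV)"
  using assms by (auto simp: point_process_def)

definition snap_of_counts :: "nat \<Rightarrow> (nat \<Rightarrow> nat) \<Rightarrow> real multiset" where
  "snap_of_counts L v = (\<Sum>l\<in>{..L}. replicate_mset (v l) (real l / real L))"

lemma snap_subset: "set_mset m \<subseteq> {0..1} \<Longrightarrow> L > 0 \<Longrightarrow> set_mset (snap L m) \<subseteq> {0..1}"
  using snap_close(1)[of _ L] by (auto simp: snap_def)

lemma snap_eq_counts: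
  assumes "set_mset m \<subseteq> {0..1}"
  shows "snap L m = snap_of_counts L (\<lambda>l\<in>{..L}. points_in m (cell L l))"
  unfolding snap_eq[OF assms] snap_of_counts_def by (intro sum.cong) auto

text \<open>Here \<open>g\<close> is arbitrary: a snapped configuration is a function of finitely
  many integer counts, and on such a discrete range every function is measurable.\<close>

lemma measurable_compose_snap:
  fixes g :: "real multiset \<Rightarrow> real"
  assumes "point_process M N"
  shows "(\<lambda>\<omega>. g (snap L (N \<omega>))) \<in> borel_measurable M"
proof -
  have "(\<lambda>\<omega>. \<lambda>l\<in>{..L}. points_in (N \<omega>) (cell L l)) \<in> measurable M (count_space UNIV)"
    by (intro measurable_restrict_nat point_processD(3)[OF assms]) auto
  hence "(\<lambda>\<omega>. g (snap_of_counts L (\<lambda>l\<in>{..L}. points_in (N \<omega>) (cell L l)))) \<in> borel_measurable M"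
    by (rule measurable_compose) simp
  moreover have "g (snap_of_counts L (\<lambda>l\<in>{..L}. points_in (N \<omega>) (cell L l))) = g (snap L (N \<omega>))"
    if "\<omega> \<in> space M" for \<omega>
    using snap_eq_counts[OF point_processD(2)[OF assms that]] by simp
  ultimately show ?thesis by (subst (asm) measurable_cong) auto
qed

text \<open>Pointwise limit along refining grids. For a fixed outcome the number of points is fixed,
  so \<open>vague_continuous_snap\<close> applies to it.\<close>

lemma measurable_compose_vague:
  assumes N: "point_process M N" and g: "continuous_map vague_topology euclideanreal g"
  shows "(\<lambda>\<omega>. g (N \<omega>)) \<in> borel_measurable M"
proof (rule borel_measurable_LIMSEQ_real)
  fix \<omega> assume "\<omega> \<in> space M"
  hence sub: "set_mset (N \<omega>) \<subseteq> {0..1}" by (rule point_processD(2)[OF N])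
  show "(\<lambda>L. g (snap L (N \<omega>))) \<longlonglongrightarrow> g (N \<omega>)"
  proof (rule LIMSEQ_I)
    fix r :: real assume "r > 0"
    from vague_continuous_snap[OF g this, of "size (N \<omega>)"] sub
    show "\<exists>no. \<forall>L\<ge>no. norm (g (snap L (N \<omega>)) - g (N \<omega>)) < r"
      by (metis abs_minus_commute real_norm_def)
  qed
qed (rule measurable_compose_snap[OF N])

text \<open>On configurations with at most \<open>R\<close> points, \<open>g\<close> is uniformly
  close to its snapped version. The probability of more than \<open>R\<close> points is small in the
  limit, hence for large \<open>n\<close>. The snapped version is a bounded function of the cell
  counts.\<close>

lemma converges_in_distributionI:
  assumes pp: "\<And>n. point_process M (\<Phi> n)" "point_process M' \<Psi>"
    and lim: "\<And>L (z :: nat \<Rightarrow> real). L > 0 \<Longrightarrow> (\<And>l. 0 \<le> z l \<and> z l < 1) \<Longrightarrow>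
      (\<lambda>n. \<integral>\<omega>. (\<Prod>x\<in>#\<Phi> n \<omega>. z (grid_index L x)) \<partial>M) \<longlonglongrightarrow> (\<integral>\<omega>. (\<Prod>x\<in>#\<Psi> \<omega>. z (grid_index L x)) \<partial>M')"
  shows "converges_in_distribution M \<Phi> M' \<Psi>"
  unfolding converges_in_distribution_def
proof (intro conjI allI impI pp)
  interpret M: prob_space M using pp(1) by (rule point_processD)
  interpret M': prob_space M' using pp(2) by (rule point_processD)
  note sub = point_processD(2)[OF pp(1)] point_processD(2)[OF pp(2)]
  have E: "(\<lambda>n. \<integral>\<omega>. F (\<lambda>l\<in>{..L}. points_in (\<Phi> n \<omega>) (cell L l)) \<partial>M)
      \<longlonglongrightarrow> (\<integral>\<omega>. F (\<lambda>l\<in>{..L}. points_in (\<Psi> \<omega>) (cell L l)) \<partial>M')"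
    if "L > 0" and F: "\<And>v. \<bar>F v\<bar> \<le> B" for L B and F :: "(nat \<Rightarrow> nat) \<Rightarrow> real"
  proof (rule joint_expectation_tendsto[OF _ _ _ _ _ joint_pgf_tendsto F])
    fix z :: "nat \<Rightarrow> real" assume z: "\<And>l. 0 \<le> z l \<and> z l < 1"
    have "(\<integral>\<omega>. (\<Prod>l\<in>{..L}. z l ^ points_in (\<Phi> n \<omega>) (cell L l)) \<partial>M)
        = (\<integral>\<omega>. (\<Prod>x\<in>#\<Phi> n \<omega>. z (grid_index L x)) \<partial>M)" for n
      using sub by (intro Bochner_Integration.integral_cong prod_points_in_cell) auto
    moreover have "(\<integral>\<omega>. (\<Prod>l\<in>{..L}. z l ^ points_in (\<Psi> \<omega>) (cell L l)) \<partial>M')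
        = (\<integral>\<omega>. (\<Prod>x\<in>#\<Psi> \<omega>. z (grid_index L x)) \<partial>M')"
      using sub by (intro Bochner_Integration.integral_cong prod_points_in_cell) auto
    ultimately show "(\<lambda>n. \<integral>\<omega>. (\<Prod>l\<in>{..L}. z l ^ points_in (\<Phi> n \<omega>) (cell L l)) \<partial>M)
        \<longlonglongrightarrow> (\<integral>\<omega>. (\<Prod>l\<in>{..L}. z l ^ points_in (\<Psi> \<omega>) (cell L l)) \<partial>M')"
      using lim[OF \<open>L > 0\<close> z] by simp
  qed (auto intro: point_processD(3)[OF pp(1)] point_processD(3)[OF pp(2)] M.prob_space_axioms M'.prob_space_axioms)
  fix g assume "continuous_map vague_topology euclideanreal g \<and> bounded (g ` topspace vague_topology)"
  hence g: "continuous_map vague_topology euclideanreal g" and "bounded (g ` {m. set_mset m \<subseteq> {0..1}})"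
    by (auto simp: topspace_vague_topology)
  then obtain B where B: "\<And>m. set_mset m \<subseteq> {0..1} \<Longrightarrow> \<bar>g m\<bar> \<le> B"
    unfolding bounded_iff by auto
  have B0: "0 \<le> B" using B[of "{#}"] by auto
  \<comment> \<open>The grid with \<open>L = 1\<close> has the cells 0 and 1, whose counts add up to
    the total number of points. Tightness thus becomes an instance of \<open>E\<close>.\<close>
  have sz: "measure K {\<omega> \<in> space K. size (N \<omega>) \<le> R} =
      (\<integral>\<omega>. of_bool ((\<Sum>l\<le>1. (\<lambda>l\<in>{..1}. points_in (N \<omega>) (cell 1 l)) l) \<le> R) \<partial>K)"
    and sz_ev: "{\<omega> \<in> space K. size (N \<omega>) \<le> R} \<in> sets K"
    if "point_process K N" for K :: "'z measure" and N R
  proof -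
    interpret K: prob_space K using that by (rule point_processD)
    have [measurable]: "(\<lambda>\<omega>. size (N \<omega>)) \<in> measurable K (count_space UNIV)"
      using point_processD(3)[OF that, of UNIV] by simp
    show "{\<omega> \<in> space K. size (N \<omega>) \<le> R} \<in> sets K" by measurable
    hence "measure K {\<omega> \<in> space K. size (N \<omega>) \<le> R} = (\<integral>\<omega>. of_bool (size (N \<omega>) \<le> R) \<partial>K)"
      by (rule K.expectation_of_bool[symmetric])
    also have "\<dots> = (\<integral>\<omega>. of_bool ((\<Sum>l\<le>1. (\<lambda>l\<in>{..1}. points_in (N \<omega>) (cell 1 l)) l) \<le> R) \<partial>K)"
      using size_eq_sum_cells[OF point_processD(2)[OF that], of _ 1]
      by (intro Bochner_Integration.integral_cong) (auto simp: atMost_Suc)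
    finally show "measure K {\<omega> \<in> space K. size (N \<omega>) \<le> R} =
      (\<integral>\<omega>. of_bool ((\<Sum>l\<le>1. (\<lambda>l\<in>{..1}. points_in (N \<omega>) (cell 1 l)) l) \<le> R) \<partial>K)" .
  qed
  have szlim: "(\<lambda>n. M.prob {\<omega> \<in> space M. size (\<Phi> n \<omega>) \<le> R}) \<longlonglongrightarrow> M'.prob {\<omega> \<in> space M'. size (\<Psi> \<omega>) \<le> R}" for R
    unfolding sz[OF pp(1)] sz[OF pp(2)]
    by (rule E[where F1 = "\<lambda>v. of_bool ((\<Sum>l\<le>1. v l) \<le> R)" and B1 = 1]) auto
  have szone: "(\<lambda>R. M'.prob {\<omega> \<in> space M'. size (\<Psi> \<omega>) \<le> R}) \<longlonglongrightarrow> 1"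
  proof -
    have "(\<lambda>R. M'.prob {\<omega> \<in> space M'. size (\<Psi> \<omega>) \<le> R}) \<longlonglongrightarrow> M'.prob (\<Union>R. {\<omega> \<in> space M'. size (\<Psi> \<omega>) \<le> R})"
      using sz_ev[OF pp(2)] by (intro M'.finite_Lim_measure_incseq) (auto simp: incseq_def)
    moreover have "(\<Union>R. {\<omega> \<in> space M'. size (\<Psi> \<omega>) \<le> R}) = space M'" by auto
    ultimately show ?thesis by (simp add: M'.prob_space)
  qed
  have near: "\<bar>(\<integral>\<omega>. g (N \<omega>) \<partial>K) - (\<integral>\<omega>. g (snap L (N \<omega>)) \<partial>K)\<bar>
      \<le> \<epsilon> + 2 * B * (1 - measure K {\<omega> \<in> space K. size (N \<omega>) \<le> R})"
    if N: "point_process K N" and L: "L > 0" "\<epsilon> > 0"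
      and close: "\<And>m. set_mset m \<subseteq> {0..1} \<Longrightarrow> size m \<le> R \<Longrightarrow> \<bar>g m - g (snap L m)\<bar> < \<epsilon>"
    for K :: "'z measure" and N L R \<epsilon>
  proof -
    interpret K: prob_space K using N by (rule point_processD)
    note [measurable] = measurable_compose_vague[OF N g] measurable_compose_snap[OF N] sz_ev[OF N]
    have s: "set_mset (N \<omega>) \<subseteq> {0..1}" "set_mset (snap L (N \<omega>)) \<subseteq> {0..1}" if "\<omega> \<in> space K" for \<omega>
      using point_processD(2)[OF N that] snap_close(1)[OF _ L(1)] by (auto simp: snap_def)
    have i1: "integrable K (\<lambda>\<omega>. g (N \<omega>))" "integrable K (\<lambda>\<omega>. g (snap L (N \<omega>)))"
      by (rule K.integrable_const_bound[where B = B]; use B s in auto)+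
    have i2: "integrable K (\<lambda>\<omega>. of_bool (size (N \<omega>) \<le> R) :: real)"
      by (rule K.integrable_const_bound[where B = 1]) (use sz_ev[OF N] in auto)
    have "\<bar>(\<integral>\<omega>. g (N \<omega>) \<partial>K) - (\<integral>\<omega>. g (snap L (N \<omega>)) \<partial>K)\<bar> = \<bar>\<integral>\<omega>. g (N \<omega>) - g (snap L (N \<omega>)) \<partial>K\<bar>"
      using i1 by simp
    also have "\<dots> \<le> (\<integral>\<omega>. \<bar>g (N \<omega>) - g (snap L (N \<omega>))\<bar> \<partial>K)" by (rule integral_abs_bound)
    also have "\<dots> \<le> (\<integral>\<omega>. \<epsilon> + 2 * B * (1 - of_bool (size (N \<omega>) \<le> R)) \<partial>K)"
    proof (rule integral_mono)
      fix \<omega> assume w: "\<omega> \<in> space K"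
      show "\<bar>g (N \<omega>) - g (snap L (N \<omega>))\<bar> \<le> \<epsilon> + 2 * B * (1 - of_bool (size (N \<omega>) \<le> R))"
        using close[OF s(1)[OF w]] B[OF s(1)[OF w]] B[OF s(2)[OF w]] L by (auto simp: of_bool_def)
    qed (use i1 i2 in auto)
    also have "\<dots> = \<epsilon> + 2 * B * (1 - measure K {\<omega> \<in> space K. size (N \<omega>) \<le> R})"
      using i2 by (simp add: K.prob_space K.expectation_of_bool[OF sz_ev[OF N]])
    finally show ?thesis .
  qed
  show "(\<lambda>n. \<integral>\<omega>. g (\<Phi> n \<omega>) \<partial>M) \<longlonglongrightarrow> (\<integral>\<omega>. g (\<Psi> \<omega>) \<partial>M')"
  proof (rule LIMSEQ_I)
    fix \<epsilon> :: real assume \<epsilon>: "\<epsilon> > 0"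
    define \<delta> where "\<delta> = \<epsilon> / (8 * (2 * B + 1))"
    have \<delta>: "\<delta> > 0" "2 * B * \<delta> < \<epsilon> / 8" using \<epsilon> B0 by (auto simp: \<delta>_def field_simps)
    have "\<forall>\<^sub>F R in sequentially. M'.prob {\<omega> \<in> space M'. size (\<Psi> \<omega>) \<le> R} > 1 - \<delta>"
      using \<delta> by (intro order_tendstoD[OF szone]) auto
    then obtain R where R: "M'.prob {\<omega> \<in> space M'. size (\<Psi> \<omega>) \<le> R} > 1 - \<delta>"
      by (auto simp: eventually_sequentially)
    have "\<exists>L0. \<forall>r. L0 r > 0 \<and> (\<forall>L\<ge>L0 r. \<forall>m. set_mset m \<subseteq> {0..1} \<and> size m = r \<longrightarrow> \<bar>g m - g (snap L m)\<bar> < \<epsilon> / 8)"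
      using vague_continuous_snap[OF g, of "\<epsilon> / 8"] \<epsilon> by (intro choice) auto
    then obtain L0 where L0: "\<And>r. L0 r > 0"
      "\<And>r L m. L \<ge> L0 r \<Longrightarrow> set_mset m \<subseteq> {0..1} \<Longrightarrow> size m = r \<Longrightarrow> \<bar>g m - g (snap L m)\<bar> < \<epsilon> / 8"
      by metis
    \<comment> \<open>The threshold of \<open>vague_continuous_snap\<close> depends on the number of
      points, so the largest one over \<open>r \<le> R\<close> is taken.\<close>
    define L where "L = Max (L0 ` {..R})"
    have LL: "L \<ge> L0 r" if "r \<le> R" for r unfolding L_def using that by (intro Max_ge) auto
    have L: "L > 0" using LL[of 0] L0(1)[of 0] by simp
    have close: "\<bar>g m - g (snap L m)\<bar> < \<epsilon> / 8" if "set_mset m \<subseteq> {0..1}" "size m \<le> R" for m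
      using L0(2)[OF LL[OF that(2)]] that by auto
    have \<epsilon>8: "\<epsilon> / 8 > 0" using \<epsilon> by simp
    have nM': "\<bar>(\<integral>\<omega>. g (\<Psi> \<omega>) \<partial>M') - (\<integral>\<omega>. g (snap L (\<Psi> \<omega>)) \<partial>M')\<bar>
        \<le> \<epsilon> / 8 + 2 * B * (1 - M'.prob {\<omega> \<in> space M'. size (\<Psi> \<omega>) \<le> R})"
      by (rule near[OF pp(2) L \<epsilon>8 close])
    have nM: "\<bar>(\<integral>\<omega>. g (\<Phi> n \<omega>) \<partial>M) - (\<integral>\<omega>. g (snap L (\<Phi> n \<omega>)) \<partial>M)\<bar>
        \<le> \<epsilon> / 8 + 2 * B * (1 - M.prob {\<omega> \<in> space M. size (\<Phi> n \<omega>) \<le> R})" for n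
      by (rule near[OF pp(1) L \<epsilon>8 close])
    have "2 * B * (1 - M'.prob {\<omega> \<in> space M'. size (\<Psi> \<omega>) \<le> R}) \<le> 2 * B * \<delta>"
      using R B0 by (intro mult_left_mono) auto
    hence R': "2 * B * (1 - M'.prob {\<omega> \<in> space M'. size (\<Psi> \<omega>) \<le> R}) < \<epsilon> / 8" using \<delta> by linarith
    have "(\<lambda>n. 2 * B * (1 - M.prob {\<omega> \<in> space M. size (\<Phi> n \<omega>) \<le> R})) \<longlonglongrightarrow>
        2 * B * (1 - M'.prob {\<omega> \<in> space M'. size (\<Psi> \<omega>) \<le> R})"
      by (intro tendsto_intros szlim)
    hence e1: "\<forall>\<^sub>F n in sequentially. 2 * B * (1 - M.prob {\<omega> \<in> space M. size (\<Phi> n \<omega>) \<le> R}) < \<epsilon> / 8"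
      using R' by (intro order_tendstoD)
    \<comment> \<open>\<open>E\<close> asks for a bound on all count vectors, whereas
      \<open>g\<close> is known to be bounded only on configurations in the unit interval; hence the
      cut-off.\<close>
    define h where "h v = (if set_mset (snap_of_counts L v) \<subseteq> {0..1} then g (snap_of_counts L v) else 0)" for v
    have hb: "\<bar>h v\<bar> \<le> B" for v using B B0 by (auto simp: h_def)
    have hg: "h (\<lambda>l\<in>{..L}. points_in (N \<omega>) (cell L l)) = g (snap L (N \<omega>))"
      if "point_process K N" "\<omega> \<in> space K" for K :: "'z measure" and N \<omega>
      using snap_subset[OF point_processD(2)[OF that] L]
      by (simp add: h_def flip: snap_eq_counts[OF point_processD(2)[OF that], of L])
    have "(\<integral>\<omega>. h (\<lambda>l\<in>{..L}. points_in (\<Phi> n \<omega>) (cell L l)) \<partial>M) = (\<integral>\<omega>. g (snap L (\<Phi> n \<omega>)) \<partial>M)" for n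
      by (intro Bochner_Integration.integral_cong hg[OF pp(1)]) auto
    moreover have "(\<integral>\<omega>. h (\<lambda>l\<in>{..L}. points_in (\<Psi> \<omega>) (cell L l)) \<partial>M') = (\<integral>\<omega>. g (snap L (\<Psi> \<omega>)) \<partial>M')"
      by (intro Bochner_Integration.integral_cong hg[OF pp(2)]) auto
    ultimately have "(\<lambda>n. \<integral>\<omega>. g (snap L (\<Phi> n \<omega>)) \<partial>M) \<longlonglongrightarrow> (\<integral>\<omega>. g (snap L (\<Psi> \<omega>)) \<partial>M')"
      using E[where F1 = h and B1 = B, OF L hb] by simp
    from tendstoD[OF this \<epsilon>8]
    have e2: "\<forall>\<^sub>F n in sequentially. dist (\<integral>\<omega>. g (snap L (\<Phi> n \<omega>)) \<partial>M) (\<integral>\<omega>. g (snap L (\<Psi> \<omega>)) \<partial>M') < \<epsilon> / 8" .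
    have "\<forall>\<^sub>F n in sequentially. norm ((\<integral>\<omega>. g (\<Phi> n \<omega>) \<partial>M) - (\<integral>\<omega>. g (\<Psi> \<omega>) \<partial>M')) < \<epsilon>"
      using e1 e2
    proof eventually_elim
      case (elim n)
      then show ?case using nM[of n] nM' R' \<epsilon> unfolding dist_real_def real_norm_def by linarith
    qed
    thus "\<exists>no. \<forall>n\<ge>no. norm ((\<integral>\<omega>. g (\<Phi> n \<omega>) \<partial>M) - (\<integral>\<omega>. g (\<Psi> \<omega>) \<partial>M')) < \<epsilon>"
      by (simp add: eventually_sequentially)
  qed
qed

section \<open>Construction of compound Poisson processes\<close>

lemma indep_vars_PiM_coordinates:
  assumes "\<And>i. prob_space (N i)"
  shows "prob_space.indep_vars (PiM UNIV N) N (\<lambda>i x. x i) UNIV"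
proof -
  interpret N: prob_space "N i" for i by (rule assms)
  interpret product_prob_space N UNIV ..
  interpret P: prob_space "PiM UNIV N" by (rule prob_space_PiM) (rule assms)
  have "distr (PiM UNIV N) (PiM UNIV N) (\<lambda>x. \<lambda>i\<in>UNIV. x i) = PiM UNIV (\<lambda>i. distr (PiM UNIV N) (N i) (\<lambda>x. x i))"
    by (simp add: PiM_component restrict_UNIV distr_id)
  thus ?thesis by (subst P.indep_vars_iff_distr_eq_PiM') auto
qed

lemma integral_PiM_prod:
  fixes f :: "'i \<Rightarrow> 'a \<Rightarrow> real"
  assumes N: "\<And>i. prob_space (N i)" and J: "finite J"
    and f: "\<And>i. f i \<in> borel_measurable (N i)" "\<And>i x. x \<in> space (N i) \<Longrightarrow> \<bar>f i x\<bar> \<le> B"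
  shows "(\<integral>x. (\<Prod>i\<in>J. f i (x i)) \<partial>PiM UNIV N) = (\<Prod>i\<in>J. \<integral>x. f i x \<partial>N i)"
proof -
  interpret N: prob_space "N i" for i by (rule assms)
  interpret product_prob_space N UNIV ..
  interpret P: prob_space "PiM UNIV N" by (rule prob_space_PiM) (rule N)
  note [measurable] = f(1)
  have sp: "x i \<in> space (N i)" if "x \<in> space (PiM UNIV N)" for x i using that by (auto simp: space_PiM)
  have "P.indep_vars (\<lambda>_. borel) (\<lambda>i x. f i (x i)) J"
    by (rule P.indep_vars_compose2[OF P.indep_vars_subset[OF indep_vars_PiM_coordinates[OF N]]]) auto
  moreover have "integrable (PiM UNIV N) (\<lambda>x. f i (x i))" for i
    by (rule P.integrable_const_bound[where B = B]) (use f(2) sp in auto)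
  ultimately have "(\<integral>x. (\<Prod>i\<in>J. f i (x i)) \<partial>PiM UNIV N) = (\<Prod>i\<in>J. \<integral>x. f i (x i) \<partial>PiM UNIV N)"
    by (intro P.indep_vars_lebesgue_integral J)
  also have "\<dots> = (\<Prod>i\<in>J. \<integral>x. f i x \<partial>N i)"
  proof (intro prod.cong refl)
    fix i
    have "(\<integral>x. f i x \<partial>distr (PiM UNIV N) (N i) (\<lambda>x. x i)) = (\<integral>x. f i (x i) \<partial>PiM UNIV N)"
      by (rule integral_distr) auto
    thus "(\<integral>x. f i (x i) \<partial>PiM UNIV N) = (\<integral>x. f i x \<partial>N i)" by (simp add: PiM_component)
  qed
  finally show ?thesis .
qed

lemma integral_poisson_power:
  assumes "0 < lam" "0 \<le> c" "c \<le> 1"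
  shows "(\<integral>k. c ^ k \<partial>measure_pmf (poisson_pmf lam)) = exp (- (lam * (1 - c)))"
proof -
  have s: "(\<lambda>k. pmf (poisson_pmf lam) k * c ^ k) sums (exp (lam * c) * exp (- lam))"
  proof -
    have "(\<lambda>k. (lam * c) ^ k /\<^sub>R fact k * exp (- lam)) sums (exp (lam * c) * exp (- lam))"
      by (intro sums_mult2 exp_converges)
    moreover have "(lam * c) ^ k /\<^sub>R fact k * exp (- lam) = pmf (poisson_pmf lam) k * c ^ k" for k
      using assms by (simp add: power_mult_distrib field_simps)
    ultimately show ?thesis by simp
  qed
  have "(\<integral>k. c ^ k \<partial>measure_pmf (poisson_pmf lam)) = (\<integral>k. pmf (poisson_pmf lam) k * c ^ k \<partial>count_space UNIV)"
    unfolding measure_pmf_eq_density by (subst integral_density) auto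
  also have "\<dots> = (\<Sum>k. pmf (poisson_pmf lam) k * c ^ k)"
    by (rule integral_count_space_nat) (use s assms in \<open>auto simp: integrable_count_space_nat_iff abs_mult sums_iff\<close>)
  also have "\<dots> = exp (lam * c) * exp (- lam)" using s by (simp add: sums_iff)
  also have "\<dots> = exp (- (lam * (1 - c)))" by (simp add: exp_add[symmetric] algebra_simps)
  finally show ?thesis .
qed

definition unit_uniform :: "real measure" where "unit_uniform = restrict_space lborel {0..1}"

lemma prob_space_unit_uniform: "prob_space unit_uniform"
  by (rule prob_spaceI) (simp add: unit_uniform_def space_restrict_space emeasure_restrict_space)

lemma space_unit_uniform [simp]: "space unit_uniform = {0..1}"
  by (simp add: unit_uniform_def space_restrict_space)

lemma measurable_unit_uniform: "f \<in> measurable borel N \<Longrightarrow> f \<in> measurable unit_uniform N"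
  unfolding unit_uniform_def by (rule measurable_restrict_space1) simp

lemma measure_unit_uniform:
  "B \<in> sets borel \<Longrightarrow> B \<subseteq> {0..1} \<Longrightarrow> measure unit_uniform B = measure lborel B"
  unfolding unit_uniform_def by (subst measure_restrict_space) auto

text \<open>Given their number, the points of a Poisson process on [0,1] are i.i.d. uniform.
  Positions and marks are infinite sequences so that their law does not depend on the number of
  points.\<close>

definition compound_space :: "real \<Rightarrow> nat pmf \<Rightarrow> (nat \<times> (nat \<Rightarrow> real) \<times> (nat \<Rightarrow> nat)) measure" where
  "compound_space lam Q = measure_pmf (poisson_pmf lam) \<Otimes>\<^sub>M
     (PiM UNIV (\<lambda>_. unit_uniform) \<Otimes>\<^sub>M PiM UNIV (\<lambda>_. measure_pmf Q))"

locale compound_construction =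
  fixes lam :: real and Q :: "nat pmf"
  assumes lam: "0 < lam"
begin

abbreviation "PX \<equiv> PiM UNIV (\<lambda>_ :: nat. unit_uniform)"
abbreviation "PM \<equiv> PiM UNIV (\<lambda>_ :: nat. measure_pmf Q)"
abbreviation "CS \<equiv> compound_space lam Q"

sublocale PX: prob_space PX by (intro prob_space_PiM prob_space_unit_uniform)
sublocale PM: prob_space PM by (intro prob_space_PiM) (rule measure_pmf.prob_space_axioms)
sublocale PXM: pair_prob_space PX PM ..
sublocale PK: pair_prob_space "measure_pmf (poisson_pmf lam)" "PX \<Otimes>\<^sub>M PM" ..

lemma CS_eq: "CS = measure_pmf (poisson_pmf lam) \<Otimes>\<^sub>M (PX \<Otimes>\<^sub>M PM)" by (simp add: compound_space_def)

sublocale CS: prob_space CS unfolding CS_eq by (rule PK.prob_space_axioms)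

definition K :: "nat \<times> (nat \<Rightarrow> real) \<times> (nat \<Rightarrow> nat) \<Rightarrow> nat" where "K \<omega> = fst \<omega>"
definition x :: "nat \<Rightarrow> nat \<times> (nat \<Rightarrow> real) \<times> (nat \<Rightarrow> nat) \<Rightarrow> real" where "x j \<omega> = fst (snd \<omega>) j"
text \<open>The mark law Q lives on \<open>{0, 1, \<dots>}\<close>; shifting by one makes every mark positive on the
  whole space, not just almost surely.\<close>

definition m :: "nat \<Rightarrow> nat \<times> (nat \<Rightarrow> real) \<times> (nat \<Rightarrow> nat) \<Rightarrow> nat" where "m j \<omega> = Suc (snd (snd \<omega>) j)"

lemma space_CS: "\<omega> \<in> space CS \<longleftrightarrow> (\<forall>j. x j \<omega> \<in> {0..1})"
  by (cases \<omega>) (auto simp: CS_eq space_pair_measure space_PiM x_def)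

lemma measurable_K [measurable]: "K \<in> measurable CS (count_space UNIV)"
  unfolding K_def[abs_def] CS_eq by (rule measurable_compose[OF measurable_fst]) simp

lemma measurable_x [measurable]: "x j \<in> measurable CS borel"
proof -
  have "x j \<in> measurable CS unit_uniform" unfolding x_def[abs_def] CS_eq by measurable
  from measurable_compose[OF this measurable_unit_uniform[of "\<lambda>x. x" borel]] show ?thesis by simp
qed

lemma measurable_m [measurable]: "m j \<in> measurable CS (count_space UNIV)"
proof -
  have "(\<lambda>\<omega>. snd (snd \<omega>) j) \<in> measurable CS (measure_pmf Q)" unfolding CS_eq by measurable
  from measurable_compose[OF this, of Suc "count_space UNIV"] show ?thesis by (simp add: m_def[abs_def])
qed

text \<open>Given \<open>K\<close>, the factors are i.i.d. with mean c, and the Poisson generating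
  function at c gives the exponential. The Poisson property of the unmarked points and the
  generating function of the marked ones are both instances of this formula.\<close>

lemma expectation_marked_prod:
  fixes h :: "real \<Rightarrow> nat \<Rightarrow> real"
  assumes h[measurable]: "\<And>n. (\<lambda>y. h y n) \<in> borel_measurable borel" and h01: "\<And>y n. 0 \<le> h y n \<and> h y n \<le> 1"
  shows "(\<integral>\<omega>. (\<Prod>j<K \<omega>. h (x j \<omega>) (m j \<omega>)) \<partial>CS)
     = exp (- (lam * (1 - (\<integral>y. (\<integral>l. h y (Suc l) \<partial>measure_pmf Q) \<partial>unit_uniform))))"
proof -
  define H where "H y = (\<integral>l. h y (Suc l) \<partial>measure_pmf Q)" for y
  have h2[measurable]: "(\<lambda>z. h (fst z) (Suc (snd z))) \<in> borel_measurable (borel \<Otimes>\<^sub>M measure_pmf Q)"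
    by (rule measurable_compose_countable[where f = "\<lambda>i z. h (fst z) (Suc i)" and g = snd]) auto
  have Hm[measurable]: "H \<in> borel_measurable borel" unfolding H_def[abs_def]
    using measure_pmf.borel_measurable_lebesgue_integral[of "\<lambda>y l. h y (Suc l)" borel Q] h2 by (simp add: case_prod_beta')
  have H01: "0 \<le> H y \<and> H y \<le> 1" for y
  proof -
    have "\<bar>H y\<bar> \<le> 1" unfolding H_def by (rule measure_pmf.abs_expectation_le) (use h01 in auto)
    moreover have "0 \<le> H y" unfolding H_def by (rule Bochner_Integration.integral_nonneg) (use h01 in auto)
    ultimately show ?thesis by simp
  qed
  define c where "c = (\<integral>y. H y \<partial>unit_uniform)"
  interpret U: prob_space unit_uniform by (rule prob_space_unit_uniform)
  have c01: "0 \<le> c" "c \<le> 1"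
  proof -
    have "\<bar>c\<bar> \<le> 1" unfolding c_def by (rule U.abs_expectation_le) (use H01 in auto)
    moreover have "0 \<le> c" unfolding c_def by (rule Bochner_Integration.integral_nonneg) (use H01 in auto)
    ultimately show "0 \<le> c" "c \<le> 1" by auto
  qed
  define F where "F k z = (\<Prod>j<k. h (fst z j) (Suc (snd z j)))" for k and z :: "(nat \<Rightarrow> real) \<times> (nat \<Rightarrow> nat)"
  have F01: "0 \<le> F k z \<and> F k z \<le> 1" for k z unfolding F_def using h01 by (auto intro!: prod_nonneg prod_le_1)
  have Fm[measurable]: "F k \<in> borel_measurable (PX \<Otimes>\<^sub>M PM)" for k
  proof -
    have "(\<lambda>z. (fst z j, snd z j)) \<in> measurable (PX \<Otimes>\<^sub>M PM) (borel \<Otimes>\<^sub>M measure_pmf Q)" for j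
    proof (rule measurable_Pair)
      have "(\<lambda>z. fst z j) \<in> measurable (PX \<Otimes>\<^sub>M PM) unit_uniform" by measurable
      from measurable_compose[OF this measurable_unit_uniform[of "\<lambda>x. x" borel]]
      show "(\<lambda>z. fst z j) \<in> measurable (PX \<Otimes>\<^sub>M PM) borel" by simp
    qed measurable
    from measurable_compose[OF this h2] show ?thesis unfolding F_def[abs_def] by simp
  qed
  have FF: "(\<integral>z. F k z \<partial>(PX \<Otimes>\<^sub>M PM)) = c ^ k" for k
  proof -
    have i: "integrable (PX \<Otimes>\<^sub>M PM) (F k)"
      by (rule PXM.integrable_const_bound[where B = 1]) (use F01 in auto)
    have "(\<integral>z. F k z \<partial>(PX \<Otimes>\<^sub>M PM)) = (\<integral>a. (\<integral>b. F k (a, b) \<partial>PM) \<partial>PX)"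
      using PXM.integral_fst'[OF i] by simp
    also have "\<dots> = (\<integral>a. (\<Prod>j<k. H (a j)) \<partial>PX)"
    proof (intro Bochner_Integration.integral_cong refl)
      fix a
      show "(\<integral>b. F k (a, b) \<partial>PM) = (\<Prod>j<k. H (a j))"
        unfolding F_def H_def fst_conv snd_conv
        by (rule integral_PiM_prod[where B = 1]) (use h01 in \<open>auto intro: measure_pmf.prob_space_axioms\<close>)
    qed
    also have "\<dots> = (\<Prod>j<k. c)" unfolding c_def
      by (rule integral_PiM_prod[where B = 1])
        (use H01 in \<open>auto intro: prob_space_unit_uniform measurable_unit_uniform[OF Hm]\<close>)
    finally show ?thesis by simp
  qed
  have m2: "(\<lambda>z. F (fst z) (snd z)) \<in> borel_measurable (measure_pmf (poisson_pmf lam) \<Otimes>\<^sub>M (PX \<Otimes>\<^sub>M PM))"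
    by (rule measurable_compose_countable[where f = "\<lambda>i z. F i (snd z)" and g = fst]) auto
  have i2: "integrable (measure_pmf (poisson_pmf lam) \<Otimes>\<^sub>M (PX \<Otimes>\<^sub>M PM)) (\<lambda>z. F (fst z) (snd z))"
    by (rule PK.integrable_const_bound[where B = 1]) (use F01 m2 in auto)
  have "(\<integral>\<omega>. (\<Prod>j<K \<omega>. h (x j \<omega>) (m j \<omega>)) \<partial>CS) = (\<integral>\<omega>. F (fst \<omega>) (snd \<omega>) \<partial>CS)"
    by (simp add: F_def K_def x_def m_def)
  also have "\<dots> = (\<integral>k. (\<integral>z. F k z \<partial>(PX \<Otimes>\<^sub>M PM)) \<partial>measure_pmf (poisson_pmf lam))"
    unfolding CS_eq using PK.integral_fst'[OF i2] by simp
  also have "\<dots> = exp (- (lam * (1 - c)))" unfolding FF using integral_poisson_power[OF lam c01] .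
  finally show ?thesis by (simp add: c_def H_def)
qed

end

lemma (in prob_space) indep_vars_natI:
  fixes N :: "'i \<Rightarrow> 'a \<Rightarrow> nat"
  assumes N[measurable]: "\<And>i. N i \<in> measurable M (count_space UNIV)"
    and prod: "\<And>J c. finite J \<Longrightarrow> J \<subseteq> I \<Longrightarrow> prob {\<omega> \<in> space M. \<forall>i\<in>J. N i \<omega> = c i} = (\<Prod>i\<in>J. prob {\<omega> \<in> space M. N i \<omega> = c i})"
  shows "indep_vars (\<lambda>_. count_space UNIV) N I"
proof -
  \<comment> \<open>The events \<open>N i = c\<close> generate the sigma-algebra of
    \<open>N i\<close>. The empty set is added because two distinct ones intersect in it, which
    makes the family closed under intersection.\<close>
  define F where "F i = insert {} (range (\<lambda>c. {\<omega> \<in> space M. N i \<omega> = c}))" for i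
  have "indep_sets F I"
  proof (rule indep_setsI)
    show "F i \<subseteq> events" for i by (auto simp: F_def)
    fix A J assume J: "J \<noteq> {}" "J \<subseteq> I" "finite J" and A: "\<forall>j\<in>J. A j \<in> F j"
    show "prob (\<Inter>j\<in>J. A j) = (\<Prod>j\<in>J. prob (A j))"
    proof (cases "\<exists>j\<in>J. A j = {}")
      case True
      then obtain j where "j \<in> J" "A j = {}" by auto
      hence "prob (A j) = 0" by simp
      hence 0: "(\<Prod>j\<in>J. prob (A j)) = 0"
        using \<open>j \<in> J\<close> J(3) prod_zero[of J "\<lambda>j. prob (A j)"] by blast
      have "(\<Inter>j\<in>J. A j) = {}" using \<open>j \<in> J\<close> \<open>A j = {}\<close> by blast
      thus ?thesis unfolding 0 by (simp only: measure_empty)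
    next
      case False
      hence "\<forall>j\<in>J. \<exists>c. A j = {\<omega> \<in> space M. N j \<omega> = c}" using A by (fastforce simp: F_def)
      then obtain c where c: "\<And>j. j \<in> J \<Longrightarrow> A j = {\<omega> \<in> space M. N j \<omega> = c j}" by metis
      have "(\<Inter>j\<in>J. A j) = {\<omega> \<in> space M. \<forall>i\<in>J. N i \<omega> = c i}" using c J by auto
      thus ?thesis using prod[OF J(3,2), of c] c by simp
    qed
  qed
  moreover have "Int_stable (F i)" for i
    unfolding Int_stable_def F_def
  proof (intro ballI)
    fix a b assume "a \<in> insert {} (range (\<lambda>c. {\<omega> \<in> space M. N i \<omega> = c}))" "b \<in> insert {} (range (\<lambda>c. {\<omega> \<in> space M. N i \<omega> = c}))"
    then consider "a = {} \<or> b = {}" | c d where "a = {\<omega> \<in> space M. N i \<omega> = c}" "b = {\<omega> \<in> space M. N i \<omega> = d}" by auto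
    thus "a \<inter> b \<in> insert {} (range (\<lambda>c. {\<omega> \<in> space M. N i \<omega> = c}))"
      by cases auto
  qed
  ultimately have "indep_sets (\<lambda>i. sigma_sets (space M) (F i)) I" by (rule indep_sets_sigma)
  hence "indep_sets (\<lambda>i. {N i -` A \<inter> space M | A. A \<in> sets (count_space UNIV)}) I"
  proof (rule indep_sets_mono_sets)
    fix i
    show "{N i -` A \<inter> space M | A. A \<in> sets (count_space UNIV)} \<subseteq> sigma_sets (space M) (F i)"
    proof safe
      fix A :: "nat set"
      have eq: "N i -` A \<inter> space M = (\<Union>c. if c \<in> A then {\<omega> \<in> space M. N i \<omega> = c} else {})" by auto
      show "N i -` A \<inter> space M \<in> sigma_sets (space M) (F i)"
        unfolding eq by (rule sigma_sets.Union) (auto simp: F_def intro!: sigma_sets.Basic)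
    qed
  qed
  thus ?thesis unfolding indep_vars_def2 by auto
qed

text \<open>The product of the marginals has the same joint generating function. Uniqueness of the
  law is obtained from \<open>joint_pgf_tendsto\<close>, applied to a sequence constant in
  \<open>n\<close>.\<close>

lemma (in prob_space) indep_vars_pgfI:
  fixes N :: "'i \<Rightarrow> 'a \<Rightarrow> nat"
  assumes N[measurable]: "\<And>i. N i \<in> measurable M (count_space UNIV)"
    and prod: "\<And>J (z :: 'i \<Rightarrow> real). finite J \<Longrightarrow> J \<subseteq> I \<Longrightarrow> (\<And>i. 0 \<le> z i \<and> z i < 1) \<Longrightarrow>
      expectation (\<lambda>\<omega>. \<Prod>i\<in>J. z i ^ N i \<omega>) = (\<Prod>i\<in>J. expectation (\<lambda>\<omega>. z i ^ N i \<omega>))"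
  shows "indep_vars (\<lambda>_. count_space UNIV) N I"
proof (rule indep_vars_natI)
  fix J c assume J: "finite J" "J \<subseteq> I"
  define D where "D i = distr M (count_space UNIV) (N i)" for i
  have D: "prob_space (D i)" for i unfolding D_def by (rule prob_space_distr) simp
  have setsD: "sets (D i) = UNIV" "space (D i) = UNIV" for i by (auto simp: D_def)
  have intD: "(\<integral>l. f l \<partial>D i) = expectation (\<lambda>\<omega>. f (N i \<omega>))" for f :: "nat \<Rightarrow> real" and i
    unfolding D_def by (rule integral_distr) auto
  have mD[measurable]: "f \<in> measurable (D i) (count_space UNIV)" for f :: "nat \<Rightarrow> nat" and i
    by (simp add: measurable_def setsD)
  have mD2[measurable]: "f \<in> borel_measurable (D i)" for f :: "nat \<Rightarrow> real" and i
    by (simp add: measurable_def setsD)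
  have mcoord[measurable]: "(\<lambda>\<omega>. \<omega> i) \<in> measurable (PiM UNIV D) (count_space UNIV)" for i
  proof -
    have "(\<lambda>\<omega>. \<omega> i) \<in> measurable (PiM UNIV D) (D i)" by measurable
    thus ?thesis by (rule measurable_compose[where g = "\<lambda>l. l"]) simp
  qed
  interpret P: prob_space "PiM UNIV D" by (rule prob_space_PiM) (rule D)
  have "(\<lambda>n :: nat. prob {\<omega> \<in> space M. \<forall>i\<in>J. N i \<omega> = c i}) \<longlonglongrightarrow> P.prob {\<omega> \<in> space (PiM UNIV D). \<forall>i\<in>J. \<omega> i = c i}"
  proof (rule joint_pgf_tendsto)
    fix z :: "'i \<Rightarrow> real" assume z: "\<And>l. 0 \<le> z l \<and> z l < 1"
    have "(\<integral>\<omega>. (\<Prod>l\<in>J. z l ^ \<omega> l) \<partial>PiM UNIV D) = (\<Prod>l\<in>J. \<integral>y. z l ^ y \<partial>D l)"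
      using z by (intro integral_PiM_prod[OF D J(1), where B = 1]) (auto simp: power_abs power_le_one less_imp_le)
    thus "(\<lambda>n :: nat. expectation (\<lambda>\<omega>. \<Prod>l\<in>J. z l ^ N l \<omega>)) \<longlonglongrightarrow> (\<integral>\<omega>. (\<Prod>l\<in>J. z l ^ \<omega> l) \<partial>PiM UNIV D)"
      using prod[OF J z] by (simp add: intD)
  qed (auto intro: J prob_space_axioms P.prob_space_axioms)
  hence "prob {\<omega> \<in> space M. \<forall>i\<in>J. N i \<omega> = c i} = P.prob {\<omega> \<in> space (PiM UNIV D). \<forall>i\<in>J. \<omega> i = c i}"
    by (simp add: LIMSEQ_const_iff)
  also have "\<dots> = (\<integral>\<omega>. of_bool (\<forall>i\<in>J. \<omega> i = c i) \<partial>PiM UNIV D)"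
    using J by (intro P.expectation_of_bool[symmetric]) measurable
  also have "\<dots> = (\<integral>\<omega>. (\<Prod>i\<in>J. of_bool (\<omega> i = c i)) \<partial>PiM UNIV D)"
    using J(1) by (intro Bochner_Integration.integral_cong) (auto simp: prod_zero_iff)
  also have "\<dots> = (\<Prod>i\<in>J. \<integral>y. of_bool (y = c i) \<partial>D i)"
    by (intro integral_PiM_prod[OF D J(1), where B = 1]) auto
  also have "\<dots> = (\<Prod>i\<in>J. prob {\<omega> \<in> space M. N i \<omega> = c i})"
    unfolding intD by (intro prod.cong expectation_of_bool refl) measurable
  finally show "prob {\<omega> \<in> space M. \<forall>i\<in>J. N i \<omega> = c i} = (\<Prod>i\<in>J. prob {\<omega> \<in> space M. N i \<omega> = c i})" .
qed measurable

section \<open>The unmarked points form a Poisson process\<close>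

context compound_construction
begin

definition base_points :: "nat \<times> (nat \<Rightarrow> real) \<times> (nat \<Rightarrow> nat) \<Rightarrow> real multiset" where
  "base_points \<omega> = image_mset (\<lambda>j. x j \<omega>) (mset_set {..<K \<omega>})"

lemma points_in_base: "points_in (base_points \<omega>) B = (\<Sum>j<K \<omega>. of_bool (x j \<omega> \<in> B))"
proof -
  have "points_in (image_mset (\<lambda>j. x j \<omega>) (mset_set A)) B = (\<Sum>j\<in>A. of_bool (x j \<omega> \<in> B))" if "finite A" for A
    using that by induction auto
  thus ?thesis by (simp add: base_points_def)
qed

lemma point_process_base: "point_process CS base_points"
  unfolding point_process_def
proof (intro conjI ballI CS.prob_space_axioms)
  show "set_mset (base_points \<omega>) \<subseteq> {0..1}" if "\<omega> \<in> space CS" for \<omega>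
    using that by (auto simp: base_points_def space_CS)
  fix B :: "real set" assume [measurable]: "B \<in> sets borel"
  show "(\<lambda>\<omega>. points_in (base_points \<omega>) B) \<in> measurable CS (count_space UNIV)"
    unfolding points_in_base
    by (rule measurable_compose_countable[where f = "\<lambda>k \<omega>. \<Sum>j<k. of_bool (x j \<omega> \<in> B)"]) measurable
qed

lemma base_points_pgf:
  fixes z :: "'i \<Rightarrow> real"
  assumes J: "finite J" and B[measurable]: "\<And>i. B i \<in> sets borel" "\<And>i. B i \<subseteq> {0..1}"
    and disj: "disjoint_family_on B J" and z: "\<And>i. 0 \<le> z i \<and> z i \<le> 1"
  shows "(\<integral>\<omega>. (\<Prod>i\<in>J. z i ^ points_in (base_points \<omega>) (B i)) \<partial>CS) =
    exp (- (lam * (\<Sum>i\<in>J. (1 - z i) * measure lborel (B i))))"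
proof -
  interpret U: prob_space unit_uniform by (rule prob_space_unit_uniform)
  define h where "h y = (\<Prod>i\<in>J. z i ^ of_bool (y \<in> B i))" for y
  have h01: "0 \<le> h y \<and> h y \<le> 1" for y
    unfolding h_def using z by (auto intro!: prod_nonneg prod_le_1 power_le_one)
  have hm[measurable]: "h \<in> borel_measurable borel" unfolding h_def by measurable
  \<comment> \<open>The sets are disjoint, so a point \<open>y\<close> lies in at most one of them
    and at most one factor differs from 1. This makes the product affine in the indicators.\<close>
  have hs: "h y = 1 - (\<Sum>i\<in>J. (1 - z i) * indicator (B i) y)" for y
    using J disj unfolding h_def
  proof (induction J rule: finite_induct)
    case (insert i J)
    have d: "disjoint_family_on B J" using insert.prems by (auto simp: disjoint_family_on_def)
    note IH = insert.IH[OF d]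
    show ?case
    proof (cases "y \<in> B i")
      case True
      hence nB: "y \<notin> B j" if "j \<in> J" for j using insert.prems insert.hyps that by (force simp: disjoint_family_on_def)
      have "(\<Sum>j\<in>J. (1 - z j) * indicator (B j) y) = 0" using nB by (intro sum.neutral) auto
      moreover have "(\<Prod>j\<in>J. z j ^ of_bool (y \<in> B j)) = 1" using nB by (intro prod.neutral) auto
      ultimately show ?thesis
        unfolding sum.insert[OF insert.hyps] prod.insert[OF insert.hyps] using True by simp
    next
      case False
      thus ?thesis
        unfolding sum.insert[OF insert.hyps] prod.insert[OF insert.hyps] IH by simp
    qed
  qed simp
  have int: "integrable unit_uniform (\<lambda>y. (1 - z i) * indicator (B i) y)" for i
    by (rule U.integrable_const_bound[where B = 1]) 
      (use z in \<open>auto simp: abs_mult indicator_def intro!: measurable_unit_uniform\<close>)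
  have "(\<integral>y. h y \<partial>unit_uniform) = 1 - (\<Sum>i\<in>J. (1 - z i) * measure lborel (B i))"
    unfolding hs using int U.prob_space
    by (simp add: Bochner_Integration.integral_diff Bochner_Integration.integral_sum
        Int_absorb2[OF B(2)] measure_unit_uniform[OF B])
  moreover have "(\<Prod>i\<in>J. z i ^ points_in (base_points \<omega>) (B i)) = (\<Prod>j<K \<omega>. h (x j \<omega>))" for \<omega>
    unfolding points_in_base power_sum h_def by (rule prod.swap)
  ultimately show ?thesis using expectation_marked_prod[of "\<lambda>y n. h y"] h01 by simp
qed

lemma poisson_point_process_base: "poisson_point_process CS lam base_points"
  unfolding poisson_point_process_def
proof (intro conjI ballI allI impI lam point_process_base)
  note [measurable] = point_processD(3)[OF point_process_base]
  fix B :: "real set" and i assume B[measurable]: "B \<in> sets borel" "B \<subseteq> {0..1}"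
  define \<mu> where "\<mu> = lam * measure lborel B"
  have \<mu>: "0 \<le> \<mu>" using lam by (simp add: \<mu>_def)
  have sm: "(\<lambda>c. \<mu> ^ c / fact c * exp (- \<mu>) * z ^ c) sums exp (- (\<mu> * (1 - z)))" for z
  proof -
    have "(\<lambda>c. (\<mu> * z) ^ c /\<^sub>R fact c * exp (- \<mu>)) sums (exp (\<mu> * z) * exp (- \<mu>))"
      by (intro sums_mult2 exp_converges)
    moreover have "exp (\<mu> * z) * exp (- \<mu>) = exp (- (\<mu> * (1 - z)))" by (simp add: exp_add[symmetric] algebra_simps)
    moreover have "(\<mu> * z) ^ c /\<^sub>R fact c * exp (- \<mu>) = \<mu> ^ c / fact c * exp (- \<mu>) * z ^ c" for c
      by (simp add: power_mult_distrib field_simps)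
    ultimately show ?thesis by simp
  qed
  \<comment> \<open>A sequence constant in \<open>n\<close>:
    \<open>power_series_coeff_tendsto\<close> serves here as uniqueness of the coefficients of a
    power series.\<close>
  have "(\<lambda>n :: nat. CS.prob {\<omega> \<in> space CS. points_in (base_points \<omega>) B = i}) \<longlonglongrightarrow> \<mu> ^ i / fact i * exp (- \<mu>)"
  proof (rule power_series_coeff_tendsto)
    show "\<bar>\<mu> ^ c / fact c * exp (- \<mu>)\<bar> \<le> 1" for c
    proof -
      have s1: "(\<lambda>c. \<mu> ^ c / fact c * exp (- \<mu>)) sums 1" using sm[of 1] by simp
      have "(\<Sum>c'\<in>{c}. \<mu> ^ c' / fact c' * exp (- \<mu>)) \<le> (\<Sum>c'. \<mu> ^ c' / fact c' * exp (- \<mu>))"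
        using \<mu> by (intro sum_le_suminf sums_summable[OF s1]) auto
      also have "\<dots> = 1" by (rule sums_unique[OF s1, symmetric])
      finally have "(\<Sum>c'\<in>{c}. \<mu> ^ c' / fact c' * exp (- \<mu>)) \<le> 1" .
      thus ?thesis using \<mu> by simp
    qed
    fix z :: real assume z: "0 < z" "z < 1"
    have "(\<lambda>c. CS.expectation (\<lambda>\<omega>. 1 * of_bool (points_in (base_points \<omega>) B = c)) * z ^ c) sums
        CS.expectation (\<lambda>\<omega>. 1 * z ^ points_in (base_points \<omega>) B)"
      using z by (intro CS.expectation_power_sums) auto
    moreover have "CS.expectation (\<lambda>\<omega>. of_bool (points_in (base_points \<omega>) B = c)) = CS.prob {\<omega> \<in> space CS. points_in (base_points \<omega>) B = c}" for c
      by (intro CS.expectation_of_bool) measurable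
    moreover have "CS.expectation (\<lambda>\<omega>. z ^ points_in (base_points \<omega>) B) = exp (- (\<mu> * (1 - z)))"
      using base_points_pgf[of "{()}" "\<lambda>_. B" "\<lambda>_. z"] B z by (simp add: \<mu>_def mult_ac disjoint_family_on_def)
    ultimately have "(\<lambda>c. CS.prob {\<omega> \<in> space CS. points_in (base_points \<omega>) B = c} * z ^ c) sums exp (- (\<mu> * (1 - z)))"
      by simp
    with sm[of z] show "(\<lambda>n :: nat. \<Sum>c. CS.prob {\<omega> \<in> space CS. points_in (base_points \<omega>) B = c} * z ^ c)
        \<longlonglongrightarrow> (\<Sum>c. \<mu> ^ c / fact c * exp (- \<mu>) * z ^ c)" by (simp add: sums_iff)
  qed auto
  thus "CS.prob {\<omega> \<in> space CS. points_in (base_points \<omega>) B = i} =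
      (lam * measure lborel B) ^ i / fact i * exp (- (lam * measure lborel B))"
    by (simp add: LIMSEQ_const_iff \<mu>_def)
next
  fix B :: "nat \<Rightarrow> real set"
  assume "range B \<subseteq> sets borel \<and> (\<forall>i. B i \<subseteq> {0..1}) \<and> disjoint_family B"
  hence B: "\<And>i. B i \<in> sets borel" "\<And>i. B i \<subseteq> {0..1}" "disjoint_family B" by auto
  show "CS.indep_vars (\<lambda>_. count_space UNIV) (\<lambda>i \<omega>. points_in (base_points \<omega>) (B i)) UNIV"
  proof (rule CS.indep_vars_pgfI)
    fix J :: "nat set" and z :: "nat \<Rightarrow> real" assume J: "finite J" and z: "\<And>i. 0 \<le> z i \<and> z i < 1"
    have z1: "0 \<le> z i \<and> z i \<le> 1" for i using z[of i] by auto
    have e: "CS.expectation (\<lambda>\<omega>. \<Prod>i\<in>J'. z i ^ points_in (base_points \<omega>) (B i)) =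
        exp (- (lam * (\<Sum>i\<in>J'. (1 - z i) * measure lborel (B i))))" if "finite J'" for J'
      using B(3) by (intro base_points_pgf that B z1) (auto simp: disjoint_family_on_def)
    have e1: "CS.expectation (\<lambda>\<omega>. z i ^ points_in (base_points \<omega>) (B i)) = exp (- (lam * ((1 - z i) * measure lborel (B i))))" for i
      using e[of "{i}"] by simp
    have "- (lam * (\<Sum>i\<in>J. (1 - z i) * measure lborel (B i))) = (\<Sum>i\<in>J. - (lam * ((1 - z i) * measure lborel (B i))))"
      by (simp only: sum_distrib_left sum_negf)
    thus "CS.expectation (\<lambda>\<omega>. \<Prod>i\<in>J. z i ^ points_in (base_points \<omega>) (B i)) =
        (\<Prod>i\<in>J. CS.expectation (\<lambda>\<omega>. z i ^ points_in (base_points \<omega>) (B i)))"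
      unfolding e[OF J] e1 by (simp only: exp_sum[OF J])
  qed (rule point_processD(3)[OF point_process_base B(1)])
qed

end

section \<open>Marks and the compound process\<close>

context compound_construction
begin

definition marked_points :: "nat \<times> (nat \<Rightarrow> real) \<times> (nat \<Rightarrow> nat) \<Rightarrow> real multiset" where
  "marked_points \<omega> = (\<Sum>j<K \<omega>. replicate_mset (m j \<omega>) (x j \<omega>))"

lemma points_in_marked: "points_in (marked_points \<omega>) B = (\<Sum>j<K \<omega>. m j \<omega> * of_bool (x j \<omega> \<in> B))"
proof -
  have r: "points_in (replicate_mset n y) B = n * of_bool (y \<in> B)" for n y by (induction n) auto
  have "points_in (\<Sum>j\<in>A. replicate_mset (m j \<omega>) (x j \<omega>)) B = (\<Sum>j\<in>A. m j \<omega> * of_bool (x j \<omega> \<in> B))"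
    if "finite A" for A using that by induction (auto simp: r)
  thus ?thesis by (simp add: marked_points_def)
qed

lemma point_process_marked: "point_process CS marked_points"
  unfolding point_process_def
proof (intro conjI ballI CS.prob_space_axioms)
  show "set_mset (marked_points \<omega>) \<subseteq> {0..1}" if "\<omega> \<in> space CS" for \<omega>
    using that by (auto simp: marked_points_def space_CS set_mset_sum split: if_splits)
  fix B :: "real set" assume [measurable]: "B \<in> sets borel"
  show "(\<lambda>\<omega>. points_in (marked_points \<omega>) B) \<in> measurable CS (count_space UNIV)"
    unfolding points_in_marked
    by (rule measurable_compose_countable[where f = "\<lambda>k \<omega>. \<Sum>j<k. m j \<omega> * of_bool (x j \<omega> \<in> B)"]) measurable
qed

lemma expectation_split:
  fixes f :: "nat \<times> (nat \<Rightarrow> real) \<Rightarrow> real" and g :: "(nat \<Rightarrow> nat) \<Rightarrow> real"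
  assumes f[measurable]: "f \<in> borel_measurable (measure_pmf (poisson_pmf lam) \<Otimes>\<^sub>M PX)" and g[measurable]: "g \<in> borel_measurable PM"
    and b: "\<And>z. \<bar>f z\<bar> \<le> 1" "\<And>z. \<bar>g z\<bar> \<le> 1"
  shows "(\<integral>\<omega>. f (fst \<omega>, fst (snd \<omega>)) * g (snd (snd \<omega>)) \<partial>CS) =
    (\<integral>k. (\<integral>a. f (k, a) \<partial>PX) \<partial>measure_pmf (poisson_pmf lam)) * (\<integral>b. g b \<partial>PM)"
proof -
  have b': "\<bar>f z * g z'\<bar> \<le> 1" for z z' using b(1)[of z] b(2)[of z'] by (auto simp: abs_mult intro: mult_le_one)
  have fk[measurable]: "(\<lambda>a. f (k, a)) \<in> borel_measurable PX" for k
    using measurable_compose[OF measurable_Pair1'[of k "measure_pmf (poisson_pmf lam)" PX] f] by simp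
  have i1: "integrable (measure_pmf (poisson_pmf lam) \<Otimes>\<^sub>M (PX \<Otimes>\<^sub>M PM)) (\<lambda>\<omega>. f (fst \<omega>, fst (snd \<omega>)) * g (snd (snd \<omega>)))"
    by (rule PK.integrable_const_bound[where B = 1]) (use b' in auto)
  have i2: "integrable (PX \<Otimes>\<^sub>M PM) (\<lambda>z. f (k, fst z) * g (snd z))" for k
    by (rule PXM.integrable_const_bound[where B = 1]) (use b' in auto)
  have "(\<integral>\<omega>. f (fst \<omega>, fst (snd \<omega>)) * g (snd (snd \<omega>)) \<partial>CS) =
      (\<integral>k. (\<integral>z. f (k, fst z) * g (snd z) \<partial>(PX \<Otimes>\<^sub>M PM)) \<partial>measure_pmf (poisson_pmf lam))"
    unfolding CS_eq using PK.integral_fst'[OF i1] by simp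
  also have "\<dots> = (\<integral>k. (\<integral>a. f (k, a) \<partial>PX) * (\<integral>b. g b \<partial>PM) \<partial>measure_pmf (poisson_pmf lam))"
    using PXM.integral_fst'[OF i2] by simp
  finally show ?thesis by simp
qed

lemma expectation_KX:
  fixes f :: "nat \<times> (nat \<Rightarrow> real) \<Rightarrow> real"
  assumes "f \<in> borel_measurable (measure_pmf (poisson_pmf lam) \<Otimes>\<^sub>M PX)" "\<And>z. \<bar>f z\<bar> \<le> 1"
  shows "(\<integral>\<omega>. f (fst \<omega>, fst (snd \<omega>)) \<partial>CS) = (\<integral>k. (\<integral>a. f (k, a) \<partial>PX) \<partial>measure_pmf (poisson_pmf lam))"
  using expectation_split[of f "\<lambda>_. 1"] assms PM.prob_space by simp

lemma expectation_M:
  fixes g :: "(nat \<Rightarrow> nat) \<Rightarrow> real"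
  assumes "g \<in> borel_measurable PM" "\<And>z. \<bar>g z\<bar> \<le> 1"
  shows "(\<integral>\<omega>. g (snd (snd \<omega>)) \<partial>CS) = (\<integral>b. g b \<partial>PM)"
  using expectation_split[of "\<lambda>_. 1" g] assms PX.prob_space by simp

lemma prob_m: "finite J \<Longrightarrow> CS.prob {\<omega> \<in> space CS. \<forall>j\<in>J. m j \<omega> = c j} = (\<Prod>j\<in>J. \<integral>l. of_bool (Suc l = c j) \<partial>measure_pmf Q)"
proof -
  assume J: "finite J"
  have "CS.prob {\<omega> \<in> space CS. \<forall>j\<in>J. m j \<omega> = c j} = (\<integral>\<omega>. of_bool (\<forall>j\<in>J. m j \<omega> = c j) \<partial>CS)"
    using J by (intro CS.expectation_of_bool[symmetric]) measurable
  also have "\<dots> = (\<integral>\<omega>. (\<Prod>j\<in>J. of_bool (Suc (snd (snd \<omega>) j) = c j)) \<partial>CS)"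
    using J by (intro Bochner_Integration.integral_cong) (auto simp: m_def prod_zero_iff)
  also have "\<dots> = (\<integral>b. (\<Prod>j\<in>J. of_bool (Suc (b j) = c j)) \<partial>PM)"
  proof (rule expectation_M)
    have "(\<lambda>b. of_bool (Suc (b j) = c j) :: real) \<in> borel_measurable PM" for j
      by (rule measurable_compose[OF measurable_component_singleton[of j UNIV "\<lambda>_. measure_pmf Q"]]) auto
    thus "(\<lambda>b. \<Prod>j\<in>J. of_bool (Suc (b j) = c j) :: real) \<in> borel_measurable PM" by measurable
    show "\<bar>\<Prod>j\<in>J. of_bool (Suc (z j) = c j) :: real\<bar> \<le> 1" for z unfolding abs_prod by (rule prod_le_1) auto
  qed
  also have "\<dots> = (\<Prod>j\<in>J. \<integral>l. of_bool (Suc l = c j) \<partial>measure_pmf Q)"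
    by (rule integral_PiM_prod[OF _ J, where B = 1]) (auto intro: measure_pmf.prob_space_axioms)
  finally show ?thesis .
qed

lemma indep_vars_m: "CS.indep_vars (\<lambda>_. count_space UNIV) m UNIV"
proof (rule CS.indep_vars_natI)
  fix J :: "nat set" and c :: "nat \<Rightarrow> nat" assume "finite J"
  moreover have "CS.prob {\<omega> \<in> space CS. m i \<omega> = c i} = (\<integral>l. of_bool (Suc l = c i) \<partial>measure_pmf Q)" for i
    using prob_m[of "{i}" c] by simp
  ultimately show "CS.prob {\<omega> \<in> space CS. \<forall>i\<in>J. m i \<omega> = c i} = (\<Prod>i\<in>J. CS.prob {\<omega> \<in> space CS. m i \<omega> = c i})"
    using prob_m[of J c] by simp
qed measurable

lemma prob_m_eq: "CS.prob {\<omega> \<in> space CS. m j \<omega> = Suc l} = pmf Q l"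
proof -
  have "CS.prob {\<omega> \<in> space CS. m j \<omega> = Suc l} = (\<integral>i. of_bool (i = l) \<partial>measure_pmf Q)"
    using prob_m[of "{j}" "\<lambda>_. Suc l"] by simp
  also have "\<dots> = measure_pmf.prob Q {i. i = l}" using measure_pmf.expectation_of_bool[of Q "\<lambda>i. i = l"] by simp
  finally show ?thesis by (simp add: pmf.rep_eq)
qed

lemma indep_elements_marks:
  "indep_elements CS (count_space UNIV \<Otimes>\<^sub>M PiM UNIV (\<lambda>_. borel)) (\<lambda>\<omega>. (K \<omega>, \<lambda>j. x j \<omega>))
     (PiM UNIV (\<lambda>_. count_space UNIV)) (\<lambda>\<omega> j. m j \<omega>)"
  unfolding indep_elements_def
proof (intro conjI)
  show mkx: "(\<lambda>\<omega>. (K \<omega>, \<lambda>j. x j \<omega>)) \<in> measurable CS (count_space UNIV \<Otimes>\<^sub>M PiM UNIV (\<lambda>_. borel))"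
    by (intro measurable_Pair measurable_K measurable_PiM_single') auto
  show mm: "(\<lambda>\<omega> j. m j \<omega>) \<in> measurable CS (PiM UNIV (\<lambda>_. count_space UNIV))"
    by (intro measurable_PiM_single') auto
  show "CS.indep_set {(\<lambda>\<omega>. (K \<omega>, \<lambda>j. x j \<omega>)) -` A \<inter> space CS |A. A \<in> sets (count_space UNIV \<Otimes>\<^sub>M PiM UNIV (\<lambda>_. borel))}
     {(\<lambda>\<omega> j. m j \<omega>) -` B \<inter> space CS |B. B \<in> sets (PiM UNIV (\<lambda>_. count_space UNIV))}"
    unfolding CS.indep_sets2_eq
  proof (intro conjI ballI)
    fix a b assume "a \<in> {(\<lambda>\<omega>. (K \<omega>, \<lambda>j. x j \<omega>)) -` A \<inter> space CS |A. A \<in> sets (count_space UNIV \<Otimes>\<^sub>M PiM UNIV (\<lambda>_. borel))}"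
      and "b \<in> {(\<lambda>\<omega> j. m j \<omega>) -` B \<inter> space CS |B. B \<in> sets (PiM UNIV (\<lambda>_. count_space UNIV))}"
    then obtain A B where A: "A \<in> sets (count_space UNIV \<Otimes>\<^sub>M PiM UNIV (\<lambda>_. borel))" "a = (\<lambda>\<omega>. (K \<omega>, \<lambda>j. x j \<omega>)) -` A \<inter> space CS"
      and B: "B \<in> sets (PiM UNIV (\<lambda>_. count_space UNIV))" "b = (\<lambda>\<omega> j. m j \<omega>) -` B \<inter> space CS" by auto
    \<comment> \<open>The events in factorised form. The shift by \<open>Suc\<close> in
      \<open>g\<close> is there because the sample space stores each mark minus 1.\<close>
    define f :: "nat \<times> (nat \<Rightarrow> real) \<Rightarrow> real" where "f z = indicator A z" for z
    define g :: "(nat \<Rightarrow> nat) \<Rightarrow> real" where "g v = indicator B (\<lambda>j. Suc (v j))" for v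
    have fm: "f \<in> borel_measurable (measure_pmf (poisson_pmf lam) \<Otimes>\<^sub>M PX)"
    proof -
      have "(\<lambda>z. (fst z, \<lambda>j. snd z j)) \<in> measurable (measure_pmf (poisson_pmf lam) \<Otimes>\<^sub>M PX) (count_space UNIV \<Otimes>\<^sub>M PiM UNIV (\<lambda>_ :: nat. borel))"
      proof (intro measurable_Pair measurable_PiM_single')
        show "fst \<in> measurable (measure_pmf (poisson_pmf lam) \<Otimes>\<^sub>M PX) (count_space UNIV)"
          using measurable_compose[OF measurable_fst[of "measure_pmf (poisson_pmf lam)" PX], of "\<lambda>y. y" "count_space UNIV"]
          by simp
        fix j
        have "(\<lambda>z. snd z j) \<in> measurable (measure_pmf (poisson_pmf lam) \<Otimes>\<^sub>M PX) unit_uniform" by measurable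
        from measurable_compose[OF this measurable_unit_uniform[of "\<lambda>x. x" borel]]
        show "(\<lambda>z. snd z j) \<in> measurable (measure_pmf (poisson_pmf lam) \<Otimes>\<^sub>M PX) borel" by simp
      qed auto
      from measurable_compose[OF this, of f borel] A show ?thesis by (simp add: f_def[abs_def])
    qed
    have gm: "g \<in> borel_measurable PM"
    proof -
      have "(\<lambda>v j. Suc (v j)) \<in> measurable PM (PiM UNIV (\<lambda>_ :: nat. count_space UNIV))"
      proof (rule measurable_PiM_single')
        fix j
        have "(\<lambda>v. v j) \<in> measurable PM (measure_pmf Q)" by measurable
        thus "(\<lambda>v. Suc (v j)) \<in> measurable PM (count_space UNIV)" by (rule measurable_compose) simp
      qed auto
      from measurable_compose[OF this, of "indicator B :: _ \<Rightarrow> real" borel] B show ?thesis by (simp add: g_def[abs_def])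
    qed
    have fb: "\<bar>f z\<bar> \<le> 1" for z by (simp add: f_def indicator_def)
    have gb: "\<bar>g z\<bar> \<le> 1" for z by (simp add: g_def indicator_def)
    have fa: "f (fst \<omega>, fst (snd \<omega>)) = indicator a \<omega>" if "\<omega> \<in> space CS" for \<omega>
      using that by (auto simp: f_def A K_def x_def indicator_def)
    have gb': "g (snd (snd \<omega>)) = indicator b \<omega>" if "\<omega> \<in> space CS" for \<omega>
      using that by (auto simp: g_def B m_def indicator_def)
    have ev: "a \<in> CS.events" "b \<in> CS.events" using A B mkx mm by auto
    have "CS.prob (a \<inter> b) = (\<integral>\<omega>. indicator (a \<inter> b) \<omega> \<partial>CS)" using ev by simp
    also have "\<dots> = (\<integral>\<omega>. f (fst \<omega>, fst (snd \<omega>)) * g (snd (snd \<omega>)) \<partial>CS)"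
      by (intro Bochner_Integration.integral_cong) (auto simp: fa gb' indicator_inter_arith)
    also have "\<dots> = (\<integral>\<omega>. f (fst \<omega>, fst (snd \<omega>)) \<partial>CS) * (\<integral>\<omega>. g (snd (snd \<omega>)) \<partial>CS)"
      using expectation_split[OF fm gm fb gb] expectation_KX[OF fm fb] expectation_M[OF gm gb] by simp
    also have "(\<integral>\<omega>. f (fst \<omega>, fst (snd \<omega>)) \<partial>CS) = (\<integral>\<omega>. indicator a \<omega> \<partial>CS)"
      by (intro Bochner_Integration.integral_cong) (auto simp: fa)
    also have "(\<integral>\<omega>. g (snd (snd \<omega>)) \<partial>CS) = (\<integral>\<omega>. indicator b \<omega> \<partial>CS)"
      by (intro Bochner_Integration.integral_cong) (auto simp: gb')
    finally show "CS.prob (a \<inter> b) = CS.prob a * CS.prob b" using ev by simp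
  qed (use mkx mm in auto)
qed

lemma compound_poisson_process_marked:
  assumes \<pi>: "\<And>l. \<pi> (Suc l) = pmf Q l"
  shows "compound_poisson_process CS lam \<pi> marked_points"
  unfolding compound_poisson_process_def
proof (intro exI[of _ K] exI[of _ x] exI[of _ m] conjI allI impI ballI indep_vars_m indep_elements_marks)
  show "poisson_point_process CS lam (\<lambda>\<omega>. image_mset (\<lambda>j. x j \<omega>) (mset_set {..<K \<omega>}))"
    using poisson_point_process_base by (simp add: base_points_def[abs_def])
  show "CS.prob {\<omega> \<in> space CS. m j \<omega> = l} = \<pi> l" if "1 \<le> l" for j l
    using that prob_m_eq[of j "l - 1"] \<pi>[of "l - 1"] by simp
qed (auto simp: m_def marked_points_def)

text \<open>The first \<open>L\<close> cells have length \<open>1 / L\<close>, and the cell with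
  index \<open>L\<close> is the null set {1}, so the value \<open>H L\<close> drops out.\<close>

lemma integral_grid_index:
  fixes H :: "nat \<Rightarrow> real"
  assumes L: "L > 0"
  shows "(\<integral>y. H (grid_index L y) \<partial>unit_uniform) = (\<Sum>l<L. H l) / real L"
proof -
  interpret U: prob_space unit_uniform by (rule prob_space_unit_uniform)
  have cell: "cell L l \<inter> {0..1} = (if l < L then {real l / real L..<real (Suc l) / real L} else {1})" if "l \<le> L" for l
  proof -
    have gi: "grid_index L y = l \<longleftrightarrow> real l \<le> real L * y \<and> real L * y < real (Suc l)" if "y \<in> {0..1}" for y
    proof -
      have "0 \<le> real L * y" using that by auto
      thus ?thesis unfolding grid_index_def by (auto simp: nat_eq_iff floor_eq_iff)
    qed
    have *: "cell L l \<inter> {0..1} = {y \<in> {0..1}. real l / real L \<le> y \<and> y < real (Suc l) / real L}"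
    proof (intro set_eqI)
      fix y
      have "real l \<le> real L * y \<longleftrightarrow> real l / real L \<le> y" "real L * y < real (Suc l) \<longleftrightarrow> y < real (Suc l) / real L"
        using L by (simp_all add: pos_divide_le_eq pos_less_divide_eq mult.commute)
      thus "y \<in> cell L l \<inter> {0..1} \<longleftrightarrow> y \<in> {y \<in> {0..1}. real l / real L \<le> y \<and> y < real (Suc l) / real L}"
        using gi[of y] by (auto simp: cell_def)
    qed
    have le: "real (Suc l) / real L \<le> 1" if "l < L" using that by (simp add: field_simps)
    have 0: "0 \<le> real l / real L" by simp
    show ?thesis
    proof (cases "l < L")
      case True
      have "y \<in> {0..1}" if "real l / real L \<le> y" "y < real (Suc l) / real L" for y
        using order_trans[OF 0 that(1)] that(2) le[OF True] by auto
      thus ?thesis unfolding * using True by auto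
    next
      case False
      hence "l = L" using that by simp
      thus ?thesis unfolding * using L by (auto simp: field_simps)
    qed
  qed
  have mc: "measure unit_uniform (cell L l \<inter> {0..1}) = (if l < L then 1 / real L else 0)" if "l \<le> L" for l
  proof -
    have "measure unit_uniform (cell L l \<inter> {0..1}) = measure lborel (cell L l \<inter> {0..1})"
      by (intro measure_unit_uniform) auto
    also have "\<dots> = (if l < L then 1 / real L else 0)"
    proof (cases "l < L")
      case True
      have "real l / real L \<le> real (Suc l) / real L" by (intro divide_right_mono) auto
      hence "measure lborel {real l / real L..<real (Suc l) / real L} = real (Suc l) / real L - real l / real L"
        by simp
      thus ?thesis using True cell[OF that] L by (simp add: field_simps)
    qed (use cell[OF that] in simp)
    finally show ?thesis .
  qed
  have i: "integrable unit_uniform (indicator (cell L l \<inter> {0..1}) :: real \<Rightarrow> real)" for l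
    by (rule U.integrable_const_bound[where B = 1]) (auto intro!: measurable_unit_uniform)
  have "(\<integral>y. H (grid_index L y) \<partial>unit_uniform) = (\<integral>y. (\<Sum>l\<le>L. H l * indicator (cell L l \<inter> {0..1}) y) \<partial>unit_uniform)"
  proof (intro Bochner_Integration.integral_cong refl)
    fix y assume "y \<in> space unit_uniform"
    hence y: "y \<in> {0..1}" by simp
    have "(\<Sum>l\<le>L. H l * indicator (cell L l \<inter> {0..1}) y) = (\<Sum>l\<le>L. if l = grid_index L y then H l else 0)"
      using y by (intro sum.cong) (auto simp: cell_def)
    thus "H (grid_index L y) = (\<Sum>l\<le>L. H l * indicator (cell L l \<inter> {0..1}) y)"
      using grid_index_le[OF y, of L] by simp
  qed
  also have "\<dots> = (\<Sum>l\<le>L. H l * measure unit_uniform (cell L l \<inter> {0..1}))"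
    using i by (subst Bochner_Integration.integral_sum) (auto simp: Int_assoc)
  also have "\<dots> = (\<Sum>l\<le>L. if l < L then H l / real L else 0)"
    by (intro sum.cong) (auto simp: mc)
  also have "\<dots> = (\<Sum>l<L. H l / real L)" by (rule sum.mono_neutral_cong_right) auto
  finally show ?thesis by (simp add: sum_divide_distrib)
qed

lemma marked_points_pgf:
  fixes w :: "nat \<Rightarrow> real"
  assumes L: "L > 0" and w: "\<And>l. 0 \<le> w l \<and> w l < 1"
  shows "(\<integral>\<omega>. (\<Prod>y\<in>#marked_points \<omega>. w (grid_index L y)) \<partial>CS) =
    exp (- (lam * (1 - (\<Sum>l<L. \<Sum>j. pmf Q j * w l ^ Suc j) / real L)))"
proof -
  have "(\<Prod>y\<in>#(\<Sum>j\<in>A. replicate_mset (m j \<omega>) (x j \<omega>)). w (grid_index L y)) = (\<Prod>j\<in>A. w (grid_index L (x j \<omega>)) ^ m j \<omega>)"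
    if "finite A" for A \<omega>
    using that by induction auto
  hence *: "(\<Prod>y\<in>#marked_points \<omega>. w (grid_index L y)) = (\<Prod>j<K \<omega>. w (grid_index L (x j \<omega>)) ^ m j \<omega>)" for \<omega>
    by (simp add: marked_points_def)
  have "(\<integral>\<omega>. (\<Prod>y\<in>#marked_points \<omega>. w (grid_index L y)) \<partial>CS) =
    exp (- (lam * (1 - (\<integral>y. (\<integral>l. w (grid_index L y) ^ (Suc l) \<partial>measure_pmf Q) \<partial>unit_uniform))))"
    unfolding * 
  proof (rule expectation_marked_prod)
    fix n
    show "(\<lambda>y. w (grid_index L y) ^ n) \<in> borel_measurable borel"
      by (rule measurable_compose[OF measurable_grid_index]) simp
    show "0 \<le> w (grid_index L y) ^ n \<and> w (grid_index L y) ^ n \<le> 1" for y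
      using w by (auto intro!: power_le_one simp: less_imp_le)
  qed
  also have "(\<integral>y. (\<integral>l. w (grid_index L y) ^ (Suc l) \<partial>measure_pmf Q) \<partial>unit_uniform)
     = (\<Sum>l<L. \<integral>j. w l ^ Suc j \<partial>measure_pmf Q) / real L"
    by (rule integral_grid_index[OF L])
  finally have int: "(\<integral>\<omega>. (\<Prod>y\<in>#marked_points \<omega>. w (grid_index L y)) \<partial>CS) =
    exp (- (lam * (1 - (\<Sum>l<L. \<integral>j. w l ^ Suc j \<partial>measure_pmf Q) / real L)))" .
  have e: "(\<integral>j. w l ^ Suc j \<partial>measure_pmf Q) = (\<Sum>j. pmf Q j * w l ^ Suc j)" for l
  proof -
    have "(\<lambda>c. measure_pmf.expectation Q (\<lambda>\<omega>. w l * of_bool (\<omega> = c)) * w l ^ c) sums measure_pmf.expectation Q (\<lambda>\<omega>. w l * w l ^ \<omega>)"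
      using w[of l] by (intro measure_pmf.expectation_power_sums[where N = "\<lambda>n. n"]) auto
    moreover have "measure_pmf.expectation Q (\<lambda>\<omega>. of_bool (\<omega> = c)) = pmf Q c" for c
      using measure_pmf.expectation_of_bool[of Q "\<lambda>i. i = c"] by (simp add: pmf.rep_eq)
    ultimately show ?thesis by (simp add: sums_iff mult_ac)
  qed
  show ?thesis using int unfolding e .
qed

end

lemma exists_compound_poisson_process:
  fixes \<pi> :: "nat \<Rightarrow> real"
  assumes lam: "0 < lam" and nn: "\<And>l. 0 \<le> \<pi> (Suc l)" and one: "(\<lambda>l. \<pi> (Suc l)) sums 1"
  obtains M' :: "(nat \<times> (nat \<Rightarrow> real) \<times> (nat \<Rightarrow> nat)) measure" and \<Psi>
  where "compound_poisson_process M' lam \<pi> \<Psi>" "point_process M' \<Psi>"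
    "\<And>L (w :: nat \<Rightarrow> real). L > 0 \<Longrightarrow> (\<And>l. 0 \<le> w l \<and> w l < 1) \<Longrightarrow>
      (\<integral>\<omega>. (\<Prod>y\<in>#\<Psi> \<omega>. w (grid_index L y)) \<partial>M') =
        exp (- (lam * (1 - (\<Sum>l<L. \<Sum>j. \<pi> (Suc j) * w l ^ Suc j) / real L)))"
proof -
  \<comment> \<open>Cluster sizes start at 1, so \<open>Q\<close> is the law of the size minus 1;
    \<open>\<pi> 0\<close> never enters.\<close>
  define Q where "Q = embed_pmf (\<lambda>l. \<pi> (Suc l))"
  have "(\<integral>\<^sup>+l. ennreal (\<pi> (Suc l)) \<partial>count_space UNIV) = ennreal (\<Sum>l. \<pi> (Suc l))"
    unfolding nn_integral_count_space_nat using nn one by (intro suminf_ennreal2) (auto simp: sums_iff)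
  also have "\<dots> = 1" using one by (simp add: sums_iff)
  finally have Q: "pmf Q l = \<pi> (Suc l)" for l unfolding Q_def using nn by (intro pmf_embed_pmf) auto
  interpret compound_construction lam Q by unfold_locales (rule lam)
  show ?thesis
    using that[OF compound_poisson_process_marked[of \<pi>, OF Q[symmetric]] point_process_marked] marked_points_pgf
    unfolding Q by blast
qed

section \<open>Windows visited by a nearest-neighbour path\<close>

text \<open>Induction that adds a new smallest index \<open>b\<close>: the later indices of all
  others are unchanged, and those later than \<open>b\<close> are the whole old set, so
  \<open>b\<close> contributes \<open>1 - w b\<close> times the old product.\<close>

lemma prod_telescope_min:
  fixes w :: "nat \<Rightarrow> real"
  assumes "finite C"
  shows "1 - (\<Prod>i\<in>C. w i) = (\<Sum>i\<in>C. (1 - w i) * (\<Prod>i'\<in>{i'\<in>C. i < i'}. w i'))"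
  using assms
proof (induction C rule: finite_linorder_min_induct)
  case (insert b A)
  have b: "b \<notin> A" using insert by auto
  have 1: "{i' \<in> insert b A. b < i'} = A" using insert by auto
  have 2: "{i' \<in> insert b A. i < i'} = {i' \<in> A. i < i'}" if "i \<in> A" for i using insert that by auto
  have s: "(\<Sum>i\<in>A. (1 - w i) * (\<Prod>i'\<in>{i'\<in>insert b A. i < i'}. w i')) =
      (\<Sum>i\<in>A. (1 - w i) * (\<Prod>i'\<in>{i'\<in>A. i < i'}. w i'))"
    by (intro sum.cong refl arg_cong2[where f = "(*)"] prod.cong 2)
  show ?case
    unfolding sum.insert[OF insert.hyps(1) b] prod.insert[OF insert.hyps(1) b] 1 s insert.IH[symmetric]
    by (simp add: algebra_simps)
qed simp

text \<open>Exactly one element of \<open>C\<close> has exactly \<open>j\<close> larger ones if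
  \<open>j < card C\<close>, and none otherwise.\<close>

lemma sum_rank_from_above:
  fixes j :: nat
  assumes "finite (C :: nat set)"
  shows "(\<Sum>i\<in>C. of_bool (card {i'\<in>C. i < i'} = j)) = (of_bool (j < card C) :: real)"
  using assms
proof (induction C rule: finite_linorder_min_induct)
  case (insert b A)
  have b: "b \<notin> A" using insert by auto
  have 1: "{i' \<in> insert b A. b < i'} = A" using insert by auto
  have 2: "{i' \<in> insert b A. i < i'} = {i' \<in> A. i < i'}" if "i \<in> A" for i using insert that by auto
  have s: "(\<Sum>i\<in>A. of_bool (card {i'\<in>insert b A. i < i'} = j)) = (\<Sum>i\<in>A. of_bool (card {i'\<in>A. i < i'} = j) :: real)"
    using 2 by (intro sum.cong refl) (simp only:)
  show ?case
    unfolding sum.insert[OF insert.hyps(1) b] 1 s insert.IH card_insert_disjoint[OF insert.hyps(1) b] by auto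
qed simp

lemma abs_prod_diff_le:
  fixes f g :: "'i \<Rightarrow> real"
  assumes "\<And>i. i \<in> I \<Longrightarrow> 0 \<le> f i \<and> f i \<le> 1" "\<And>i. i \<in> I \<Longrightarrow> 0 \<le> g i \<and> g i \<le> 1"
  shows "\<bar>(\<Prod>i\<in>I. f i) - (\<Prod>i\<in>I. g i)\<bar> \<le> (\<Sum>i\<in>I. \<bar>f i - g i\<bar>)"
  using norm_prod_diff[of I f g] assms by auto

text \<open>The sets of k + 1 consecutive integers containing 0 are \<open>window k a\<close> with \<open>a \<le> k\<close>.\<close>

definition window :: "nat \<Rightarrow> nat \<Rightarrow> int set" where "window k a = {int a - int k..int a}"

text \<open>These are the times \<open>i\<close> at which \<open>Y\<close> at site \<open>s\<close>
  enters the moving maximum seen by the path, since \<open>\<sigma> i \<in> {s - int k..s}\<close>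
  says the same as \<open>s \<in> {\<sigma> i..\<sigma> i + int k}\<close>.\<close>

definition hits :: "nat \<Rightarrow> nat \<Rightarrow> (nat \<Rightarrow> int) \<Rightarrow> int \<Rightarrow> nat set" where
  "hits k n \<sigma> s = {i\<in>{..n}. \<sigma> i \<in> {s - int k..s}}"

text \<open>Double counting of the pairs of a time \<open>i\<close> and a window end
  \<open>s\<close> with the path in the window at time \<open>i\<close>: such an \<open>s\<close> is
  \<open>\<sigma> i + int a\<close> for a unique \<open>a \<le> k\<close>.\<close>

lemma sum_windows_swap:
  fixes G :: "nat \<Rightarrow> int \<Rightarrow> real"
  assumes D: "finite D" "\<And>i a. i \<le> n \<Longrightarrow> a \<le> k \<Longrightarrow> \<sigma> i + int a \<in> D"
  shows "(\<Sum>i\<le>n. \<Sum>a\<le>k. G i (\<sigma> i + int a)) = (\<Sum>s\<in>D. \<Sum>i\<in>hits k n \<sigma> s. G i s)"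
proof -
  have "(\<Sum>s\<in>D. \<Sum>i\<in>hits k n \<sigma> s. G i s) =
      (\<Sum>s\<in>D. \<Sum>i\<le>n. if \<sigma> i \<in> {s - int k..s} then G i s else 0)"
    unfolding hits_def by (intro sum.cong refl sum.inter_filter) auto
  also have "\<dots> = (\<Sum>i\<le>n. \<Sum>s\<in>D. if \<sigma> i \<in> {s - int k..s} then G i s else 0)"
    by (rule sum.swap)
  also have "\<dots> = (\<Sum>i\<le>n. \<Sum>a\<le>k. G i (\<sigma> i + int a))"
  proof (intro sum.cong refl)
    fix i assume i: "i \<in> {..n}"
    have "(\<Sum>s\<in>D. if \<sigma> i \<in> {s - int k..s} then G i s else 0) = (\<Sum>s\<in>{s\<in>D. \<sigma> i \<in> {s - int k..s}}. G i s)"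
      using D(1) by (intro sum.inter_filter[symmetric])
    also have "{s\<in>D. \<sigma> i \<in> {s - int k..s}} = (\<lambda>a. \<sigma> i + int a) ` {..k}"
    proof (intro equalityI subsetI)
      fix s assume "s \<in> {s\<in>D. \<sigma> i \<in> {s - int k..s}}"
      hence "s = \<sigma> i + int (nat (s - \<sigma> i))" "nat (s - \<sigma> i) \<le> k" by auto
      thus "s \<in> (\<lambda>a. \<sigma> i + int a) ` {..k}" by blast
    qed (use D(2) i in auto)
    also have "(\<Sum>s\<in>(\<lambda>a. \<sigma> i + int a) ` {..k}. G i s) = (\<Sum>a\<le>k. G i (\<sigma> i + int a))"
      by (subst sum.reindex) (auto simp: inj_on_def)
    finally show "(\<Sum>s\<in>D. if \<sigma> i \<in> {s - int k..s} then G i s else 0) = (\<Sum>a\<le>k. G i (\<sigma> i + int a))" .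
  qed
  finally show ?thesis ..
qed

text \<open>A deterministic set containing every site whose \<open>Y\<close> can matter up to time
  \<open>n\<close>. Sums over sites then have an index set that does not depend on the walk.\<close>

definition site_range :: "nat \<Rightarrow> nat \<Rightarrow> int set" where
  "site_range k n = {- int n..int n + int k}"

definition nn_path :: "(nat \<Rightarrow> int) \<Rightarrow> nat \<Rightarrow> bool" where
  "nn_path \<sigma> n \<longleftrightarrow> \<sigma> 0 = 0 \<and> (\<forall>i<n. \<bar>\<sigma> (Suc i) - \<sigma> i\<bar> = 1)"

lemma nn_path_bound: "nn_path \<sigma> n \<Longrightarrow> i \<le> n \<Longrightarrow> \<bar>\<sigma> i\<bar> \<le> int i"
proof (induction i)
  case (Suc i)
  have "\<bar>\<sigma> (Suc i) - \<sigma> i\<bar> = 1" using Suc.prems by (simp add: nn_path_def)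
  moreover have "\<bar>\<sigma> i\<bar> \<le> int i" using Suc by simp
  ultimately show ?case by simp
qed (simp add: nn_path_def)

lemma finite_hits [simp]: "finite (hits k n \<sigma> s)" by (simp add: hits_def)

lemma finite_site_range [simp]: "finite (site_range k n)" by (simp add: site_range_def)

lemma card_site_range: "card (site_range k n) = 2 * n + k + 1"
  by (simp add: site_range_def)

lemma site_range_mem: "nn_path \<sigma> n \<Longrightarrow> i \<le> n \<Longrightarrow> a \<le> k \<Longrightarrow> \<sigma> i + int a \<in> site_range k n"
  using nn_path_bound[of \<sigma> n i] by (auto simp: site_range_def)

text \<open>Recentring at the current position: the later visits to a window are read off from the
  increments after time \<open>i\<close> and the offset \<open>a\<close> alone.\<close>

lemma later_hits:
  "{i'\<in>hits k n \<sigma> (\<sigma> i + int a). i < i'} = {i'\<in>{i<..n}. \<sigma> i' - \<sigma> i \<in> window k a}"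
  by (auto simp: hits_def window_def)

text \<open>A window s is charged to each of its visits i in turn; only the later visits to s matter, so
  the i-th summand depends on the steps after time i alone.\<close>

lemma cluster_telescope:
  fixes w :: "nat \<Rightarrow> real"
  assumes "nn_path \<sigma> n"
  shows "(\<Sum>s\<in>site_range k n. 1 - (\<Prod>i\<in>hits k n \<sigma> s. w i)) =
    (\<Sum>i\<le>n. (1 - w i) * (\<Sum>a\<le>k. \<Prod>i'\<in>{i'\<in>{i<..n}. \<sigma> i' - \<sigma> i \<in> window k a}. w i'))"
proof -
  have "(\<Sum>i\<le>n. (1 - w i) * (\<Sum>a\<le>k. \<Prod>i'\<in>{i'\<in>{i<..n}. \<sigma> i' - \<sigma> i \<in> window k a}. w i')) =
    (\<Sum>i\<le>n. \<Sum>a\<le>k. (1 - w i) * (\<Prod>i'\<in>{i'\<in>hits k n \<sigma> (\<sigma> i + int a). i < i'}. w i'))"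
    by (simp add: later_hits sum_distrib_left)
  also have "\<dots> = (\<Sum>s\<in>site_range k n. \<Sum>i\<in>hits k n \<sigma> s. (1 - w i) * (\<Prod>i'\<in>{i'\<in>hits k n \<sigma> s. i < i'}. w i'))"
    using sum_windows_swap[of "site_range k n" n k \<sigma> "\<lambda>i s. (1 - w i) * (\<Prod>i'\<in>{i'\<in>hits k n \<sigma> s. i < i'}. w i')"]
      site_range_mem[OF assms] by simp
  also have "\<dots> = (\<Sum>s\<in>site_range k n. 1 - (\<Prod>i\<in>hits k n \<sigma> s. w i))"
    by (simp add: prod_telescope_min)
  finally show ?thesis ..
qed

lemma cluster_count:
  assumes "nn_path \<sigma> n"
  shows "(\<Sum>i\<le>n. \<Sum>a\<le>k. of_bool (card {i'\<in>{i<..n}. \<sigma> i' - \<sigma> i \<in> window k a} = j)) =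
    (\<Sum>s\<in>site_range k n. of_bool (j < card (hits k n \<sigma> s)) :: real)"
proof -
  have "(\<Sum>i\<le>n. \<Sum>a\<le>k. of_bool (card {i'\<in>{i<..n}. \<sigma> i' - \<sigma> i \<in> window k a} = j)) =
    (\<Sum>s\<in>site_range k n. \<Sum>i\<in>hits k n \<sigma> s. of_bool (card {i'\<in>hits k n \<sigma> s. i < i'} = j) :: real)"
    using sum_windows_swap[of "site_range k n" n k \<sigma> "\<lambda>i s. of_bool (card {i'\<in>hits k n \<sigma> s. i < i'} = j)"]
      site_range_mem[OF assms] by (simp add: later_hits del: sum_of_bool_eq)
  thus ?thesis by (simp only: sum_rank_from_above[OF finite_hits])
qed

lemma nn_path_intermediate:
  assumes "nn_path \<sigma> n" "i \<le> n" "j \<le> n" "\<sigma> i \<le> t" "t \<le> \<sigma> j"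
  shows "\<exists>l\<le>n. \<sigma> l = t"
proof -
  have step: "\<bar>\<sigma> (Suc i) - \<sigma> i\<bar> \<le> 1" if "i < n" for i using assms(1) that by (simp add: nn_path_def)
  consider "i \<le> j" | "j \<le> i" by linarith
  thus ?thesis
  proof cases
    case 1
    have "\<exists>l. i \<le> l \<and> l \<le> j \<and> \<sigma> l = t"
      using step 1 assms by (intro nat_intermed_int_val) auto
    then obtain l where "l \<le> j" "\<sigma> l = t" by blast
    thus ?thesis using assms(3) by (intro exI[of _ l]) auto
  next
    case 2
    have "\<bar>- \<sigma> (Suc i) - - \<sigma> i\<bar> \<le> 1" if "i < n" for i using step[OF that] by simp
    hence "\<exists>l. j \<le> l \<and> l \<le> i \<and> - \<sigma> l = - t"
      using 2 assms by (intro nat_intermed_int_val) auto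
    then obtain l where "l \<le> i" "\<sigma> l = t" by auto
    thus ?thesis using assms(2) by (intro exI[of _ l]) auto
  qed
qed

text \<open>A nearest-neighbour path visits every site between its minimum and its maximum, so the
  ends of the visited windows fill the interval from \<open>mn\<close> to
  \<open>mx + int k\<close>.\<close>

lemma count_visited_windows:
  assumes "nn_path \<sigma> n"
  defines "mx \<equiv> Max (\<sigma> ` {..n})" and "mn \<equiv> Min (\<sigma> ` {..n})"
  shows "(\<Sum>s\<in>site_range k n. of_bool (0 < card (hits k n \<sigma> s)) :: real) = real_of_int (mx - mn) + real k + 1"
    "\<bar>\<sigma> n\<bar> \<le> mx - mn"
proof -
  have mx: "\<sigma> i \<le> mx" if "i \<le> n" for i unfolding mx_def using that by (intro Max_ge) auto
  have mn: "mn \<le> \<sigma> i" if "i \<le> n" for i unfolding mn_def using that by (intro Min_le) auto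
  have "mx \<in> \<sigma> ` {..n}" "mn \<in> \<sigma> ` {..n}" unfolding mx_def mn_def by (intro Max_in Min_in; auto)+
  then obtain i j where ij: "i \<le> n" "mx = \<sigma> i" "j \<le> n" "mn = \<sigma> j" by auto
  have "\<sigma> 0 = 0" using assms(1) by (simp add: nn_path_def)
  with mx[of 0] mn[of 0] mx[of n] mn[of n] show "\<bar>\<sigma> n\<bar> \<le> mx - mn" by auto
  have "{s\<in>site_range k n. 0 < card (hits k n \<sigma> s)} = {mn..mx + int k}"
  proof (intro equalityI subsetI)
    fix s assume "s \<in> {s\<in>site_range k n. 0 < card (hits k n \<sigma> s)}"
    then obtain i where "i \<in> hits k n \<sigma> s" by fastforce
    thus "s \<in> {mn..mx + int k}" using mx[of i] mn[of i] by (auto simp: hits_def)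
  next
    fix s assume s: "s \<in> {mn..mx + int k}"
    \<comment> \<open>The site \<open>min s mx\<close> lies in the range of the path and in the
      window ending at \<open>s\<close>, because \<open>s\<close> exceeds \<open>mx\<close> by at
      most \<open>k\<close>.\<close>
    have "\<exists>l\<le>n. \<sigma> l = min s mx" using s ij mx[of j]
      by (intro nn_path_intermediate[OF assms(1) ij(3) ij(1)]) auto
    then obtain l where l: "l \<le> n" "\<sigma> l = min s mx" by auto
    have "l \<in> hits k n \<sigma> s" using l s by (auto simp: hits_def)
    hence "0 < card (hits k n \<sigma> s)" by (metis card_gt_0_iff empty_iff finite_hits)
    moreover have "s = \<sigma> l + int (nat (s - \<sigma> l))" "nat (s - \<sigma> l) \<le> k" using l s by auto
    with site_range_mem[OF assms(1) l(1), of "nat (s - \<sigma> l)" k] have "s \<in> site_range k n" by simp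
    ultimately show "s \<in> {s\<in>site_range k n. 0 < card (hits k n \<sigma> s)}" by auto
  qed
  hence "(\<Sum>s\<in>site_range k n. of_bool (0 < card (hits k n \<sigma> s)) :: real) = real (card {mn..mx + int k})"
    by (simp add: of_bool_def flip: sum.inter_filter)
  also have "mn \<le> mx" using mx[of 0] mn[of 0] by simp
  hence "real (card {mn..mx + int k}) = real_of_int (mx - mn) + real k + 1" by simp
  finally show "(\<Sum>s\<in>site_range k n. of_bool (0 < card (hits k n \<sigma> s)) :: real) = real_of_int (mx - mn) + real k + 1" .
qed

section \<open>Transience of the biased walk\<close>

definition psum :: "(nat \<Rightarrow> int) \<Rightarrow> nat \<Rightarrow> int" where "psum x d = (\<Sum>j<d. x j)"

text \<open>Time 0 is left out: for \<open>a \<le> k\<close> the starting point always lies in the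
  window, so the number of visits up to \<open>T\<close> is one more than this.\<close>

definition returns :: "nat \<Rightarrow> nat \<Rightarrow> nat \<Rightarrow> (nat \<Rightarrow> int) \<Rightarrow> nat" where
  "returns k a T x = card {d\<in>{0<..T}. psum x d \<in> window k a}"

abbreviation "int_seqs \<equiv> PiM UNIV (\<lambda>_ :: nat. count_space (UNIV :: int set))"

lemma measurable_add_int:
  fixes f g :: "'a \<Rightarrow> int"
  assumes [measurable]: "f \<in> measurable N (count_space UNIV)" "g \<in> measurable N (count_space UNIV)"
  shows "(\<lambda>x. f x + g x) \<in> measurable N (count_space UNIV)"
  by (rule measurable_compose_countable[where f = "\<lambda>i x. f x + i" and g = g])
    (auto intro: measurable_compose[OF assms(1)])

lemma measurable_psum [measurable]: "(\<lambda>x. psum x d) \<in> measurable int_seqs (count_space UNIV)"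
proof (induction d)
  case (Suc d)
  have "(\<lambda>x. psum x (Suc d)) = (\<lambda>x. psum x d + x d)" by (simp add: psum_def)
  also have "\<dots> \<in> measurable int_seqs (count_space UNIV)"
    by (rule measurable_add_int[OF Suc]) measurable
  finally show ?case .
qed (simp add: psum_def)

lemma measurable_psum_mem [measurable]: "Measurable.pred int_seqs (\<lambda>x. psum x d \<in> A)"
  by (rule measurable_compose[OF measurable_psum]) simp

lemma card_filter_eq_sum: "finite I \<Longrightarrow> card {d\<in>I. P d} = (\<Sum>d\<in>I. of_bool (P d))"
  unfolding card_eq_sum of_bool_def by (rule sum.inter_filter)

lemma measurable_returns [measurable]: "returns k a T \<in> measurable int_seqs (count_space UNIV)"
proof -
  have "returns k a T = (\<lambda>x. \<Sum>d\<in>{0<..T}. of_bool (psum x d \<in> window k a))"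
    unfolding returns_def by (intro ext card_filter_eq_sum) simp
  also have "\<dots> \<in> measurable int_seqs (count_space UNIV)" by measurable
  finally show ?thesis .
qed

section \<open>Stationarity and independence of the steps\<close>

locale biased_walk = prob_space M for M :: "'a measure" +
  fixes X :: "nat \<Rightarrow> 'a \<Rightarrow> int" and p :: real
  assumes p: "0 < p" "p < 1" "p \<noteq> 1 / 2"
    and indep: "indep_vars (\<lambda>_. count_space UNIV) X {1..}"
    and prob_up: "\<And>i. i \<ge> 1 \<Longrightarrow> prob {\<omega> \<in> space M. X i \<omega> = 1} = p"
    and prob_down: "\<And>i. i \<ge> 1 \<Longrightarrow> prob {\<omega> \<in> space M. X i \<omega> = -1} = 1 - p"
begin

definition steps :: "nat \<Rightarrow> 'a \<Rightarrow> nat \<Rightarrow> int" where "steps i \<omega> = (\<lambda>j. X (Suc (i + j)) \<omega>)"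

lemma measurable_X: "i \<ge> 1 \<Longrightarrow> X i \<in> measurable M (count_space UNIV)"
  using indep by (auto simp: indep_vars_def2)

lemma measurable_X_Suc [measurable]: "X (Suc i) \<in> measurable M (count_space UNIV)"
  by (rule measurable_X) simp

lemma measurable_steps [measurable]: "steps i \<in> measurable M int_seqs"
  unfolding steps_def by (rule measurable_PiM_single') auto

lemma walk_add: "walk X (i + d) \<omega> = walk X i \<omega> + psum (steps i \<omega>) d"
  by (induction d) (simp_all add: walk_def psum_def steps_def)

lemma walk_0 [simp]: "walk X 0 \<omega> = 0" by (simp add: walk_def)

lemma walk_eq_psum: "walk X d \<omega> = psum (steps 0 \<omega>) d"
  using walk_add[of 0 d \<omega>] by simp

lemma measurable_walk [measurable]: "walk X i \<in> measurable M (count_space UNIV)"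
proof -
  have "walk X i = (\<lambda>\<omega>. psum (steps 0 \<omega>) i)" by (simp add: walk_eq_psum fun_eq_iff)
  also have "\<dots> \<in> measurable M (count_space UNIV)" by (rule measurable_compose[OF measurable_steps measurable_psum])
  finally show ?thesis .
qed

lemma AE_step: "i \<ge> 1 \<Longrightarrow> AE \<omega> in M. X i \<omega> = 1 \<or> X i \<omega> = -1"
proof -
  assume i: "i \<ge> 1"
  note [measurable] = measurable_X[OF i]
  have "prob ({\<omega> \<in> space M. X i \<omega> = 1} \<union> {\<omega> \<in> space M. X i \<omega> = -1}) = p + (1 - p)"
    using prob_up[OF i] prob_down[OF i] by (subst finite_measure_Union) auto
  hence "AE \<omega> in M. \<omega> \<in> {\<omega> \<in> space M. X i \<omega> = 1} \<union> {\<omega> \<in> space M. X i \<omega> = -1}"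
    by (intro AE_prob_1) simp
  thus ?thesis by eventually_elim auto
qed

lemma AE_steps: "AE \<omega> in M. \<forall>i. X (Suc i) \<omega> = 1 \<or> X (Suc i) \<omega> = -1"
  unfolding AE_all_countable using AE_step by simp

lemma AE_nn_path: "AE \<omega> in M. \<forall>n. nn_path (\<lambda>i. walk X i \<omega>) n"
  using AE_steps
proof eventually_elim
  case (elim \<omega>)
  have "walk X (Suc i) \<omega> - walk X i \<omega> = X (Suc i) \<omega>" for i by (simp add: walk_def)
  thus ?case using elim by (auto simp: nn_path_def) (metis abs_1 abs_minus_cancel)
qed

lemma expectation_step:
  fixes f :: "int \<Rightarrow> real"
  assumes "i \<ge> 1"
  shows "expectation (\<lambda>\<omega>. f (X i \<omega>)) = p * f 1 + (1 - p) * f (-1)" "integrable M (\<lambda>\<omega>. f (X i \<omega>))"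
proof -
  note [measurable] = measurable_X[OF assms]
  have [measurable]: "(\<lambda>\<omega>. f (X i \<omega>)) \<in> borel_measurable M"
    by (rule measurable_compose[OF measurable_X[OF assms]]) simp
  show int: "integrable M (\<lambda>\<omega>. f (X i \<omega>))"
    using AE_step[OF assms] by (intro integrable_const_bound[where B = "\<bar>f 1\<bar> + \<bar>f (-1)\<bar>"]) (auto elim!: eventually_mono)
  have i: "integrable M (\<lambda>\<omega>. of_bool (X i \<omega> = c) :: real)" for c
    by (rule integrable_const_bound[where B = 1]) auto
  have "expectation (\<lambda>\<omega>. f (X i \<omega>)) = expectation (\<lambda>\<omega>. f 1 * of_bool (X i \<omega> = 1) + f (-1) * of_bool (X i \<omega> = -1))"
    using AE_step[OF assms] by (intro integral_cong_AE) (auto elim!: eventually_mono)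
  also have "\<dots> = f 1 * prob {\<omega> \<in> space M. X i \<omega> = 1} + f (-1) * prob {\<omega> \<in> space M. X i \<omega> = -1}"
    using i by (simp add: expectation_of_bool)
  finally show "expectation (\<lambda>\<omega>. f (X i \<omega>)) = p * f 1 + (1 - p) * f (-1)"
    using prob_up[OF assms] prob_down[OF assms] by (simp add: mult.commute)
qed

lemma distr_X_eq:
  assumes "i \<ge> 1" "j \<ge> 1"
  shows "distr M (count_space UNIV) (X i) = distr M (count_space UNIV) (X j)"
proof (rule measure_eqI_countable[where A = UNIV])
  note [measurable] = measurable_X[OF assms(1)] measurable_X[OF assms(2)]
  fix c :: int
  have *: "emeasure (distr M (count_space UNIV) (X l)) {c} = ennreal (p * of_bool (1 = c) + (1 - p) * of_bool (-1 = c))"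
    if l: "l \<ge> 1" for l
  proof -
    note [measurable] = measurable_X[OF l]
    have "emeasure (distr M (count_space UNIV) (X l)) {c} = emeasure M (X l -` {c} \<inter> space M)"
      by (subst emeasure_distr) auto
    also have "X l -` {c} \<inter> space M = {\<omega> \<in> space M. X l \<omega> = c}" by auto
    also have "emeasure M \<dots> = ennreal (prob \<dots>)" by (rule emeasure_eq_measure)
    also have "prob {\<omega> \<in> space M. X l \<omega> = c} = p * of_bool (1 = c) + (1 - p) * of_bool (-1 = c)"
      using expectation_step(1)[OF l, of "\<lambda>x. of_bool (x = c)"] by (subst (asm) expectation_of_bool) auto
    finally show ?thesis .
  qed
  show "emeasure (distr M (count_space UNIV) (X i)) {c} = emeasure (distr M (count_space UNIV) (X j)) {c}"
    using *[OF assms(1)] *[OF assms(2)] by simp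
qed auto

text \<open>The shift by \<open>i\<close> is an injective reindexing of an i.i.d. product, so the
  law of the future does not depend on \<open>i\<close>.\<close>

lemma distr_steps:
  "distr M int_seqs (steps i) = PiM UNIV (\<lambda>_. distr M (count_space UNIV) (X 1))"
proof -
  \<comment> \<open>The step laws are controlled only for indices at least 1; \<open>max 1 j\<close>
    gives a family over all naturals that agrees with them there.\<close>
  define D where "D j = distr M (count_space UNIV) (X (max 1 j))" for j
  have D: "prob_space (D j)" for j unfolding D_def by (intro prob_space_distr measurable_X) simp
  have D1: "D j = D 1" for j unfolding D_def by (rule distr_X_eq) auto
  have "distr M (PiM {1..} (\<lambda>_. count_space UNIV)) (\<lambda>\<omega>. \<lambda>j\<in>{1..}. X j \<omega>) = PiM {1..} (\<lambda>j. distr M (count_space UNIV) (X j))"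
    using indep by (subst (asm) indep_vars_iff_distr_eq_PiM') (auto intro: measurable_X)
  also have "\<dots> = PiM {1..} D"
    by (intro PiM_cong) (auto simp: D_def max_def)
  finally have eq: "distr M (PiM {1..} (\<lambda>_. count_space UNIV)) (\<lambda>\<omega>. \<lambda>j\<in>{1..}. X j \<omega>) = PiM {1..} D" .
  have 1: "distr (PiM {1..} D) (PiM UNIV (\<lambda>j. D (Suc (i + j)))) (\<lambda>x. \<lambda>j\<in>UNIV. x (Suc (i + j))) = PiM UNIV (\<lambda>j. D (Suc (i + j)))"
    using D by (intro distr_PiM_reindex) (auto simp: inj_on_def)
  have 2: "PiM UNIV (\<lambda>j. D (Suc (i + j))) = PiM UNIV (\<lambda>_. D 1)" by (intro PiM_cong D1) auto
  have "PiM UNIV (\<lambda>_. D 1) = distr (PiM {1..} D) (PiM UNIV (\<lambda>_. D 1)) (\<lambda>x. \<lambda>j\<in>UNIV. x (Suc (i + j)))"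
    using 1 unfolding 2 by (rule sym)
  also have "\<dots> = distr (PiM {1..} D) int_seqs (\<lambda>x. \<lambda>j\<in>UNIV. x (Suc (i + j)))"
    by (intro distr_cong refl sets_PiM_cong) (auto simp: D_def)
  also have "\<dots> = distr M int_seqs ((\<lambda>x. \<lambda>j\<in>UNIV. x (Suc (i + j))) \<circ> (\<lambda>\<omega>. \<lambda>j\<in>{1..}. X j \<omega>))"
    unfolding eq[symmetric]
  proof (intro distr_distr)
    show "(\<lambda>x. \<lambda>j\<in>UNIV. x (Suc (i + j))) \<in> measurable (PiM {1..} (\<lambda>_. count_space UNIV)) int_seqs"
      by (intro measurable_restrict measurable_component_singleton) auto
    show "(\<lambda>\<omega>. \<lambda>j\<in>{1..}. X j \<omega>) \<in> measurable M (PiM {1..} (\<lambda>_. count_space UNIV))"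
      by (intro measurable_restrict measurable_X) auto
  qed
  also have "(\<lambda>x. \<lambda>j\<in>UNIV. x (Suc (i + j))) \<circ> (\<lambda>\<omega>. \<lambda>j\<in>{1..}. X j \<omega>) = steps i"
    by (auto simp: fun_eq_iff steps_def)
  finally show ?thesis by (simp add: D_def)
qed

lemma expectation_steps:
  fixes F :: "(nat \<Rightarrow> int) \<Rightarrow> real"
  assumes "F \<in> borel_measurable int_seqs"
  shows "expectation (\<lambda>\<omega>. F (steps i \<omega>)) = expectation (\<lambda>\<omega>. F (steps 0 \<omega>))"
proof -
  have "expectation (\<lambda>\<omega>. F (steps i \<omega>)) = (\<integral>x. F x \<partial>PiM UNIV (\<lambda>_. distr M (count_space UNIV) (X 1)))" for i
    unfolding distr_steps[of i, symmetric] using assms by (subst integral_distr) auto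
  thus ?thesis by simp
qed

lemma prob_steps:
  assumes P: "Measurable.pred int_seqs P"
  shows "prob {\<omega> \<in> space M. P (steps i \<omega>)} = prob {\<omega> \<in> space M. P (steps 0 \<omega>)}"
proof -
  have m: "Measurable.pred M (\<lambda>\<omega>. P (steps i \<omega>))" for i by (rule measurable_compose[OF measurable_steps P])
  have "(\<lambda>x. of_bool (P x) :: real) \<in> borel_measurable int_seqs" by (rule measurable_compose[OF P]) simp
  from expectation_steps[OF this, of i] show ?thesis using m by (simp add: expectation_of_bool)
qed

lemma indep_steps_product:
  fixes F G :: "(nat \<Rightarrow> int) \<Rightarrow> real"
  assumes [measurable]: "F \<in> borel_measurable int_seqs" "G \<in> borel_measurable int_seqs"
    and F: "\<And>x y. (\<And>l. l < T \<Longrightarrow> x l = y l) \<Longrightarrow> F x = F y" and G: "\<And>x y. (\<And>l. l < T \<Longrightarrow> x l = y l) \<Longrightarrow> G x = G y"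
    and b: "\<And>x. \<bar>F x\<bar> \<le> B" "\<And>x. \<bar>G x\<bar> \<le> B" and ij: "i + T \<le> j"
  shows "expectation (\<lambda>\<omega>. F (steps i \<omega>) * G (steps j \<omega>)) = expectation (\<lambda>\<omega>. F (steps i \<omega>)) * expectation (\<lambda>\<omega>. G (steps j \<omega>))"
proof -
  define I where "I i = {Suc i..i + T}" for i
  \<comment> \<open>Rebuilds a full step sequence from the block \<open>I i\<close>, padded by 0
    beyond \<open>T\<close>, where \<open>F\<close> and \<open>G\<close> do not look. The blocks of
    \<open>i\<close> and \<open>j\<close> are disjoint because \<open>i + T \<le> j\<close>.\<close>
  define E where "E i f = (\<lambda>l. if l < T then f (Suc (i + l)) else 0 :: int)" for i :: nat and f :: "nat \<Rightarrow> int"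
  have Em: "E i \<in> measurable (PiM (I i) (\<lambda>_. count_space UNIV)) int_seqs" for i
    unfolding E_def
  proof (rule measurable_PiM_single')
    fix l
    show "(\<lambda>f. if l < T then f (Suc (i + l)) else 0) \<in> measurable (PiM (I i) (\<lambda>_. count_space UNIV)) (count_space UNIV)"
      by (cases "l < T") (auto simp: I_def intro!: measurable_component_singleton)
  qed auto
  have iv: "indep_var (PiM (I i) (\<lambda>_. count_space UNIV)) (\<lambda>\<omega>. restrict (\<lambda>i. X i \<omega>) (I i))
      (PiM (I j) (\<lambda>_. count_space UNIV)) (\<lambda>\<omega>. restrict (\<lambda>i. X i \<omega>) (I j))"
    using ij by (intro indep_var_restrict[OF indep]) (auto simp: I_def)
  have "indep_var borel (F \<circ> E i \<circ> (\<lambda>\<omega>. restrict (\<lambda>i. X i \<omega>) (I i))) borel (G \<circ> E j \<circ> (\<lambda>\<omega>. restrict (\<lambda>i. X i \<omega>) (I j)))"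
    by (rule indep_var_compose[OF iv]) (auto intro!: measurable_comp[OF Em])
  moreover have "F \<circ> E i \<circ> (\<lambda>\<omega>. restrict (\<lambda>i. X i \<omega>) (I i)) = (\<lambda>\<omega>. F (steps i \<omega>))"
    by (auto simp: fun_eq_iff E_def I_def steps_def intro!: F)
  moreover have "G \<circ> E j \<circ> (\<lambda>\<omega>. restrict (\<lambda>i. X i \<omega>) (I j)) = (\<lambda>\<omega>. G (steps j \<omega>))"
    by (auto simp: fun_eq_iff E_def I_def steps_def intro!: G)
  ultimately have "indep_var borel (\<lambda>\<omega>. F (steps i \<omega>)) borel (\<lambda>\<omega>. G (steps j \<omega>))" by simp
  thus ?thesis
    by (rule indep_var_lebesgue_integral) (rule integrable_const_bound[where B = B]; use b in auto)+
qed

end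

section \<open>Exponential bounds on late returns\<close>

context biased_walk
begin

text \<open>The exponential tilt minimising \<open>p t + (1 - p) / t\<close>, and the minimum, which is below 1
  because p differs from 1/2.\<close>

definition tilt :: real where "tilt = sqrt ((1 - p) / p)"
definition rate :: real where "rate = 2 * sqrt (p * (1 - p))"
text \<open>Sum over all d > T of the bounds \<open>max tilt (1 / tilt) ^ k * rate ^ d\<close> for
  being within distance \<open>k\<close> of the start after d steps.\<close>

definition tail :: "nat \<Rightarrow> nat \<Rightarrow> real" where
  "tail k T = max tilt (1 / tilt) ^ k * rate ^ Suc T / (1 - rate)"

lemma tilt_pos: "tilt > 0" using p by (simp add: tilt_def)

lemma rate_bounds: "0 \<le> rate" "rate < 1"
proof -
  show "0 \<le> rate" using p by (simp add: rate_def)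
  have "0 < (1 - 2 * p)\<^sup>2" using p by simp
  hence "4 * (p * (1 - p)) < 1" by (simp add: power2_eq_square algebra_simps)
  hence "sqrt (4 * (p * (1 - p))) < 1" by simp
  thus "rate < 1" by (simp add: rate_def real_sqrt_mult)
qed

text \<open>At this tilt both summands equal \<open>sqrt (p * (1 - p))\<close>, the equality case of
  the arithmetic-geometric mean inequality.\<close>

lemma tilt_sums: "p * tilt + (1 - p) * (1 / tilt) = rate"
proof -
  have a: "tilt = sqrt (1 - p) / sqrt p" by (simp add: tilt_def real_sqrt_divide)
  have sp: "sqrt p * sqrt p = p" "sqrt (1 - p) * sqrt (1 - p) = 1 - p" "sqrt p > 0" "sqrt (1 - p) > 0" using p by auto
  have "p * tilt = sqrt p * sqrt (1 - p)" unfolding a using sp by (simp add: field_simps)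
  moreover have "(1 - p) * (1 / tilt) = sqrt p * sqrt (1 - p)" unfolding a using sp by (simp add: field_simps)
  ultimately show ?thesis by (simp add: rate_def real_sqrt_mult)
qed

lemma expectation_tilt_walk:
  "expectation (\<lambda>\<omega>. tilt powi walk X d \<omega>) = rate ^ d" "integrable M (\<lambda>\<omega>. tilt powi walk X d \<omega>)"
proof -
  have eq: "tilt powi walk X d \<omega> = (\<Prod>i=1..d. tilt powi X i \<omega>)" for \<omega>
    using tilt_pos by (induction d) (simp_all add: walk_def power_int_add)
  have iv: "indep_vars (\<lambda>_. borel) (\<lambda>i \<omega>. tilt powi X i \<omega>) {1..d}"
    by (rule indep_vars_compose2[OF indep_vars_subset[OF indep]]) auto
  have e: "expectation (\<lambda>\<omega>. tilt powi X i \<omega>) = rate" if "i \<ge> 1" for i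
    using expectation_step(1)[OF that, of "\<lambda>x. tilt powi x"] tilt_sums by (simp add: power_int_minus inverse_eq_divide)
  have i: "integrable M (\<lambda>\<omega>. tilt powi X i \<omega>)" if "i \<in> {1..d}" for i
    using expectation_step(2)[of i "\<lambda>x. tilt powi x"] that by simp
  show "integrable M (\<lambda>\<omega>. tilt powi walk X d \<omega>)"
    unfolding eq by (rule indep_vars_integrable[OF _ iv i]) auto
  show "expectation (\<lambda>\<omega>. tilt powi walk X d \<omega>) = rate ^ d"
    unfolding eq by (subst indep_vars_lebesgue_integral[OF _ iv i]) (auto simp: e)
qed

text \<open>One of \<open>tilt\<close> and its inverse is at least 1, so their maximum to the power
  \<open>k\<close> compensates the smallest value of \<open>tilt powi s\<close> near 0. This gives
  the constant of the exponential Markov inequality for both directions of the drift.\<close>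

lemma tilt_lower_bound:
  assumes "\<bar>s\<bar> \<le> int k"
  shows "1 \<le> max tilt (1 / tilt) ^ k * tilt powi s"
proof -
  let ?R = "max tilt (1 / tilt)"
  have "1 \<le> tilt \<or> 1 \<le> 1 / tilt" using tilt_pos by (auto simp: field_simps)
  hence R: "?R \<ge> 1" by (simp add: le_max_iff_disj)
  have base: "1 \<le> ?R ^ k * y ^ n" if "n \<le> k" "y > 0" "1 / y \<le> ?R" for y n
  proof -
    have "(1 / y) ^ n \<le> ?R ^ n" using that by (intro power_mono) auto
    also have "\<dots> \<le> ?R ^ k" using R that by (intro power_increasing) auto
    finally have "(1 / y) ^ n * y ^ n \<le> ?R ^ k * y ^ n" using that by (intro mult_right_mono) auto
    thus ?thesis using that by (simp add: power_one_over)
  qed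
  show ?thesis
  proof (cases "s \<ge> 0")
    case True
    thus ?thesis using base[of "nat s" tilt] assms tilt_pos by (simp add: power_int_def)
  next
    case False
    thus ?thesis using base[of "nat (- s)" "inverse tilt"] assms tilt_pos by (simp add: power_int_def inverse_eq_divide)
  qed
qed

text \<open>Exponential Markov inequality: the indicator of the event is at most a constant times
  \<open>tilt powi walk X d \<omega>\<close>, whose mean is \<open>rate ^ d\<close>.\<close>

lemma prob_near_zero: "prob {\<omega> \<in> space M. \<bar>walk X d \<omega>\<bar> \<le> int k} \<le> max tilt (1 / tilt) ^ k * rate ^ d"
proof -
  have ev: "{\<omega> \<in> space M. \<bar>walk X d \<omega>\<bar> \<le> int k} \<in> events"
    using measurable_sets[OF measurable_walk[of d], of "{s. \<bar>s\<bar> \<le> int k}"] by (simp add: vimage_def Int_def conj_commute)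
  have i: "integrable M (\<lambda>\<omega>. of_bool (\<bar>walk X d \<omega>\<bar> \<le> int k) :: real)"
    by (rule integrable_const_bound[where B = 1]) (use ev in auto)
  have "prob {\<omega> \<in> space M. \<bar>walk X d \<omega>\<bar> \<le> int k} = expectation (\<lambda>\<omega>. of_bool (\<bar>walk X d \<omega>\<bar> \<le> int k))"
    by (rule expectation_of_bool[OF ev, symmetric])
  also have "\<dots> \<le> expectation (\<lambda>\<omega>. max tilt (1 / tilt) ^ k * tilt powi walk X d \<omega>)"
    using tilt_lower_bound tilt_pos
    by (intro integral_mono i integrable_mult_right expectation_tilt_walk(2)) (auto simp: of_bool_def)
  finally show ?thesis by (simp add: expectation_tilt_walk(1))
qed

lemma tail_nonneg: "0 \<le> tail k T"
  using rate_bounds tilt_pos by (simp add: tail_def)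

lemma tail_tendsto: "tail k \<longlonglongrightarrow> 0"
proof -
  have "(\<lambda>T. max tilt (1 / tilt) ^ k * rate ^ Suc T / (1 - rate)) \<longlonglongrightarrow> max tilt (1 / tilt) ^ k * 0 / (1 - rate)"
    using rate_bounds by (intro tendsto_intros LIMSEQ_Suc LIMSEQ_power_zero) auto
  thus ?thesis by (simp add: tail_def[abs_def])
qed

lemma sum_tail_bound: "(\<Sum>m\<le>n. tail k m) \<le> max tilt (1 / tilt) ^ k / (1 - rate)\<^sup>2"
proof -
  let ?C = "max tilt (1 / tilt) ^ k"
  have "(\<Sum>m\<le>n. tail k m) = ?C * rate / (1 - rate) * (\<Sum>m\<le>n. rate ^ m)"
  proof -
    have "tail k m = ?C * rate / (1 - rate) * rate ^ m" for m by (simp add: tail_def)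
    thus ?thesis by (simp only: sum_distrib_left)
  qed
  also have "\<dots> \<le> ?C * rate / (1 - rate) * (1 / (1 - rate))"
  proof (rule mult_left_mono)
    have "(\<Sum>m\<le>n. rate ^ m) \<le> (\<Sum>m. rate ^ m)"
      using rate_bounds by (intro sum_le_suminf summable_geometric) auto
    thus "(\<Sum>m\<le>n. rate ^ m) \<le> 1 / (1 - rate)" using rate_bounds by (simp add: suminf_geometric)
    show "0 \<le> ?C * rate / (1 - rate)" using rate_bounds tilt_pos by simp
  qed
  also have "\<dots> \<le> ?C * 1 / (1 - rate) * (1 / (1 - rate))"
    using rate_bounds tilt_pos by (intro mult_right_mono divide_right_mono mult_left_mono) auto
  finally show ?thesis by (simp add: power2_eq_square)
qed

lemma prob_late_return:
  "prob {\<omega> \<in> space M. \<exists>d\<in>{T<..m}. \<bar>psum (steps i \<omega>) d\<bar> \<le> int k} \<le> tail k T"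
proof -
  let ?C = "max tilt (1 / tilt) ^ k"
  have [measurable]: "Measurable.pred int_seqs (\<lambda>x. \<bar>psum x d\<bar> \<le> int k)" for d
    by (rule measurable_compose[OF measurable_psum]) simp
  have "prob {\<omega> \<in> space M. \<exists>d\<in>{T<..m}. \<bar>psum (steps i \<omega>) d\<bar> \<le> int k}
      = prob {\<omega> \<in> space M. \<exists>d\<in>{T<..m}. \<bar>psum (steps 0 \<omega>) d\<bar> \<le> int k}"
    by (rule prob_steps) measurable
  also have "\<dots> = prob (\<Union>d\<in>{T<..m}. {\<omega> \<in> space M. \<bar>walk X d \<omega>\<bar> \<le> int k})"
    by (intro arg_cong[where f = prob]) (auto simp: walk_eq_psum)
  also have "\<dots> \<le> (\<Sum>d\<in>{T<..m}. prob {\<omega> \<in> space M. \<bar>walk X d \<omega>\<bar> \<le> int k})"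
  proof (rule measure_UNION_le)
    fix d
    show "{\<omega> \<in> space M. \<bar>walk X d \<omega>\<bar> \<le> int k} \<in> events"
      using measurable_sets[OF measurable_walk[of d], of "{s. \<bar>s\<bar> \<le> int k}"] by (simp add: vimage_def Int_def conj_commute)
  qed auto
  also have "\<dots> \<le> (\<Sum>d\<in>{T<..m}. ?C * rate ^ d)" by (intro sum_mono prob_near_zero)
  also have "\<dots> = ?C * rate ^ Suc T * (\<Sum>d<m - T. rate ^ d)"
  proof -
    have "(\<Sum>d\<in>{T<..m}. rate ^ d) = (\<Sum>d<m - T. rate ^ (Suc T + d))"
      by (intro sum.reindex_bij_witness[of _ "\<lambda>d. Suc T + d" "\<lambda>d. d - Suc T"]) auto
    hence "(\<Sum>d\<in>{T<..m}. rate ^ d) = rate ^ Suc T * (\<Sum>d<m - T. rate ^ d)"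
      by (simp only: power_add sum_distrib_left)
    thus ?thesis by (simp only: sum_distrib_left[symmetric] mult.assoc)
  qed
  also have "\<dots> \<le> ?C * rate ^ Suc T * (1 / (1 - rate))"
  proof (rule mult_left_mono)
    have "(\<Sum>d<m - T. rate ^ d) \<le> (\<Sum>d. rate ^ d)"
      using rate_bounds by (intro sum_le_suminf summable_geometric) auto
    thus "(\<Sum>d<m - T. rate ^ d) \<le> 1 / (1 - rate)" using rate_bounds by (simp add: suminf_geometric)
    show "0 \<le> ?C * rate ^ Suc T" using rate_bounds tilt_pos by simp
  qed
  finally show ?thesis by (simp add: tail_def)
qed

lemma window_abs: "a \<le> k \<Longrightarrow> s \<in> window k a \<Longrightarrow> \<bar>s\<bar> \<le> int k"
  by (auto simp: window_def)

text \<open>Limit of \<open>prob_late_return\<close> along the increasing events as the upper end of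
  the time range grows; the bound does not depend on that end.\<close>

lemma prob_late_walk:
  "prob {\<omega> \<in> space M. \<exists>d>T. \<bar>walk X d \<omega>\<bar> \<le> int k} \<le> tail k T"
  and late_walk_event: "{\<omega> \<in> space M. \<exists>d>T. \<bar>walk X d \<omega>\<bar> \<le> int k} \<in> events"
proof -
  define A where "A m = {\<omega> \<in> space M. \<exists>d\<in>{T<..m}. \<bar>psum (steps 0 \<omega>) d\<bar> \<le> int k}" for m
  have un: "(\<Union>m. A m) = {\<omega> \<in> space M. \<exists>d>T. \<bar>walk X d \<omega>\<bar> \<le> int k}"
    by (auto simp: A_def walk_eq_psum) (meson greaterThanAtMost_iff order_refl)
  have [measurable]: "Measurable.pred M (\<lambda>\<omega>. \<bar>psum (steps 0 \<omega>) d\<bar> \<le> int k)" for d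
    by (rule measurable_compose[OF measurable_compose[OF measurable_steps measurable_psum]]) simp
  have ev: "A m \<in> events" for m unfolding A_def by measurable
  thus "{\<omega> \<in> space M. \<exists>d>T. \<bar>walk X d \<omega>\<bar> \<le> int k} \<in> events" unfolding un[symmetric] by auto
  have "(\<lambda>m. prob (A m)) \<longlonglongrightarrow> prob (\<Union>m. A m)"
    using ev by (intro finite_Lim_measure_incseq) (auto simp: incseq_def A_def)
  hence "prob (\<Union>m. A m) \<le> tail k T"
    by (rule LIMSEQ_le_const2) (use prob_late_return in \<open>auto simp: A_def\<close>)
  thus "prob {\<omega> \<in> space M. \<exists>d>T. \<bar>walk X d \<omega>\<bar> \<le> int k} \<le> tail k T" by (simp add: un)
qed

lemma prob_diff_le:
  assumes "P \<in> events" "Q \<in> events" "E \<in> events" "P - E \<subseteq> Q" "Q - E \<subseteq> P"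
  shows "\<bar>prob P - prob Q\<bar> \<le> prob E"
proof -
  have "prob P \<le> prob (Q \<union> E)" "prob Q \<le> prob (P \<union> E)" using assms by (intro finite_measure_mono; auto)+
  moreover have "prob (Q \<union> E) \<le> prob Q + prob E" "prob (P \<union> E) \<le> prob P + prob E"
    using assms by (intro measure_Un_le; auto)+
  ultimately show ?thesis by linarith
qed

text \<open>Expresses the possibly infinite total through counts over finite ranges with quantifiers
  over naturals, from which measurability is immediate. With infinitely many visits the counts are
  unbounded, so no \<open>T\<close> can work.\<close>

lemma visits_eq_iff:
  "visits X A \<omega> = enat c \<longleftrightarrow> (\<exists>T. \<forall>T'\<ge>T. card {i\<in>{..T'}. walk X i \<omega> \<in> A} = c)"
proof -
  define S where "S = {i. walk X i \<omega> \<in> A}"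
  have S: "{i\<in>{..T'}. walk X i \<omega> \<in> A} = S \<inter> {..T'}" for T' by (auto simp: S_def)
  show ?thesis
  proof (cases "finite S")
    case True
    then obtain T where T: "S \<subseteq> {..T}" using finite_nat_iff_bounded_le by auto
    hence "S \<inter> {..T'} = S" if "T' \<ge> T" for T' using that by force
    hence "(\<exists>T. \<forall>T'\<ge>T. card (S \<inter> {..T'}) = c) \<longleftrightarrow> card S = c"
      by (metis nle_le)
    thus ?thesis using True unfolding S by (simp add: visits_def S_def)
  next
    case False
    have "\<not> (\<forall>T'\<ge>T. card (S \<inter> {..T'}) = c)" for T
    proof
      assume *: "\<forall>T'\<ge>T. card (S \<inter> {..T'}) = c"
      obtain B where B: "finite B" "card B = Suc c" "B \<subseteq> S" using infinite_arbitrarily_large[OF False] by metis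
      then obtain T1 where "B \<subseteq> {..T1}" using finite_nat_iff_bounded_le by auto
      hence "B \<subseteq> S \<inter> {..max T T1}" using B by force
      hence "card B \<le> card (S \<inter> {..max T T1})" by (intro card_mono) auto
      thus False using * B by simp
    qed
    thus ?thesis using False unfolding S by (simp add: visits_def S_def)
  qed
qed

lemma visits_event: "{\<omega> \<in> space M. visits X A \<omega> = enat c} \<in> events"
proof -
  have [measurable]: "Measurable.pred M (\<lambda>\<omega>. walk X i \<omega> \<in> A)" for i
    by (rule measurable_compose[OF measurable_walk]) simp
  have "(\<lambda>\<omega>. card {i\<in>{..T}. walk X i \<omega> \<in> A}) = (\<lambda>\<omega>. \<Sum>i\<in>{..T}. of_bool (walk X i \<omega> \<in> A))" for T
    by (intro ext card_filter_eq_sum) simp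
  moreover have "(\<lambda>\<omega>. \<Sum>i\<in>{..T}. of_bool (walk X i \<omega> \<in> A) :: nat) \<in> measurable M (count_space UNIV)" for T by measurable
  ultimately have [measurable]: "(\<lambda>\<omega>. card {i\<in>{..T}. walk X i \<omega> \<in> A}) \<in> measurable M (count_space UNIV)" for T by simp
  show ?thesis unfolding visits_eq_iff by measurable
qed

section \<open>Cluster size distribution\<close>

definition visit_mass_upto :: "nat \<Rightarrow> nat \<Rightarrow> nat \<Rightarrow> real" where
  "visit_mass_upto k T j = (\<Sum>a\<le>k. prob {\<omega> \<in> space M. returns k a T (steps 0 \<omega>) = j})"

text \<open>The index is shifted: \<open>visit_mass k j\<close> sums \<open>P(N(A) = j + 1)\<close>, and the approximation
  \<open>visit_mass_upto\<close> counts the j returns after time 0.\<close>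

definition visit_mass :: "nat \<Rightarrow> nat \<Rightarrow> real" where
  "visit_mass k j = (\<Sum>a\<le>k. prob {\<omega> \<in> space M. visits X (window k a) \<omega> = enat (Suc j)})"

lemma measurable_returns_steps [measurable]:
  "(\<lambda>\<omega>. returns k a T (steps i \<omega>)) \<in> measurable M (count_space UNIV)"
  by (rule measurable_compose[OF measurable_steps measurable_returns])

text \<open>Unless the walk is within distance \<open>k\<close> of 0 after time \<open>T\<close>,
  the visits to a window are time 0 plus the returns up to \<open>T\<close>. Each of the
  \<open>k + 1\<close> windows costs one \<open>tail\<close>.\<close>

lemma visit_mass_upto_approx: "\<bar>visit_mass_upto k T j - visit_mass k j\<bar> \<le> (real k + 1) * tail k T"
proof -
  have "\<bar>prob {\<omega> \<in> space M. returns k a T (steps 0 \<omega>) = j} - prob {\<omega> \<in> space M. visits X (window k a) \<omega> = enat (Suc j)}\<bar> \<le> tail k T"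
    if a: "a \<le> k" for a
  proof -
    have eq: "visits X (window k a) \<omega> = enat (Suc (returns k a T (steps 0 \<omega>)))"
      if "\<not> (\<exists>d>T. \<bar>walk X d \<omega>\<bar> \<le> int k)" for \<omega>
    proof -
      have "{i. walk X i \<omega> \<in> window k a} = insert 0 {d\<in>{0<..T}. psum (steps 0 \<omega>) d \<in> window k a}"
      proof (intro equalityI subsetI)
        fix i assume "i \<in> {i. walk X i \<omega> \<in> window k a}"
        hence i: "walk X i \<omega> \<in> window k a" by simp
        hence "i \<le> T" using window_abs[OF a i] that by (meson not_le)
        thus "i \<in> insert 0 {d\<in>{0<..T}. psum (steps 0 \<omega>) d \<in> window k a}" using i by (auto simp: walk_eq_psum)
      qed (use a in \<open>auto simp: walk_eq_psum window_def psum_def\<close>)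
      thus ?thesis by (simp add: visits_def returns_def)
    qed
    have "\<bar>prob {\<omega> \<in> space M. returns k a T (steps 0 \<omega>) = j} - prob {\<omega> \<in> space M. visits X (window k a) \<omega> = enat (Suc j)}\<bar>
        \<le> prob {\<omega> \<in> space M. \<exists>d>T. \<bar>walk X d \<omega>\<bar> \<le> int k}"
    proof (rule prob_diff_le[OF _ visits_event late_walk_event])
      show "{\<omega> \<in> space M. returns k a T (steps 0 \<omega>) = j} \<in> events" by measurable
    qed (use eq in auto)
    also have "\<dots> \<le> tail k T" by (rule prob_late_walk)
    finally show ?thesis .
  qed
  hence "(\<Sum>a\<le>k. \<bar>prob {\<omega> \<in> space M. returns k a T (steps 0 \<omega>) = j} - prob {\<omega> \<in> space M. visits X (window k a) \<omega> = enat (Suc j)}\<bar>)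
      \<le> (\<Sum>a\<le>k. tail k T)" by (intro sum_mono) auto
  moreover have "\<bar>visit_mass_upto k T j - visit_mass k j\<bar> \<le> (\<Sum>a\<le>k. \<bar>prob {\<omega> \<in> space M. returns k a T (steps 0 \<omega>) = j} - prob {\<omega> \<in> space M. visits X (window k a) \<omega> = enat (Suc j)}\<bar>)"
    unfolding visit_mass_upto_def visit_mass_def sum_subtractf[symmetric] by (rule sum_abs)
  ultimately show ?thesis by (simp add: algebra_simps)
qed

lemma returns_steps_eq:
  "i \<le> n \<Longrightarrow> returns k a (n - i) (steps i \<omega>) = card {i'\<in>{i<..n}. walk X i' \<omega> - walk X i \<omega> \<in> window k a}"
proof -
  assume "i \<le> n"
  have "bij_betw (\<lambda>d. i + d) {d\<in>{0<..n - i}. psum (steps i \<omega>) d \<in> window k a} {i'\<in>{i<..n}. walk X i' \<omega> - walk X i \<omega> \<in> window k a}"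
    by (rule bij_betw_byWitness[where f' = "\<lambda>i'. i' - i"]) (auto simp: walk_add \<open>i \<le> n\<close> dest: le_Suc_ex less_imp_add_positive)
  thus ?thesis unfolding returns_def by (rule bij_betw_same_card)
qed

definition windows_hit :: "nat \<Rightarrow> nat \<Rightarrow> nat \<Rightarrow> 'a \<Rightarrow> real" where
  "windows_hit k n j \<omega> = (\<Sum>s\<in>site_range k n. of_bool (j < card (hits k n (\<lambda>i. walk X i \<omega>) s)))"

lemma measurable_windows_hit [measurable]: "windows_hit k n j \<in> borel_measurable M"
proof -
  have [measurable]: "Measurable.pred M (\<lambda>\<omega>. walk X i \<omega> \<in> A)" for i A
    by (rule measurable_compose[OF measurable_walk]) simp
  have "(\<lambda>\<omega>. card (hits k n (\<lambda>i. walk X i \<omega>) s)) = (\<lambda>\<omega>. \<Sum>i\<in>{..n}. of_bool (walk X i \<omega> \<in> {s - int k..s}))" for s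
    unfolding hits_def by (intro ext card_filter_eq_sum) simp
  moreover have "(\<lambda>\<omega>. \<Sum>i\<in>{..n}. of_bool (walk X i \<omega> \<in> {s - int k..s}) :: nat) \<in> measurable M (count_space UNIV)" for s by measurable
  ultimately have [measurable]: "(\<lambda>\<omega>. card (hits k n (\<lambda>i. walk X i \<omega>) s)) \<in> measurable M (count_space UNIV)" for s by simp
  show ?thesis unfolding windows_hit_def[abs_def] by measurable
qed

lemma integrable_windows_hit: "integrable M (windows_hit k n j)"
proof (rule integrable_const_bound[where B = "real (card (site_range k n))"])
  show "AE \<omega> in M. norm (windows_hit k n j \<omega>) \<le> real (card (site_range k n))"
  proof (intro AE_I2)
    fix \<omega>
    have "windows_hit k n j \<omega> \<le> (\<Sum>s\<in>site_range k n. 1)" unfolding windows_hit_def by (intro sum_mono) auto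
    moreover have "0 \<le> windows_hit k n j \<omega>" unfolding windows_hit_def by (intro sum_nonneg) auto
    ultimately show "norm (windows_hit k n j \<omega>) \<le> real (card (site_range k n))" by simp
  qed
qed measurable

text \<open>Each window with more than j visits is counted exactly once, at its (j + 1)-st visit from the end.\<close>

lemma expectation_windows_hit: "expectation (windows_hit k n j) = (\<Sum>i\<le>n. visit_mass_upto k i j)"
proof -
  have i: "integrable M (\<lambda>\<omega>. of_bool (returns k a T (steps i \<omega>) = j) :: real)" for a T i
    by (rule integrable_const_bound[where B = 1]) auto
  have "expectation (windows_hit k n j) = expectation (\<lambda>\<omega>. \<Sum>i\<le>n. \<Sum>a\<le>k. of_bool (returns k a (n - i) (steps i \<omega>) = j))"
  proof (rule integral_cong_AE)
    show "AE \<omega> in M. windows_hit k n j \<omega> = (\<Sum>i\<le>n. \<Sum>a\<le>k. of_bool (returns k a (n - i) (steps i \<omega>) = j))"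
      using AE_nn_path
    proof eventually_elim
      case (elim \<omega>)
      have "windows_hit k n j \<omega> = (\<Sum>i\<le>n. \<Sum>a\<le>k. of_bool (card {i'\<in>{i<..n}. walk X i' \<omega> - walk X i \<omega> \<in> window k a} = j))"
        unfolding windows_hit_def using elim by (intro cluster_count[symmetric]) auto
      also have "\<dots> = (\<Sum>i\<le>n. \<Sum>a\<le>k. of_bool (returns k a (n - i) (steps i \<omega>) = j))"
        by (intro sum.cong refl) (simp add: returns_steps_eq)
      finally show ?case .
    qed
  qed measurable
  also have "\<dots> = (\<Sum>i\<le>n. \<Sum>a\<le>k. expectation (\<lambda>\<omega>. of_bool (returns k a (n - i) (steps i \<omega>) = j)))"
    using i by (simp add: Bochner_Integration.integral_sum Bochner_Integration.integrable_sum del: sum_of_bool_eq)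
  also have "\<dots> = (\<Sum>i\<le>n. \<Sum>a\<le>k. prob {\<omega> \<in> space M. returns k a (n - i) (steps 0 \<omega>) = j})"
  proof (intro sum.cong refl)
    fix i a
    have "expectation (\<lambda>\<omega>. of_bool (returns k a (n - i) (steps i \<omega>) = j)) = prob {\<omega> \<in> space M. returns k a (n - i) (steps i \<omega>) = j}"
      by (rule expectation_of_bool) measurable
    also have "\<dots> = prob {\<omega> \<in> space M. returns k a (n - i) (steps 0 \<omega>) = j}"
      by (rule prob_steps) measurable
    finally show "expectation (\<lambda>\<omega>. of_bool (returns k a (n - i) (steps i \<omega>) = j)) = prob {\<omega> \<in> space M. returns k a (n - i) (steps 0 \<omega>) = j}" .
  qed
  also have "\<dots> = (\<Sum>i\<le>n. visit_mass_upto k (n - i) j)" by (simp add: visit_mass_upto_def)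
  also have "\<dots> = (\<Sum>i\<le>n. visit_mass_upto k i j)" by (intro sum.reindex_bij_witness[of _ "\<lambda>i. n - i" "\<lambda>i. n - i"]) auto
  finally show ?thesis .
qed

text \<open>The errors \<open>tail k i\<close> are summable in \<open>i\<close>, so the deviation
  stays bounded as \<open>n\<close> grows. Inequalities between expected counts then pass to
  \<open>visit_mass\<close> by \<open>le_of_linear_bound\<close>.\<close>

lemma windows_hit_average:
  "\<bar>expectation (windows_hit k n j) - (real n + 1) * visit_mass k j\<bar> \<le> (real k + 1) * (max tilt (1 / tilt) ^ k / (1 - rate)\<^sup>2)"
proof -
  have "expectation (windows_hit k n j) - (real n + 1) * visit_mass k j = (\<Sum>i\<le>n. visit_mass_upto k i j - visit_mass k j)"
    by (simp add: expectation_windows_hit sum_subtractf algebra_simps)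
  also have "\<bar>\<dots>\<bar> \<le> (\<Sum>i\<le>n. (real k + 1) * tail k i)"
    by (rule order_trans[OF sum_abs]) (intro sum_mono visit_mass_upto_approx)
  also have "\<dots> = (real k + 1) * (\<Sum>i\<le>n. tail k i)" by (simp add: sum_distrib_left)
  also have "\<dots> \<le> (real k + 1) * (max tilt (1 / tilt) ^ k / (1 - rate)\<^sup>2)"
    by (intro mult_left_mono sum_tail_bound) auto
  finally show ?thesis .
qed

lemma le_of_linear_bound:
  fixes a b c :: real
  assumes "\<And>n :: nat. (real n + 1) * a \<le> (real n + 1) * b + c"
  shows "a \<le> b"
proof (rule ccontr)
  assume "\<not> a \<le> b"
  hence ab: "a - b > 0" by simp
  obtain n where n: "real n > c / (a - b)" using reals_Archimedean2 by blast
  hence "c < real n * (a - b)" using ab by (simp add: field_simps)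
  also have "\<dots> \<le> (real n + 1) * (a - b)" using ab by (intro mult_right_mono) auto
  finally show False using assms[of n] by (simp add: algebra_simps)
qed

lemma visit_mass_decreasing: "visit_mass k (Suc j) \<le> visit_mass k j"
proof (rule le_of_linear_bound)
  fix n
  have "expectation (windows_hit k n (Suc j)) \<le> expectation (windows_hit k n j)"
    unfolding windows_hit_def
    by (intro integral_mono integrable_windows_hit[unfolded windows_hit_def[abs_def]] sum_mono) auto
  thus "(real n + 1) * visit_mass k (Suc j) \<le> (real n + 1) * visit_mass k j + 2 * ((real k + 1) * (max tilt (1 / tilt) ^ k / (1 - rate)\<^sup>2))"
    using windows_hit_average[of k n "Suc j"] windows_hit_average[of k n j] by linarith
qed

text \<open>The sites visited form an interval, so the number of windows hit exceeds the number of sites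
  visited by exactly k.\<close>

lemma visit_mass_0_eq: "visit_mass k 0 = visit_mass 0 0"
proof -
  have e: "expectation (windows_hit k n 0) = expectation (windows_hit 0 n 0) + real k" for n
  proof -
    have "expectation (windows_hit k n 0) = expectation (\<lambda>\<omega>. windows_hit 0 n 0 \<omega> + real k)"
    proof (rule integral_cong_AE)
      show "AE \<omega> in M. windows_hit k n 0 \<omega> = windows_hit 0 n 0 \<omega> + real k"
        using AE_nn_path
      proof eventually_elim
        case (elim \<omega>)
        hence "nn_path (\<lambda>i. walk X i \<omega>) n" by simp
        from count_visited_windows(1)[OF this, of k] count_visited_windows(1)[OF this, of 0]
        show ?case by (simp add: windows_hit_def)
      qed
    qed measurable
    thus ?thesis using integrable_windows_hit by (simp add: prob_space)
  qed
  let ?c = "\<lambda>k. (real k + 1) * (max tilt (1 / tilt) ^ k / (1 - rate)\<^sup>2)"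
  show ?thesis
  proof (rule antisym)
    show "visit_mass k 0 \<le> visit_mass 0 0"
    proof (rule le_of_linear_bound)
      fix n
      show "(real n + 1) * visit_mass k 0 \<le> (real n + 1) * visit_mass 0 0 + (?c k + ?c 0 + real k)"
        using windows_hit_average[of k n 0] windows_hit_average[of 0 n 0] e[of n] by linarith
    qed
    show "visit_mass 0 0 \<le> visit_mass k 0"
    proof (rule le_of_linear_bound)
      fix n
      show "(real n + 1) * visit_mass 0 0 \<le> (real n + 1) * visit_mass k 0 + (?c k + ?c 0)"
        using windows_hit_average[of k n 0] windows_hit_average[of 0 n 0] e[of n] by linarith
    qed
  qed
qed

lemma expectation_walk: "expectation (\<lambda>\<omega>. real_of_int (walk X n \<omega>)) = real n * (2 * p - 1)"
  and integrable_walk: "integrable M (\<lambda>\<omega>. real_of_int (walk X n \<omega>))"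
proof -
  have i: "integrable M (\<lambda>\<omega>. real_of_int (X i \<omega>))" "expectation (\<lambda>\<omega>. real_of_int (X i \<omega>)) = 2 * p - 1" if "i \<in> {1..n}" for i
    using expectation_step[of i real_of_int] that by auto
  show "integrable M (\<lambda>\<omega>. real_of_int (walk X n \<omega>))"
    unfolding walk_def of_int_sum by (intro Bochner_Integration.integrable_sum i)
  show "expectation (\<lambda>\<omega>. real_of_int (walk X n \<omega>)) = real n * (2 * p - 1)"
    unfolding walk_def of_int_sum using i by (subst Bochner_Integration.integral_sum) auto
qed

text \<open>The number of sites visited is at least \<open>\<bar>S\<^sub>n\<bar>\<close>, whose expectation grows linearly because of the drift.\<close>

lemma visit_mass_0_pos: "visit_mass 0 0 > 0"
proof -
  let ?c = "(real 0 + 1) * (max tilt (1 / tilt) ^ 0 / (1 - rate)\<^sup>2)"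
  have "\<bar>2 * p - 1\<bar> \<le> visit_mass 0 0"
  proof (rule le_of_linear_bound)
    fix n
    have "real n * \<bar>2 * p - 1\<bar> = \<bar>expectation (\<lambda>\<omega>. real_of_int (walk X n \<omega>))\<bar>"
      by (simp add: expectation_walk abs_mult)
    also have "\<dots> \<le> expectation (\<lambda>\<omega>. \<bar>real_of_int (walk X n \<omega>)\<bar>)" by (rule integral_abs_bound)
    also have "\<dots> \<le> expectation (windows_hit 0 n 0)"
    proof (rule integral_mono_AE)
      show "AE \<omega> in M. \<bar>real_of_int (walk X n \<omega>)\<bar> \<le> windows_hit 0 n 0 \<omega>"
        using AE_nn_path
      proof eventually_elim
        case (elim \<omega>)
        hence "nn_path (\<lambda>i. walk X i \<omega>) n" by simp
        from count_visited_windows(1)[OF this, of 0] count_visited_windows(2)[OF this] show ?case by (simp add: windows_hit_def)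
      qed
    qed (use integrable_walk integrable_windows_hit in auto)
    finally have "real n * \<bar>2 * p - 1\<bar> \<le> expectation (windows_hit 0 n 0)" .
    thus "(real n + 1) * \<bar>2 * p - 1\<bar> \<le> (real n + 1) * visit_mass 0 0 + (?c + \<bar>2 * p - 1\<bar>)"
      using windows_hit_average[of 0 n 0] by (simp add: algebra_simps)
  qed
  thus ?thesis using p by (smt (verit) field_sum_of_halves)
qed

end

section \<open>The cluster size law and its generating function\<close>

context biased_walk
begin

text \<open>For \<open>k = 0\<close> the only window is {0}, visited at time 0; exactly one visit
  means that the walk never returns.\<close>

lemma no_return_prob_eq: "no_return_prob M X = visit_mass 0 0"
proof -
  have "visits X (window 0 0) \<omega> = enat (Suc 0) \<longleftrightarrow> (\<forall>i\<ge>1. walk X i \<omega> \<noteq> 0)" for \<omega>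
  proof -
    define S where "S = {i. walk X i \<omega> \<in> window 0 0}"
    have S: "S = {i. walk X i \<omega> = 0}" by (auto simp: S_def window_def)
    have "0 \<in> S" by (simp add: S)
    hence "visits X (window 0 0) \<omega> = enat (Suc 0) \<longleftrightarrow> S = {0}"
      unfolding visits_def S_def[symmetric] by (auto simp: card_1_singleton_iff)
    also have "S = {0} \<longleftrightarrow> (\<forall>i\<ge>1. walk X i \<omega> \<noteq> 0)"
    proof
      assume 0: "S = {0}"
      show "\<forall>i\<ge>1. walk X i \<omega> \<noteq> 0"
      proof (intro allI impI)
        fix i :: nat assume "1 \<le> i"
        hence "i \<notin> S" unfolding 0 by simp
        thus "walk X i \<omega> \<noteq> 0" unfolding S by simp
      qed
    next
      assume *: "\<forall>i\<ge>1. walk X i \<omega> \<noteq> 0"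
      have "i = 0" if "i \<in> S" for i
      proof (rule ccontr)
        assume "i \<noteq> 0"
        hence "walk X i \<omega> \<noteq> 0" using * by simp
        thus False using that unfolding S by simp
      qed
      with \<open>0 \<in> S\<close> show "S = {0}" by auto
    qed
    finally show ?thesis .
  qed
  thus ?thesis by (simp add: no_return_prob_def visit_mass_def)
qed

lemma no_return_prob_pos: "no_return_prob M X > 0"
  by (simp add: no_return_prob_eq visit_mass_0_pos)

lemma visit_mass_0: "visit_mass k 0 = no_return_prob M X"
  unfolding no_return_prob_eq by (rule visit_mass_0_eq)

lemma windows_containing_zero: "{A. 0 \<in> A \<and> (\<exists>a. A = {a..a + int k})} = window k ` {..k}"
proof (intro equalityI subsetI)
  fix A assume "A \<in> {A. 0 \<in> A \<and> (\<exists>a. A = {a..a + int k})}"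
  then obtain a where a: "A = {a..a + int k}" "0 \<in> A" by auto
  hence "A = window k (nat (a + int k))" "nat (a + int k) \<le> k" by (auto simp: window_def)
  thus "A \<in> window k ` {..k}" by auto
next
  fix A assume "A \<in> window k ` {..k}"
  then obtain a where a: "a \<le> k" "A = window k a" by auto
  hence "A = {(int a - int k)..(int a - int k) + int k}" "0 \<in> A" by (auto simp: window_def)
  thus "A \<in> {A. 0 \<in> A \<and> (\<exists>a. A = {a..a + int k})}" by blast
qed

lemma inj_window: "inj_on (window k) {..k}"
proof (rule inj_onI)
  fix a b assume "window k a = window k b"
  hence "int a - int k = int b - int k" unfolding window_def by (subst (asm) Icc_eq_Icc) auto
  thus "a = b" by simp
qed

lemma cluster_size_distr_eq:
  "cluster_size_distr M X k (Suc j) = (visit_mass k j - visit_mass k (Suc j)) / no_return_prob M X"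
  unfolding cluster_size_distr_def windows_containing_zero sum.reindex[OF inj_window]
  by (simp add: visit_mass_def sum_subtractf)

lemma visit_mass_nonneg: "0 \<le> visit_mass k j" unfolding visit_mass_def by (intro sum_nonneg) auto

lemma visit_mass_le: "visit_mass k j \<le> real k + 1"
proof -
  have "visit_mass k j \<le> (\<Sum>a\<le>k. 1)" unfolding visit_mass_def by (intro sum_mono) simp
  thus ?thesis by simp
qed

text \<open>For one window the events with different numbers of visits are disjoint. The resulting
  summability forces \<open>visit_mass k j\<close> to 0, so the differences in
  \<open>cluster_size_distr\<close> telescope to total mass 1.\<close>

lemma sum_visit_mass_le: "(\<Sum>j<J. visit_mass k j) \<le> real k + 1"
proof -
  have "(\<Sum>j<J. visit_mass k j) = (\<Sum>a\<le>k. \<Sum>j<J. prob {\<omega> \<in> space M. visits X (window k a) \<omega> = enat (Suc j)})"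
    unfolding visit_mass_def by (rule sum.swap)
  also have "\<dots> \<le> (\<Sum>a\<le>k. 1)"
  proof (rule sum_mono)
    fix a
    have "(\<Sum>j<J. prob {\<omega> \<in> space M. visits X (window k a) \<omega> = enat (Suc j)}) =
        prob (\<Union>j<J. {\<omega> \<in> space M. visits X (window k a) \<omega> = enat (Suc j)})"
      by (intro finite_measure_finite_Union[symmetric]) (auto simp: disjoint_family_on_def intro: visits_event)
    thus "(\<Sum>j<J. prob {\<omega> \<in> space M. visits X (window k a) \<omega> = enat (Suc j)}) \<le> 1" by simp
  qed
  finally show ?thesis by simp
qed

lemma visit_mass_tendsto_0: "visit_mass k \<longlonglongrightarrow> 0"
proof (rule summable_LIMSEQ_zero)
  show "summable (visit_mass k)" by (rule summableI_nonneg_bounded[where x = "real k + 1"]) (use visit_mass_nonneg sum_visit_mass_le in auto)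
qed

lemma cluster_size_distr_nonneg: "0 \<le> cluster_size_distr M X k (Suc j)"
  using visit_mass_decreasing[of k j] no_return_prob_pos by (simp add: cluster_size_distr_eq)

lemma cluster_size_distr_sums: "(\<lambda>j. cluster_size_distr M X k (Suc j)) sums 1"
proof -
  have "(\<lambda>j. (visit_mass k j - visit_mass k (Suc j)) / no_return_prob M X) sums ((visit_mass k 0 - 0) / no_return_prob M X)"
    by (intro sums_divide telescope_sums' visit_mass_tendsto_0)
  thus ?thesis using no_return_prob_pos by (simp add: cluster_size_distr_eq visit_mass_0)
qed

text \<open>Up to the factor \<open>\<tau> / real (k + 1)\<close>, this is the exponent per unit of
  time of the compound Poisson generating functional at constant weight \<open>z\<close>.\<close>

definition cluster_rate :: "nat \<Rightarrow> real \<Rightarrow> real" where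
  "cluster_rate k z = no_return_prob M X * (1 - (\<Sum>j. cluster_size_distr M X k (Suc j) * z ^ Suc j))"

definition return_gf :: "nat \<Rightarrow> nat \<Rightarrow> real \<Rightarrow> real" where
  "return_gf k T z = (\<Sum>a\<le>k. expectation (\<lambda>\<omega>. z ^ returns k a T (steps 0 \<omega>)))"

text \<open>The coefficientwise error is summed against \<open>z ^ j\<close>, which costs
  \<open>1 / (1 - z)\<close>; the prefactor \<open>1 - z\<close> cancels it and makes the bound
  uniform in \<open>z\<close>.\<close>

lemma return_gf_approx:
  assumes z: "0 \<le> z" "z < 1"
  shows "\<bar>(1 - z) * return_gf k T z - cluster_rate k z\<bar> \<le> (real k + 1) * tail k T"
proof -
  define q where "q = no_return_prob M X"
  have q: "q > 0" using no_return_prob_pos by (simp add: q_def)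
  have geo: "summable (\<lambda>j. z ^ j)" using z by (intro summable_geometric) auto
  have "(\<lambda>j. \<Sum>a\<le>k. expectation (\<lambda>\<omega>. 1 * of_bool (returns k a T (steps 0 \<omega>) = j)) * z ^ j) sums
      (\<Sum>a\<le>k. expectation (\<lambda>\<omega>. 1 * z ^ returns k a T (steps 0 \<omega>)))"
    by (intro sums_sum expectation_power_sums) (use z in auto)
  moreover have "expectation (\<lambda>\<omega>. of_bool (returns k a T (steps 0 \<omega>) = j)) = prob {\<omega> \<in> space M. returns k a T (steps 0 \<omega>) = j}" for a j
    by (rule expectation_of_bool) measurable
  ultimately have s1: "(\<lambda>j. visit_mass_upto k T j * z ^ j) sums return_gf k T z"
    by (simp add: visit_mass_upto_def return_gf_def sum_distrib_right)
  have sR: "summable (\<lambda>j. visit_mass k j * z ^ j)"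
  proof (rule summable_comparison_test'[where g = "\<lambda>j. (real k + 1) * z ^ j"])
    show "summable (\<lambda>j. (real k + 1) * z ^ j)" by (intro summable_mult geo)
    show "norm (visit_mass k j * z ^ j) \<le> (real k + 1) * z ^ j" for j
      using visit_mass_nonneg visit_mass_le z by (auto simp: abs_mult intro!: mult_right_mono)
  qed
  define \<rho> where "\<rho> = (\<Sum>j. visit_mass k j * z ^ j)"
  have s2: "(\<lambda>j. visit_mass k j * z ^ j) sums \<rho>" unfolding \<rho>_def using sR by (rule summable_sums)
  have s3: "(\<lambda>j. (visit_mass_upto k T j - visit_mass k j) * z ^ j) sums (return_gf k T z - \<rho>)"
    using sums_diff[OF s1 s2] by (simp add: left_diff_distrib)
  have "norm (\<Sum>j. (visit_mass_upto k T j - visit_mass k j) * z ^ j) \<le> (\<Sum>j. (real k + 1) * tail k T * z ^ j)"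
  proof (rule norm_suminf_le)
    show "norm ((visit_mass_upto k T j - visit_mass k j) * z ^ j) \<le> (real k + 1) * tail k T * z ^ j" for j
      using visit_mass_upto_approx[of k T j] z by (auto simp: abs_mult intro!: mult_right_mono)
  qed (intro summable_mult geo)
  hence "\<bar>return_gf k T z - \<rho>\<bar> \<le> (\<Sum>j. (real k + 1) * tail k T * z ^ j)"
    by (simp only: sums_unique[OF s3, symmetric] real_norm_def)
  also have "\<dots> = (real k + 1) * tail k T * (1 / (1 - z))"
    using geo z by (subst suminf_mult) (auto simp: suminf_geometric)
  finally have d: "\<bar>return_gf k T z - \<rho>\<bar> \<le> (real k + 1) * tail k T / (1 - z)" by simp
  \<comment> \<open>Summation by parts: multiplying the series of \<open>visit_mass\<close> by
    \<open>1 - z\<close> produces its differences, which are q times the cluster size probabilities,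
    and the boundary term \<open>visit_mass k 0 = q\<close>.\<close>
  have "cluster_rate k z = (1 - z) * \<rho>"
  proof -
    have "(\<lambda>j. visit_mass k (Suc j) * z ^ Suc j) sums (\<rho> - visit_mass k 0)"
      using s2 sums_Suc_iff[of "\<lambda>j. visit_mass k j * z ^ j" "\<rho> - visit_mass k 0"] by simp
    moreover have "(\<lambda>j. z * (visit_mass k j * z ^ j)) sums (z * \<rho>)" by (intro sums_mult s2)
    ultimately have "(\<lambda>j. (z * (visit_mass k j * z ^ j) - visit_mass k (Suc j) * z ^ Suc j) / q) sums ((z * \<rho> - (\<rho> - visit_mass k 0)) / q)"
      by (intro sums_divide sums_diff)
    hence "(\<Sum>j. cluster_size_distr M X k (Suc j) * z ^ Suc j) = (z * \<rho> - (\<rho> - q)) / q"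
      by (simp add: cluster_size_distr_eq q_def[symmetric] visit_mass_0 sums_iff algebra_simps)
    thus ?thesis using q by (simp add: cluster_rate_def q_def[symmetric] field_simps)
  qed
  hence "\<bar>(1 - z) * return_gf k T z - cluster_rate k z\<bar> = (1 - z) * \<bar>return_gf k T z - \<rho>\<bar>"
    using z by (simp add: abs_mult flip: right_diff_distrib)
  also have "\<dots> \<le> (1 - z) * ((real k + 1) * tail k T / (1 - z))" using z d by (intro mult_left_mono) auto
  finally show ?thesis using z by simp
qed

end

section \<open>Law of large numbers for clusters\<close>

lemma grid_index_frac: "n > 0 \<Longrightarrow> grid_index L (real i / real n) = L * i div n"
proof -
  assume "n > 0"
  have "real L * (real i / real n) = real (L * i) / real n" by simp
  thus ?thesis unfolding grid_index_def by (simp only: floor_divide_of_nat_eq nat_int)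
qed

lemma card_grid_fibre:
  assumes "n > 0" "L > 0"
  shows "\<bar>real (card {i. L * i div n = l}) - real n / real L\<bar> \<le> 1" "finite {i. L * i div n = l}"
proof -
  \<comment> \<open>\<open>N m\<close> is the number of \<open>i\<close> with
    \<open>L * i < m * n\<close>, so the fibre over \<open>l\<close> is the interval from
    \<open>N l\<close> to \<open>N (Suc l)\<close>; rounding both ends up costs at most 1.\<close>
  define N where "N m = nat \<lceil>real (m * n) / real L\<rceil>" for m
  have N: "i < N m \<longleftrightarrow> L * i < m * n" for i m
  proof -
    have "i < N m \<longleftrightarrow> real i < real (m * n) / real L"
      unfolding N_def by (metis less_ceiling_iff of_int_of_nat_eq zless_nat_eq_int_zless)
    also have "\<dots> \<longleftrightarrow> real (L * i) < real (m * n)" using assms by (simp add: pos_less_divide_eq mult.commute)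
    finally show ?thesis by (simp only: of_nat_less_iff)
  qed
  have set: "{i. L * i div n = l} = {N l..<N (Suc l)}"
  proof (intro set_eqI)
    fix i
    have "L * i div n = l \<longleftrightarrow> l * n \<le> L * i \<and> L * i < Suc l * n"
    proof -
      have "L * i div n = l \<longleftrightarrow> l \<le> L * i div n \<and> L * i div n < Suc l" by auto
      thus ?thesis using assms by (simp only: less_eq_div_iff_mult_less_eq div_less_iff_less_mult)
    qed
    thus "i \<in> {i. L * i div n = l} \<longleftrightarrow> i \<in> {N l..<N (Suc l)}"
      using N[of i l] N[of i "Suc l"] by (auto simp: not_less)
  qed
  thus "finite {i. L * i div n = l}" by simp
  have Nb: "real (m * n) / real L \<le> real (N m)" "real (N m) < real (m * n) / real L + 1" for m
  proof -
    have "0 \<le> real (m * n) / real L" by simp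
    hence "0 \<le> \<lceil>real (m * n) / real L\<rceil>" by linarith
    hence "real (N m) = real_of_int \<lceil>real (m * n) / real L\<rceil>" by (simp add: N_def)
    thus "real (m * n) / real L \<le> real (N m)" "real (N m) < real (m * n) / real L + 1" by linarith+
  qed
  have step: "real (Suc l * n) / real L = real (l * n) / real L + real n / real L"
    by (simp add: add_divide_distrib)
  have "N l \<le> N (Suc l)"
    unfolding N_def by (intro nat_mono ceiling_mono divide_right_mono) auto
  hence "real (card {i. L * i div n = l}) = real (N (Suc l)) - real (N l)" by (simp add: set)
  thus "\<bar>real (card {i. L * i div n = l}) - real n / real L\<bar> \<le> 1"
    using Nb[of l] Nb[of "Suc l"] step by linarith
qed

text \<open>A Riemann sum: each of the \<open>L\<close> cells has a count off by at most 1, and the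
  endpoint \<open>i = n\<close> falls into the extra cell \<open>L\<close>. This makes
  \<open>L + 1\<close> errors of size at most \<open>B\<close>.\<close>

lemma grid_sum_bound:
  fixes H :: "nat \<Rightarrow> real"
  assumes "n > 0" "L > 0" and B: "\<And>l. \<bar>H l\<bar> \<le> B"
  shows "\<bar>(\<Sum>i\<le>n. H (L * i div n)) - real n * ((\<Sum>l<L. H l) / real L)\<bar> \<le> B * (real L + 1)"
proof -
  have "(\<Sum>i<n. H (L * i div n)) = (\<Sum>l<L. \<Sum>i\<in>{i\<in>{..<n}. L * i div n = l}. H (L * i div n))"
  proof (rule sum.group[symmetric])
    show "(\<lambda>i. L * i div n) ` {..<n} \<subseteq> {..<L}"
    proof (intro image_subsetI)
      fix i assume "i \<in> {..<n}"
      hence "L * i < L * n" using assms by simp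
      thus "L * i div n \<in> {..<L}" by (simp add: less_mult_imp_div_less)
    qed
  qed auto
  also have "\<dots> = (\<Sum>l<L. H l * real (card {i. L * i div n = l}))"
  proof (intro sum.cong refl)
    fix l assume l: "l \<in> {..<L}"
    have "{i\<in>{..<n}. L * i div n = l} = {i. L * i div n = l}"
    proof (intro equalityI subsetI)
      fix i assume i: "i \<in> {i. L * i div n = l}"
      have "i < n"
      proof (rule ccontr)
        assume "\<not> i < n"
        hence "L * n div n \<le> L * i div n" by (intro div_le_mono mult_le_mono2) auto
        thus False using i l assms by simp
      qed
      thus "i \<in> {i\<in>{..<n}. L * i div n = l}" using i by simp
    qed auto
    thus "(\<Sum>i\<in>{i\<in>{..<n}. L * i div n = l}. H (L * i div n)) = H l * real (card {i. L * i div n = l})" by simp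
  qed
  finally have 1: "(\<Sum>i<n. H (L * i div n)) = (\<Sum>l<L. H l * real (card {i. L * i div n = l}))" .
  have 2: "(\<Sum>i\<le>n. H (L * i div n)) = (\<Sum>i<n. H (L * i div n)) + H L"
    using assms by (simp add: lessThan_Suc_atMost[symmetric])
  have 3: "real n * ((\<Sum>l<L. H l) / real L) = (\<Sum>l<L. H l * (real n / real L))"
    by (simp add: sum_distrib_left sum_divide_distrib mult_ac)
  have "(\<Sum>i\<le>n. H (L * i div n)) - real n * ((\<Sum>l<L. H l) / real L) =
      (\<Sum>l<L. H l * (real (card {i. L * i div n = l}) - real n / real L)) + H L"
    unfolding 1 2 3 by (simp add: sum_subtractf right_diff_distrib)
  also have "\<bar>\<dots>\<bar> \<le> (\<Sum>l<L. \<bar>H l * (real (card {i. L * i div n = l}) - real n / real L)\<bar>) + \<bar>H L\<bar>"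
    using sum_abs[of "\<lambda>l. H l * (real (card {i. L * i div n = l}) - real n / real L)" "{..<L}"] by linarith
  also have "\<dots> \<le> (\<Sum>l<L. B * 1) + B"
  proof (intro add_mono sum_mono B)
    fix l
    show "\<bar>H l * (real (card {i. L * i div n = l}) - real n / real L)\<bar> \<le> B * 1"
      unfolding abs_mult using B[of l] card_grid_fibre(1)[OF assms(1,2), of l] by (intro mult_mono) auto
  qed
  finally show ?thesis by (simp add: algebra_simps)
qed

text \<open>Each unit shift telescopes to a difference of two values, at most the last one by
  nonnegativity; monotonicity bounds all \<open>d\<close> of these by the largest.\<close>

lemma sum_shift_mono_bound:
  fixes a :: "nat \<Rightarrow> real"
  assumes "mono a" "\<And>i. 0 \<le> a i"
  shows "(\<Sum>i\<le>n. a (i + d) - a i) \<le> real d * a (n + d)"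
proof (induction d)
  case (Suc d)
  have "(\<Sum>i\<le>n. a (i + Suc d) - a i) = (\<Sum>i\<le>n. a (Suc i + d) - a (i + d)) + (\<Sum>i\<le>n. a (i + d) - a i)"
    by (simp add: sum.distrib[symmetric])
  also have "(\<Sum>i\<le>n. a (Suc i + d) - a (i + d)) = a (Suc n + d) - a (0 + d)"
    by (induction n) auto
  also have "\<dots> + (\<Sum>i\<le>n. a (i + d) - a i) \<le> a (n + Suc d) + real d * a (n + d)"
    using Suc assms(2)[of d] by simp
  also have "\<dots> \<le> a (n + Suc d) + real d * a (n + Suc d)"
    using monoD[OF assms(1), of "n + d" "n + Suc d"] by (intro add_left_mono mult_left_mono) auto
  finally show ?case by (simp add: algebra_simps)
qed simp

text \<open>The weight can change only when the cell index does, and then by at most 1, so the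
  increments of the index dominate. The bound is free of \<open>n\<close>: freezing weights over a
  fixed horizon costs nothing after division by \<open>n\<close>.\<close>

lemma sum_shift_step_bound:
  fixes W :: "nat \<Rightarrow> real"
  assumes "n > 0" and W: "\<And>l. 0 \<le> W l \<and> W l \<le> 1"
  shows "(\<Sum>i\<le>n. \<bar>W (L * (i + d) div n) - W (L * i div n)\<bar>) \<le> real d * (real L * (1 + real d))"
proof -
  define a where "a i = real (L * i div n)" for i
  have mono: "mono a" unfolding a_def by (intro monoI of_nat_mono div_le_mono mult_le_mono2)
  have "\<bar>W (L * (i + d) div n) - W (L * i div n)\<bar> \<le> a (i + d) - a i" for i
  proof (cases "L * (i + d) div n = L * i div n")
    case False
    moreover have "L * i div n \<le> L * (i + d) div n" by (intro div_le_mono mult_le_mono2) auto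
    ultimately have "L * i div n + 1 \<le> L * (i + d) div n" by linarith
    hence "1 \<le> a (i + d) - a i" unfolding a_def by linarith
    moreover have "\<bar>W (L * (i + d) div n) - W (L * i div n)\<bar> \<le> 1"
      using W[of "L * (i + d) div n"] W[of "L * i div n"] by auto
    ultimately show ?thesis by linarith
  qed (simp add: a_def)
  hence "(\<Sum>i\<le>n. \<bar>W (L * (i + d) div n) - W (L * i div n)\<bar>) \<le> (\<Sum>i\<le>n. a (i + d) - a i)" by (intro sum_mono)
  also have "\<dots> \<le> real d * a (n + d)" by (rule sum_shift_mono_bound[OF mono]) (simp add: a_def)
  also have "\<dots> \<le> real d * (real L * (1 + real d))"
  proof (intro mult_left_mono)
    have "a (n + d) \<le> real (L * (n + d)) / real n" 
    proof -
      have "real (L * (n + d) div n * n) \<le> real (L * (n + d))" by (intro of_nat_mono div_times_less_eq_dividend)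
      thus ?thesis using assms by (simp add: a_def pos_le_divide_eq)
    qed
    also have "\<dots> = real L * (1 + real d / real n)" using assms by (simp add: field_simps)
    also have "real d / real n \<le> real d / 1" using assms by (intro divide_left_mono) auto
    finally show "a (n + d) \<le> real L * (1 + real d)" by (simp add: mult_left_mono)
  qed auto
  finally show ?thesis .
qed

lemma (in prob_space) expectation_abs_le_sqrt:
  fixes Y :: "'a \<Rightarrow> real"
  assumes "integrable M Y" "integrable M (\<lambda>\<omega>. (Y \<omega>)\<^sup>2)" "expectation (\<lambda>\<omega>. (Y \<omega>)\<^sup>2) \<le> B"
  shows "expectation (\<lambda>\<omega>. \<bar>Y \<omega>\<bar>) \<le> sqrt B"
proof -
  define m where "m = expectation (\<lambda>\<omega>. \<bar>Y \<omega>\<bar>)"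
  have "0 \<le> expectation (\<lambda>\<omega>. (\<bar>Y \<omega>\<bar> - m)\<^sup>2)" by (rule Bochner_Integration.integral_nonneg) auto
  also have "\<dots> = expectation (\<lambda>\<omega>. (Y \<omega>)\<^sup>2 - 2 * m * \<bar>Y \<omega>\<bar> + m\<^sup>2)"
    by (intro Bochner_Integration.integral_cong) (auto simp: power2_diff)
  also have "\<dots> = expectation (\<lambda>\<omega>. (Y \<omega>)\<^sup>2) - 2 * m * m + m\<^sup>2"
    using assms by (simp add: prob_space m_def)
  finally have "m\<^sup>2 \<le> B" using assms(3) by (simp add: power2_eq_square)
  thus ?thesis unfolding m_def by (rule real_le_rsqrt)
qed

section \<open>Replacing the cluster sum by a sum of local functions\<close>

context biased_walk
begin

definition forward_prod :: "nat \<Rightarrow> nat \<Rightarrow> (nat \<Rightarrow> real) \<Rightarrow> nat \<Rightarrow> 'a \<Rightarrow> real" where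
  "forward_prod k n w i \<omega> = (\<Sum>a\<le>k. \<Prod>d\<in>{0<..n - i}. if psum (steps i \<omega>) d \<in> window k a then w (i + d) else 1)"

text \<open>Stated through the steps after each time, which makes sense and is measurable for every
  outcome. It is the sum over windows of \<open>cluster_sum_eq\<close> on nearest-neighbour paths,
  hence almost surely.\<close>

definition cluster_sum :: "nat \<Rightarrow> nat \<Rightarrow> (nat \<Rightarrow> real) \<Rightarrow> 'a \<Rightarrow> real" where
  "cluster_sum k n w \<omega> = (\<Sum>i\<le>n. (1 - w i) * forward_prod k n w i \<omega>)"

text \<open>The tractable substitute for \<open>forward_prod\<close>: horizon cut at
  \<open>T\<close> and weight frozen at its value \<open>z\<close> at time \<open>i\<close>. It
  depends on the next \<open>T\<close> steps only.\<close>

definition local_gf :: "nat \<Rightarrow> nat \<Rightarrow> real \<Rightarrow> nat \<Rightarrow> 'a \<Rightarrow> real" where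
  "local_gf k T z i \<omega> = (\<Sum>a\<le>k. z ^ returns k a T (steps i \<omega>))"

lemma measurable_psum_steps [measurable]: "Measurable.pred M (\<lambda>\<omega>. psum (steps i \<omega>) d \<in> A)"
  by (rule measurable_compose[OF measurable_steps measurable_psum_mem])

lemma measurable_forward_prod [measurable]: "forward_prod k n w i \<in> borel_measurable M"
  unfolding forward_prod_def[abs_def] by measurable

lemma measurable_cluster_sum [measurable]: "cluster_sum k n w \<in> borel_measurable M"
  unfolding cluster_sum_def[abs_def] by measurable

lemma measurable_local_gf [measurable]: "local_gf k T z i \<in> borel_measurable M"
  unfolding local_gf_def[abs_def] by measurable

lemma cluster_sum_eq:
  assumes "nn_path (\<lambda>i. walk X i \<omega>) n"
  shows "cluster_sum k n w \<omega> = (\<Sum>s\<in>site_range k n. 1 - (\<Prod>i\<in>hits k n (\<lambda>i. walk X i \<omega>) s. w i))"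
  unfolding cluster_telescope[OF assms] cluster_sum_def forward_prod_def
proof (intro sum.cong refl arg_cong2[where f = "(*)"])
  fix i a assume i: "i \<in> {..n}"
  have "(\<Prod>i'\<in>{i'\<in>{i<..n}. walk X i' \<omega> - walk X i \<omega> \<in> window k a}. w i') =
      (\<Prod>i'\<in>{i<..n}. if walk X i' \<omega> - walk X i \<omega> \<in> window k a then w i' else 1)"
    by (rule prod.inter_filter) simp
  also have "\<dots> = (\<Prod>d\<in>{0<..n - i}. if psum (steps i \<omega>) d \<in> window k a then w (i + d) else 1)"
  proof -
    have img: "{i<..n} = (\<lambda>d. i + d) ` {0<..n - i}"
      using i by (auto simp: image_iff intro!: bexI[of _ "_ - i"])
    show ?thesis unfolding img by (subst prod.reindex) (auto simp: walk_add)
  qed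
  finally show "(\<Prod>d\<in>{0<..n - i}. if psum (steps i \<omega>) d \<in> window k a then w (i + d) else 1) =
      (\<Prod>i'\<in>{i'\<in>{i<..n}. walk X i' \<omega> - walk X i \<omega> \<in> window k a}. w i')" by simp
qed

lemma forward_prod_bounds:
  assumes "\<And>i. 0 \<le> w i \<and> w i \<le> 1"
  shows "0 \<le> forward_prod k n w i \<omega>" "forward_prod k n w i \<omega> \<le> real k + 1"
proof -
  show "0 \<le> forward_prod k n w i \<omega>" unfolding forward_prod_def using assms by (intro sum_nonneg prod_nonneg) auto
  have "forward_prod k n w i \<omega> \<le> (\<Sum>a\<le>k. 1)" unfolding forward_prod_def
    using assms by (intro sum_mono prod_le_1) auto
  thus "forward_prod k n w i \<omega> \<le> real k + 1" by simp
qed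

lemma local_gf_bounds:
  assumes "0 \<le> z" "z \<le> 1"
  shows "0 \<le> local_gf k T z i \<omega>" "local_gf k T z i \<omega> \<le> real k + 1"
proof -
  show "0 \<le> local_gf k T z i \<omega>" unfolding local_gf_def using assms by (intro sum_nonneg) auto
  have "local_gf k T z i \<omega> \<le> (\<Sum>a\<le>k. 1)" unfolding local_gf_def
    using assms by (intro sum_mono power_le_one) auto
  thus "local_gf k T z i \<omega> \<le> real k + 1" by simp
qed

lemma integrable_local_gf: "0 \<le> z \<Longrightarrow> z \<le> 1 \<Longrightarrow> integrable M (local_gf k T z i)"
  by (rule integrable_const_bound[where B = "real k + 1"]) (use local_gf_bounds in auto)

lemma expectation_local_gf:
  assumes "0 \<le> z" "z \<le> 1"
  shows "expectation (local_gf k T z i) = return_gf k T z"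
proof -
  have int: "integrable M (\<lambda>\<omega>. z ^ returns k a T (steps i \<omega>))" for a
    by (rule integrable_const_bound[where B = 1]) (use assms in \<open>auto simp: power_le_one\<close>)
  have m: "(\<lambda>x. z ^ returns k a T x) \<in> borel_measurable int_seqs" for a
    by (rule measurable_compose[OF measurable_returns]) simp
  show ?thesis unfolding local_gf_def[abs_def] return_gf_def
    using int by (subst Bochner_Integration.integral_sum) (auto intro!: sum.cong expectation_steps[OF m])
qed

text \<open>The bracket collects the ways the substitution can fail: the weights vary within the
  horizon, the walk comes back after it, or fewer than \<open>T\<close> steps remain. In the last
  two cases the trivial bound 1 for numbers in [0,1] is used; otherwise both products run over the
  same lags.\<close>

lemma local_approx:
  assumes w: "\<And>i. 0 \<le> w i \<and> w i \<le> 1"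
  shows "\<bar>forward_prod k n w i \<omega> - local_gf k T (w i) i \<omega>\<bar> \<le> (real k + 1) *
    ((\<Sum>d\<in>{0<..T}. \<bar>w (i + d) - w i\<bar>) + of_bool (\<exists>d\<in>{T<..n}. \<bar>psum (steps i \<omega>) d\<bar> \<le> int k) + of_bool (n < i + T))"
    (is "_ \<le> _ * ?E")
proof -
  have "\<bar>(\<Prod>d\<in>{0<..n - i}. if psum (steps i \<omega>) d \<in> window k a then w (i + d) else 1) - w i ^ returns k a T (steps i \<omega>)\<bar> \<le> ?E"
    if a: "a \<le> k" for a
  proof -
    let ?A = "(\<Prod>d\<in>{0<..n - i}. if psum (steps i \<omega>) d \<in> window k a then w (i + d) else 1)"
    have A01: "0 \<le> ?A" "?A \<le> 1" using w by (auto intro!: prod_nonneg prod_le_1)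
    have B01: "0 \<le> w i ^ returns k a T (steps i \<omega>)" "w i ^ returns k a T (steps i \<omega>) \<le> 1"
      using w[of i] by (auto intro: power_le_one)
    have nn: "0 \<le> (\<Sum>d\<in>{0<..T}. \<bar>w (i + d) - w i\<bar>)" by (intro sum_nonneg) auto
    show ?thesis
    proof (cases "(\<exists>d\<in>{T<..n}. \<bar>psum (steps i \<omega>) d\<bar> \<le> int k) \<or> n < i + T")
      case True
      hence "1 \<le> ?E" using nn by (auto simp: of_bool_def)
      thus ?thesis using A01 B01 by linarith
    next
      case False
      define D where "D = {d\<in>{0<..T}. psum (steps i \<omega>) d \<in> window k a}"
      have "{d\<in>{0<..n - i}. psum (steps i \<omega>) d \<in> window k a} = D"
      proof (intro equalityI subsetI)
        fix d assume d: "d \<in> {d\<in>{0<..n - i}. psum (steps i \<omega>) d \<in> window k a}"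
        hence "\<bar>psum (steps i \<omega>) d\<bar> \<le> int k" using window_abs[OF a] by simp
        hence "d \<notin> {T<..n}" using False by blast
        thus "d \<in> D" using d by (auto simp: D_def)
      qed (use False in \<open>auto simp: D_def\<close>)
      moreover have "?A = (\<Prod>d\<in>{d\<in>{0<..n - i}. psum (steps i \<omega>) d \<in> window k a}. w (i + d))"
        by (rule prod.inter_filter[symmetric]) simp
      ultimately have A: "?A = (\<Prod>d\<in>D. w (i + d))" by simp
      have B: "w i ^ returns k a T (steps i \<omega>) = (\<Prod>d\<in>D. w i)" by (simp add: returns_def D_def)
      have "\<bar>?A - w i ^ returns k a T (steps i \<omega>)\<bar> \<le> (\<Sum>d\<in>D. \<bar>w (i + d) - w i\<bar>)"
        unfolding A B using w by (intro abs_prod_diff_le) auto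
      also have "\<dots> \<le> (\<Sum>d\<in>{0<..T}. \<bar>w (i + d) - w i\<bar>)" by (intro sum_mono2) (auto simp: D_def)
      finally show ?thesis by (simp add: of_bool_def)
    qed
  qed
  hence "(\<Sum>a\<le>k. \<bar>(\<Prod>d\<in>{0<..n - i}. if psum (steps i \<omega>) d \<in> window k a then w (i + d) else 1) - w i ^ returns k a T (steps i \<omega>)\<bar>) \<le> (\<Sum>a\<le>k. ?E)"
    by (intro sum_mono) auto
  moreover have "\<bar>forward_prod k n w i \<omega> - local_gf k T (w i) i \<omega>\<bar> \<le>
      (\<Sum>a\<le>k. \<bar>(\<Prod>d\<in>{0<..n - i}. if psum (steps i \<omega>) d \<in> window k a then w (i + d) else 1) - w i ^ returns k a T (steps i \<omega>)\<bar>)"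
    unfolding forward_prod_def local_gf_def sum_subtractf[symmetric] by (rule sum_abs)
  ultimately show ?thesis by (simp add: algebra_simps)
qed

end

lemma psum_cong: "(\<And>l. l < T \<Longrightarrow> x l = y l) \<Longrightarrow> d \<le> T \<Longrightarrow> psum x d = psum y d"
  by (auto simp: psum_def intro!: sum.cong)

lemma returns_cong: "(\<And>l. l < T \<Longrightarrow> x l = y l) \<Longrightarrow> returns k a T x = returns k a T y"
proof -
  assume e: "\<And>l. l < T \<Longrightarrow> x l = y l"
  have "psum x d = psum y d" if "d \<in> {0<..T}" for d using that by (intro psum_cong[OF e]) auto
  hence "{d\<in>{0<..T}. psum x d \<in> window k a} = {d\<in>{0<..T}. psum y d \<in> window k a}" by auto
  thus ?thesis by (simp only: returns_def)
qed

context biased_walk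
begin

lemma return_gf_bounds:
  assumes "0 \<le> z" "z \<le> 1"
  shows "0 \<le> return_gf k T z" "return_gf k T z \<le> real k + 1"
proof -
  have "0 \<le> expectation (local_gf k T z 0)"
    by (rule Bochner_Integration.integral_nonneg) (use local_gf_bounds assms in auto)
  thus "0 \<le> return_gf k T z" by (simp add: expectation_local_gf[OF assms])
  have "\<bar>expectation (local_gf k T z 0)\<bar> \<le> real k + 1"
    by (rule abs_expectation_le) (use local_gf_bounds[OF assms] in auto)
  thus "return_gf k T z \<le> real k + 1" by (simp add: expectation_local_gf[OF assms])
qed

text \<open>Summands at distance at least T are independent, so the variance of the sum is linear in n.\<close>

lemma local_gf_concentration:
  assumes w: "\<And>i. 0 \<le> w i \<and> w i \<le> 1"
  shows "expectation (\<lambda>\<omega>. \<bar>\<Sum>i\<le>n. (1 - w i) * (local_gf k T (w i) i \<omega> - return_gf k T (w i))\<bar>)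
    \<le> sqrt ((real n + 1) * (2 * real T * (real k + 1)\<^sup>2))"
proof -
  define F where "F i x = (1 - w i) * ((\<Sum>a\<le>k. w i ^ returns k a T x) - return_gf k T (w i))" for i x
  have Z: "(1 - w i) * (local_gf k T (w i) i \<omega> - return_gf k T (w i)) = F i (steps i \<omega>)" for i \<omega>
    by (simp add: F_def local_gf_def)
  have [measurable]: "(\<lambda>x. w i ^ returns k a T x) \<in> borel_measurable int_seqs" for i a
    by (rule measurable_compose[OF measurable_returns]) simp
  have Fm: "F i \<in> borel_measurable int_seqs" for i unfolding F_def[abs_def] by measurable
  have Fs[measurable]: "(\<lambda>\<omega>. F i (steps i \<omega>)) \<in> borel_measurable M" for i
    by (rule measurable_compose[OF measurable_steps Fm])
  have Fc: "F i x = F i y" if "\<And>l. l < T \<Longrightarrow> x l = y l" for i x y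
    unfolding F_def using returns_cong[of T x y, OF that] by simp
  have Fb: "\<bar>F i x\<bar> \<le> real k + 1" for i x
  proof -
    have "0 \<le> (\<Sum>a\<le>k. w i ^ returns k a T x)" using w by (intro sum_nonneg) auto
    moreover have "(\<Sum>a\<le>k. w i ^ returns k a T x) \<le> (\<Sum>a\<le>k. 1)" using w by (intro sum_mono power_le_one) auto
    ultimately have "\<bar>(\<Sum>a\<le>k. w i ^ returns k a T x) - return_gf k T (w i)\<bar> \<le> real k + 1"
      using return_gf_bounds[of "w i" k T] w[of i] by auto
    hence "\<bar>1 - w i\<bar> * \<bar>(\<Sum>a\<le>k. w i ^ returns k a T x) - return_gf k T (w i)\<bar> \<le> 1 * (real k + 1)"
      using w[of i] by (intro mult_mono) auto
    thus ?thesis by (simp add: F_def abs_mult)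
  qed
  have F0: "expectation (\<lambda>\<omega>. F i (steps i \<omega>)) = 0" for i
    unfolding Z[symmetric] using w[of i] integrable_local_gf[of "w i" k T i] expectation_local_gf[of "w i" k T i]
    by (simp add: prob_space)
  have int: "integrable M (\<lambda>\<omega>. F i (steps i \<omega>))" for i
    by (rule integrable_const_bound[where B = "real k + 1"]) (use Fb in auto)
  have FFb: "\<bar>F i (steps i \<omega>) * F j (steps j \<omega>)\<bar> \<le> (real k + 1)\<^sup>2" for i j \<omega>
    unfolding abs_mult power2_eq_square using Fb by (intro mult_mono) auto
  have int2: "integrable M (\<lambda>\<omega>. F i (steps i \<omega>) * F j (steps j \<omega>))" for i j
    by (rule integrable_const_bound[where B = "(real k + 1)\<^sup>2"]) (use FFb in auto)
  \<comment> \<open>Pairs closer than \<open>T\<close> get the trivial bound. For each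
    \<open>i\<close> there are at most \<open>2 * T\<close> of them, the source of that factor in
    the variance.\<close>
  have cov: "expectation (\<lambda>\<omega>. F i (steps i \<omega>) * F j (steps j \<omega>)) \<le> (real k + 1)\<^sup>2 * of_bool (j \<in> {i - T..<i + T})" for i j
  proof (cases "i + T \<le> j \<or> j + T \<le> i")
    case True
    have "expectation (\<lambda>\<omega>. F i (steps i \<omega>) * F j (steps j \<omega>)) = 0"
    proof -
      have *: "expectation (\<lambda>\<omega>. F i (steps i \<omega>) * F j (steps j \<omega>)) = 0" if "i + T \<le> j" for i j
        using indep_steps_product[OF Fm Fm Fc Fc Fb Fb that] by (simp add: F0)
      show ?thesis using True *[of i j] *[of j i] by (auto simp: mult.commute)
    qed
    thus ?thesis by simp
  next
    case False
    have "\<bar>expectation (\<lambda>\<omega>. F i (steps i \<omega>) * F j (steps j \<omega>))\<bar> \<le> (real k + 1)\<^sup>2"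
      by (rule abs_expectation_le) (use FFb in auto)
    thus ?thesis using False by (auto simp: of_bool_def)
  qed
  have sq: "(\<Sum>i\<le>n. F i (steps i \<omega>))\<^sup>2 = (\<Sum>i\<le>n. \<Sum>j\<le>n. F i (steps i \<omega>) * F j (steps j \<omega>))" for \<omega>
    by (simp add: power2_eq_square sum_product)
  have "expectation (\<lambda>\<omega>. (\<Sum>i\<le>n. F i (steps i \<omega>))\<^sup>2) = (\<Sum>i\<le>n. \<Sum>j\<le>n. expectation (\<lambda>\<omega>. F i (steps i \<omega>) * F j (steps j \<omega>)))"
    unfolding sq using int2 by (simp add: Bochner_Integration.integral_sum)
  also have "\<dots> \<le> (\<Sum>i\<le>n. \<Sum>j\<le>n. (real k + 1)\<^sup>2 * of_bool (j \<in> {i - T..<i + T}))"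
    by (intro sum_mono cov)
  also have "\<dots> \<le> (\<Sum>i\<le>n. 2 * real T * (real k + 1)\<^sup>2)"
  proof (rule sum_mono)
    fix i
    have "(\<Sum>j\<le>n. of_bool (j \<in> {i - T..<i + T}) :: real) = real (card ({..n} \<inter> {i - T..<i + T}))"
      by (simp add: of_bool_def sum.If_cases Int_def)
    also have "card ({..n} \<inter> {i - T..<i + T}) \<le> card {i - T..<i + T}" by (intro card_mono) auto
    also have "card {i - T..<i + T} \<le> 2 * T" by simp
    finally have "(real k + 1)\<^sup>2 * (\<Sum>j\<le>n. of_bool (j \<in> {i - T..<i + T})) \<le> (real k + 1)\<^sup>2 * (2 * real T)"
      by (intro mult_left_mono) auto
    thus "(\<Sum>j\<le>n. (real k + 1)\<^sup>2 * of_bool (j \<in> {i - T..<i + T})) \<le> 2 * real T * (real k + 1)\<^sup>2"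
      by (simp only: sum_distrib_left mult.commute mult.left_commute)
  qed
  also have "\<dots> = (real n + 1) * (2 * real T * (real k + 1)\<^sup>2)" by (simp add: algebra_simps)
  finally have v: "expectation (\<lambda>\<omega>. (\<Sum>i\<le>n. F i (steps i \<omega>))\<^sup>2) \<le> (real n + 1) * (2 * real T * (real k + 1)\<^sup>2)" .
  show ?thesis unfolding Z
  proof (rule expectation_abs_le_sqrt[OF _ _ v])
    show "integrable M (\<lambda>\<omega>. \<Sum>i\<le>n. F i (steps i \<omega>))" by (intro Bochner_Integration.integrable_sum int)
    show "integrable M (\<lambda>\<omega>. (\<Sum>i\<le>n. F i (steps i \<omega>))\<^sup>2)"
      unfolding sq by (intro Bochner_Integration.integrable_sum int2)
  qed
qed

lemma integrable_forward_prod: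
  assumes "\<And>i. 0 \<le> w i \<and> w i \<le> 1"
  shows "integrable M (forward_prod k n w i)"
  by (rule integrable_const_bound[where B = "real k + 1"]) (use forward_prod_bounds[OF assms] in auto)

lemma integrable_cluster_sum:
  assumes "\<And>i. 0 \<le> w i \<and> w i \<le> 1"
  shows "integrable M (cluster_sum k n w)"
  unfolding cluster_sum_def[abs_def]
  by (intro Bochner_Integration.integrable_sum integrable_mult_right integrable_forward_prod assms)

text \<open>Three contributions: \<open>A\<close> from replacing the forward products by local
  functions, \<open>B\<close> from the fluctuation of the local sum, and \<open>C\<close> from the
  bias of its mean. Late returns in \<open>A\<close> cost another \<open>C\<close>, hence the factor
  2 on \<open>tail\<close>.\<close>

lemma cluster_sum_bound:
  fixes W :: "nat \<Rightarrow> real"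
  assumes n: "n > 0" and L: "L > 0" and W: "\<And>l. 0 \<le> W l \<and> W l < 1"
  defines "w \<equiv> \<lambda>i. W (L * i div n)"
  shows "expectation (\<lambda>\<omega>. \<bar>cluster_sum k n w \<omega> - (\<Sum>i\<le>n. cluster_rate k (w i))\<bar>) \<le>
    (real k + 1) * (real T * (real T * (real L * (1 + real T))) + real T) + (real n + 1) * (2 * ((real k + 1) * tail k T))
    + sqrt ((real n + 1) * (2 * real T * (real k + 1)\<^sup>2))"
proof -
  have w: "0 \<le> w i \<and> w i \<le> 1" for i using W by (auto simp: w_def less_imp_le)
  have w': "0 \<le> w i" "w i < 1" for i using W by (auto simp: w_def)
  define late where "late i \<omega> = (of_bool (\<exists>d\<in>{T<..n}. \<bar>psum (steps i \<omega>) d\<bar> \<le> int k) :: real)" for i \<omega>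
  have [measurable]: "Measurable.pred M (\<lambda>\<omega>. \<bar>psum (steps i \<omega>) d\<bar> \<le> int k)" for i d
    by (rule measurable_compose[OF measurable_compose[OF measurable_steps measurable_psum]]) simp
  have late_int: "integrable M (late i)" for i
  proof (rule integrable_const_bound[where B = 1])
    show "late i \<in> borel_measurable M" unfolding late_def[abs_def] by measurable
  qed (simp add: late_def)
  have late_exp: "expectation (late i) \<le> tail k T" for i
  proof -
    have "expectation (late i) = prob {\<omega> \<in> space M. \<exists>d\<in>{T<..n}. \<bar>psum (steps i \<omega>) d\<bar> \<le> int k}"
      unfolding late_def by (rule expectation_of_bool) measurable
    thus ?thesis using prob_late_return[of T n i k] by simp
  qed
  define V where "V i = (\<Sum>d\<in>{0<..T}. \<bar>w (i + d) - w i\<bar>)" for i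
  define A where "A \<omega> = (\<Sum>i\<le>n. (real k + 1) * (V i + late i \<omega> + of_bool (n < i + T)))" for \<omega>
  define B where "B \<omega> = \<bar>\<Sum>i\<le>n. (1 - w i) * (local_gf k T (w i) i \<omega> - return_gf k T (w i))\<bar>" for \<omega>
  define C where "C = (real n + 1) * ((real k + 1) * tail k T)"
  have A_int: "integrable M A" unfolding A_def[abs_def]
    by (intro Bochner_Integration.integrable_sum integrable_mult_right Bochner_Integration.integrable_add late_int) auto
  have B_int: "integrable M B" unfolding B_def[abs_def]
    by (intro integrable_abs Bochner_Integration.integrable_sum integrable_mult_right Bochner_Integration.integrable_diff
        integrable_local_gf) (use w in auto)
  have point: "\<bar>cluster_sum k n w \<omega> - (\<Sum>i\<le>n. cluster_rate k (w i))\<bar> \<le> A \<omega> + B \<omega> + C" for \<omega>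
  proof -
    have "cluster_sum k n w \<omega> - (\<Sum>i\<le>n. cluster_rate k (w i)) =
        (\<Sum>i\<le>n. (1 - w i) * (forward_prod k n w i \<omega> - local_gf k T (w i) i \<omega>))
        + (\<Sum>i\<le>n. (1 - w i) * (local_gf k T (w i) i \<omega> - return_gf k T (w i)))
        + (\<Sum>i\<le>n. (1 - w i) * return_gf k T (w i) - cluster_rate k (w i))"
      unfolding cluster_sum_def by (simp add: right_diff_distrib sum_subtractf)
    moreover have "\<bar>\<Sum>i\<le>n. (1 - w i) * (forward_prod k n w i \<omega> - local_gf k T (w i) i \<omega>)\<bar> \<le> A \<omega>"
      unfolding A_def
    proof (rule order_trans[OF sum_abs], rule sum_mono)
      fix i
      have "\<bar>(1 - w i) * (forward_prod k n w i \<omega> - local_gf k T (w i) i \<omega>)\<bar> \<le> 1 * \<bar>forward_prod k n w i \<omega> - local_gf k T (w i) i \<omega>\<bar>"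
        unfolding abs_mult using w[of i] by (intro mult_right_mono) auto
      also have "\<dots> \<le> (real k + 1) * (V i + late i \<omega> + of_bool (n < i + T))"
        using local_approx[of w k n i \<omega> T, OF w] by (simp only: V_def late_def mult_1)
      finally show "\<bar>(1 - w i) * (forward_prod k n w i \<omega> - local_gf k T (w i) i \<omega>)\<bar> \<le> (real k + 1) * (V i + late i \<omega> + of_bool (n < i + T))" .
    qed
    moreover have "\<bar>\<Sum>i\<le>n. (1 - w i) * return_gf k T (w i) - cluster_rate k (w i)\<bar> \<le> C"
    proof -
      have "\<bar>\<Sum>i\<le>n. (1 - w i) * return_gf k T (w i) - cluster_rate k (w i)\<bar> \<le> (\<Sum>i\<le>n. (real k + 1) * tail k T)"
        by (rule order_trans[OF sum_abs], rule sum_mono, rule return_gf_approx[OF w'])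
      thus ?thesis by (simp add: C_def algebra_simps)
    qed
    ultimately show ?thesis unfolding B_def by linarith
  qed
  have EA: "expectation A \<le> (real k + 1) * (real T * (real T * (real L * (1 + real T))) + real T) + C"
  proof -
    have "expectation A = (\<Sum>i\<le>n. (real k + 1) * (V i + expectation (late i) + of_bool (n < i + T)))"
      unfolding A_def[abs_def] using late_int by (simp add: Bochner_Integration.integral_sum prob_space)
    also have "\<dots> \<le> (\<Sum>i\<le>n. (real k + 1) * (V i + tail k T + of_bool (n < i + T)))"
      by (intro sum_mono mult_left_mono add_mono late_exp) auto
    also have "\<dots> = (real k + 1) * ((\<Sum>i\<le>n. V i) + (real n + 1) * tail k T + (\<Sum>i\<le>n. of_bool (n < i + T)))"
      by (simp add: sum.distrib sum_distrib_left[symmetric] algebra_simps)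
    also have "\<dots> \<le> (real k + 1) * (real T * (real T * (real L * (1 + real T))) + (real n + 1) * tail k T + real T)"
    proof (intro mult_left_mono add_mono order_refl)
      have "(\<Sum>i\<le>n. V i) = (\<Sum>d\<in>{0<..T}. \<Sum>i\<le>n. \<bar>w (i + d) - w i\<bar>)"
        unfolding V_def by (rule sum.swap)
      also have "\<dots> \<le> (\<Sum>d\<in>{0<..T}. real T * (real L * (1 + real T)))"
      proof (rule sum_mono)
        fix d assume d: "d \<in> {0<..T}"
        have "(\<Sum>i\<le>n. \<bar>w (i + d) - w i\<bar>) \<le> real d * (real L * (1 + real d))"
          unfolding w_def by (rule sum_shift_step_bound[OF n]) (use W in \<open>auto simp: less_imp_le\<close>)
        also have "\<dots> \<le> real T * (real L * (1 + real T))" using d by (intro mult_mono) auto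
        finally show "(\<Sum>i\<le>n. \<bar>w (i + d) - w i\<bar>) \<le> real T * (real L * (1 + real T))" .
      qed
      finally show "(\<Sum>i\<le>n. V i) \<le> real T * (real T * (real L * (1 + real T)))" by simp
      have "(\<Sum>i\<le>n. of_bool (n < i + T)) = real (card {i\<in>{..n}. n < i + T})"
        by (subst card_filter_eq_sum) auto
      also have "card {i\<in>{..n}. n < i + T} \<le> card {Suc n - T..<Suc n}" by (intro card_mono) auto
      also have "\<dots> \<le> T" by simp
      finally show "(\<Sum>i\<le>n. of_bool (n < i + T)) \<le> real T" by simp
    qed auto
    finally show ?thesis by (simp add: C_def algebra_simps)
  qed
  have "expectation (\<lambda>\<omega>. \<bar>cluster_sum k n w \<omega> - (\<Sum>i\<le>n. cluster_rate k (w i))\<bar>) \<le> expectation (\<lambda>\<omega>. A \<omega> + B \<omega> + C)"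
    by (rule integral_mono) (use A_int B_int integrable_cluster_sum[of w k n, OF w] point in auto)
  also have "\<dots> = expectation A + expectation B + C" using A_int B_int by (simp add: prob_space)
  also have "expectation B \<le> sqrt ((real n + 1) * (2 * real T * (real k + 1)\<^sup>2))"
    unfolding B_def by (rule local_gf_concentration[OF w])
  finally show ?thesis using EA unfolding C_def by linarith
qed

text \<open>A crude bound uniform in \<open>z\<close>, read off from \<open>return_gf_approx\<close>
  at horizon 0; it controls the grid sums.\<close>

lemma cluster_rate_bound: "0 \<le> z \<Longrightarrow> z < 1 \<Longrightarrow> \<bar>cluster_rate k z\<bar> \<le> 2 * (real k + 1) + tail k 0 * (real k + 1)"
proof -
  assume z: "0 \<le> z" "z < 1"
  have "0 \<le> (1 - z) * return_gf k 0 z" "(1 - z) * return_gf k 0 z \<le> 1 * (real k + 1)"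
    using z return_gf_bounds[of z k 0] by (auto intro: mult_mono[of "1 - z" 1, simplified])
  thus ?thesis using return_gf_approx[OF z, of k 0] by (simp add: algebra_simps)
qed

lemma cluster_sum_tendsto:
  fixes W :: "nat \<Rightarrow> real"
  assumes L: "L > 0" and W: "\<And>l. 0 \<le> W l \<and> W l < 1"
  shows "(\<lambda>n. expectation (\<lambda>\<omega>. \<bar>cluster_sum k n (\<lambda>i. W (L * i div n)) \<omega> / real n - (\<Sum>l<L. cluster_rate k (W l)) / real L\<bar>)) \<longlonglongrightarrow> 0"
proof (rule LIMSEQ_I)
  fix \<epsilon> :: real assume \<epsilon>: "\<epsilon> > 0"
  define c0 where "c0 = (\<Sum>l<L. cluster_rate k (W l)) / real L"
  define CB where "CB = 2 * (real k + 1) + tail k 0 * (real k + 1)"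
  have CB: "\<bar>cluster_rate k (W l)\<bar> \<le> CB" for l unfolding CB_def using W by (intro cluster_rate_bound) auto
  \<comment> \<open>The horizon is fixed before \<open>n\<close>: its error does not vanish with
    \<open>n\<close>, while all others do. The 4 combines the factor 2 of
    \<open>cluster_sum_bound\<close> with \<open>(n + 1) / n \<le> 2\<close>.\<close>
  have "(\<lambda>T. 4 * ((real k + 1) * tail k T)) \<longlonglongrightarrow> 4 * ((real k + 1) * 0)" by (intro tendsto_intros tail_tendsto)
  hence "\<forall>\<^sub>F T in sequentially. 4 * ((real k + 1) * tail k T) < \<epsilon> / 2"
    by (rule order_tendstoD(2)) (use \<epsilon> in simp)
  then obtain T where T: "4 * ((real k + 1) * tail k T) < \<epsilon> / 2" by (auto simp: eventually_sequentially)
  define D where "D = (real k + 1) * (real T * (real T * (real L * (1 + real T))) + real T) + CB * (real L + 1)"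
  define S where "S = 2 * real T * (real k + 1)\<^sup>2"
  have S: "S \<ge> 0" by (simp add: S_def)
  have bound: "expectation (\<lambda>\<omega>. \<bar>cluster_sum k n (\<lambda>i. W (L * i div n)) \<omega> / real n - c0\<bar>) \<le>
      D / real n + 4 * ((real k + 1) * tail k T) + sqrt (2 * S / real n)" if n: "n > 0" for n
  proof -
    let ?w = "\<lambda>i. W (L * i div n)"
    let ?s = "\<Sum>i\<le>n. cluster_rate k (?w i)"
    have w: "0 \<le> ?w i \<and> ?w i \<le> 1" for i using W by (auto simp: less_imp_le)
    have int: "integrable M (cluster_sum k n ?w)" by (rule integrable_cluster_sum[OF w])
    have g: "\<bar>?s - real n * c0\<bar> \<le> CB * (real L + 1)"
      unfolding c0_def by (rule grid_sum_bound[OF n L CB])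
    have "expectation (\<lambda>\<omega>. \<bar>cluster_sum k n ?w \<omega> / real n - c0\<bar>) \<le> expectation (\<lambda>\<omega>. (\<bar>cluster_sum k n ?w \<omega> - ?s\<bar> + CB * (real L + 1)) / real n)"
    proof (rule integral_mono)
      fix \<omega>
      have "\<bar>cluster_sum k n ?w \<omega> - real n * c0\<bar> \<le> \<bar>cluster_sum k n ?w \<omega> - ?s\<bar> + CB * (real L + 1)" using g by linarith
      hence "\<bar>cluster_sum k n ?w \<omega> - real n * c0\<bar> / real n \<le> (\<bar>cluster_sum k n ?w \<omega> - ?s\<bar> + CB * (real L + 1)) / real n"
        by (intro divide_right_mono) auto
      moreover have "cluster_sum k n ?w \<omega> / real n - c0 = (cluster_sum k n ?w \<omega> - real n * c0) / real n"
        using n by (simp add: field_simps)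
      hence "\<bar>cluster_sum k n ?w \<omega> / real n - c0\<bar> = \<bar>cluster_sum k n ?w \<omega> - real n * c0\<bar> / real n"
        using n by simp
      ultimately show "\<bar>cluster_sum k n ?w \<omega> / real n - c0\<bar> \<le> (\<bar>cluster_sum k n ?w \<omega> - ?s\<bar> + CB * (real L + 1)) / real n" by linarith
    qed (use int in auto)
    also have "\<dots> = (expectation (\<lambda>\<omega>. \<bar>cluster_sum k n ?w \<omega> - ?s\<bar>) + CB * (real L + 1)) / real n"
      using int by (simp add: prob_space)
    also have "\<dots> \<le> (D + (real n + 1) * (2 * ((real k + 1) * tail k T)) + sqrt ((real n + 1) * S)) / real n"
      using cluster_sum_bound[where W = W, OF n L W, of k T] by (intro divide_right_mono) (auto simp: D_def S_def)
    also have "\<dots> = D / real n + (real n + 1) * (2 * ((real k + 1) * tail k T)) / real n + sqrt ((real n + 1) * S) / real n"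
      by (simp add: add_divide_distrib)
    also have "\<dots> \<le> D / real n + 4 * ((real k + 1) * tail k T) + sqrt (2 * S / real n)"
    proof (intro add_mono order_refl)
      have "(real n + 1) * (2 * ((real k + 1) * tail k T)) \<le> (2 * real n) * (2 * ((real k + 1) * tail k T))"
        using n tail_nonneg by (intro mult_right_mono) auto
      thus "(real n + 1) * (2 * ((real k + 1) * tail k T)) / real n \<le> 4 * ((real k + 1) * tail k T)"
        using n by (simp add: pos_divide_le_eq mult_ac)
      have "sqrt ((real n + 1) * S) / real n = sqrt ((real n + 1) * S / (real n)\<^sup>2)"
        using n by (simp add: real_sqrt_divide)
      also have "\<dots> \<le> sqrt (2 * S / real n)"
      proof (rule real_sqrt_le_mono)
        have "(real n + 1) * S / (real n)\<^sup>2 \<le> (2 * real n) * S / (real n)\<^sup>2"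
          using n S by (intro divide_right_mono mult_right_mono) auto
        also have "\<dots> = 2 * S / real n" using n by (simp add: power2_eq_square)
        finally show "(real n + 1) * S / (real n)\<^sup>2 \<le> 2 * S / real n" .
      qed
      finally show "sqrt ((real n + 1) * S) / real n \<le> sqrt (2 * S / real n)" .
    qed
    finally show ?thesis .
  qed
  have "(\<lambda>n. D / real n + sqrt (2 * S / real n)) \<longlonglongrightarrow> 0 + sqrt 0"
    by (intro tendsto_intros lim_const_over_n)
  hence "\<forall>\<^sub>F n in sequentially. D / real n + sqrt (2 * S / real n) < \<epsilon> / 2"
    by (rule order_tendstoD(2)) (use \<epsilon> in simp)
  with eventually_gt_at_top[of 0]
  have "\<forall>\<^sub>F n in sequentially. norm (expectation (\<lambda>\<omega>. \<bar>cluster_sum k n (\<lambda>i. W (L * i div n)) \<omega> / real n - c0\<bar>) - 0) < \<epsilon>"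
  proof eventually_elim
    case (elim n)
    have "0 \<le> expectation (\<lambda>\<omega>. \<bar>cluster_sum k n (\<lambda>i. W (L * i div n)) \<omega> / real n - c0\<bar>)"
      by (rule Bochner_Integration.integral_nonneg) auto
    thus ?case using bound[OF elim(1)] elim(2) T unfolding real_norm_def by linarith
  qed
  thus "\<exists>no. \<forall>n\<ge>no. norm (expectation (\<lambda>\<omega>. \<bar>cluster_sum k n (\<lambda>i. W (L * i div n)) \<omega> / real n - (\<Sum>l<L. cluster_rate k (W l)) / real L\<bar>) - 0) < \<epsilon>"
    by (simp add: eventually_sequentially c0_def)
qed

end

section \<open>The scenery along a fixed path\<close>

lemma exp_minus_bounds:
  fixes x :: real
  assumes "0 \<le> x"
  shows "\<bar>1 - x - exp (- x)\<bar> \<le> x\<^sup>2"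
proof -
  have 1: "1 - x \<le> exp (- x)" using exp_ge_add_one_self[of "- x"] by simp
  have "exp (- x) * (1 + x) \<le> exp (- x) * exp x" using exp_ge_add_one_self[of x] by (intro mult_left_mono) auto
  also have "\<dots> = 1" by (simp add: exp_minus)
  also have "1 \<le> (1 - x + x\<^sup>2) * (1 + x)"
  proof -
    have "(1 - x + x\<^sup>2) * (1 + x) = 1 + x ^ 3" by (simp add: algebra_simps power2_eq_square power3_eq_cube)
    thus ?thesis using assms by simp
  qed
  finally have "exp (- x) \<le> 1 - x + x\<^sup>2" using assms by (simp add: mult_le_cancel_right_pos)
  thus ?thesis using 1 by simp
qed

lemma abs_exp_minus_diff_le:
  fixes a b :: real
  assumes "0 \<le> a" "0 \<le> b"
  shows "\<bar>exp (- a) - exp (- b)\<bar> \<le> \<bar>a - b\<bar>"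
proof -
  have *: "exp (- a) - exp (- b) \<le> b - a" if "0 \<le> a" "a \<le> b" for a b :: real
  proof -
    have "exp (- a) - exp (- b) = exp (- a) * (1 - exp (- (b - a)))" by (simp add: right_diff_distrib flip: exp_add)
    also have "\<dots> \<le> 1 * (b - a)"
    proof (rule mult_mono)
      show "1 - exp (- (b - a)) \<le> b - a" using exp_ge_add_one_self[of "- (b - a)"] by linarith
      show "0 \<le> 1 - exp (- (b - a))" using that by simp
    qed (use that in auto)
    finally show ?thesis by simp
  qed
  show ?thesis
  proof (cases "a \<le> b")
    case True
    hence "exp (- b) \<le> exp (- a)" by simp
    thus ?thesis using *[OF assms(1) True] True by simp
  next
    case False
    hence "b \<le> a" by simp
    hence "exp (- a) \<le> exp (- b)" by simp
    thus ?thesis using *[OF assms(2) \<open>b \<le> a\<close>] False by simp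
  qed
qed

lemma one_minus_power_bound:
  fixes p :: real
  assumes "0 \<le> p" "p \<le> 1"
  shows "\<bar>1 - (1 - p) ^ m - real m * p\<bar> \<le> (real m)\<^sup>2 * p\<^sup>2"
proof (induction m)
  case (Suc m)
  have b: "1 - (1 - p) ^ m \<le> real m * p" "0 \<le> 1 - (1 - p) ^ m"
    using Bernoulli_inequality[of "- p" m] assms by (auto simp: power_le_one)
  have "1 - (1 - p) ^ Suc m - real (Suc m) * p = (1 - (1 - p) ^ m - real m * p) - p * (1 - (1 - p) ^ m)"
    by (simp add: algebra_simps)
  also have "\<bar>\<dots>\<bar> \<le> (real m)\<^sup>2 * p\<^sup>2 + p * (real m * p)"
  proof -
    have "0 \<le> p * (1 - (1 - p) ^ m)" using assms b by simp
    moreover have "p * (1 - (1 - p) ^ m) \<le> p * (real m * p)" using assms b by (intro mult_left_mono) auto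
    ultimately show ?thesis using Suc by linarith
  qed
  also have "\<dots> = ((real m)\<^sup>2 + real m) * p\<^sup>2" by (simp add: algebra_simps power2_eq_square)
  also have "\<dots> \<le> (real (Suc m))\<^sup>2 * p\<^sup>2" by (intro mult_right_mono) (auto simp: power2_eq_square algebra_simps)
  finally show ?case .
qed simp

lemma moving_max_exceeds: "u < moving_max Y k s \<omega> \<longleftrightarrow> (\<exists>t\<in>{s..s + int k}. u < Y t \<omega>)"
  unfolding moving_max_def by (subst Max_gr_iff) auto

locale iid_scenery = prob_space M for M :: "'a measure" +
  fixes Y :: "int \<Rightarrow> 'a \<Rightarrow> real"
  assumes indep_Y: "indep_vars (\<lambda>_. borel) Y UNIV"
    and distr_Y: "\<And>s t. distr M borel (Y s) = distr M borel (Y t)"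
begin

lemma measurable_Y [measurable]: "Y t \<in> borel_measurable M"
  using indep_Y by (auto simp: indep_vars_def2)

definition excess :: "real \<Rightarrow> real" where "excess u = prob {\<omega> \<in> space M. u < Y 0 \<omega>}"

lemma excess_bounds: "0 \<le> excess u" "excess u \<le> 1" by (auto simp: excess_def)

lemma expectation_excess: "expectation (\<lambda>\<omega>. of_bool (u < Y t \<omega>)) = excess u"
proof -
  have "expectation (\<lambda>\<omega>. of_bool (u < Y t \<omega>)) = (\<integral>y. (of_bool (u < y) :: real) \<partial>distr M borel (Y t))" for t
    by (subst integral_distr) auto
  hence "expectation (\<lambda>\<omega>. of_bool (u < Y t \<omega>)) = expectation (\<lambda>\<omega>. of_bool (u < Y 0 \<omega>) :: real)"
    using distr_Y[of t 0] by simp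
  also have "\<dots> = excess u" unfolding excess_def by (rule expectation_of_bool) measurable
  finally show ?thesis .
qed

lemma expectation_prod_Y:
  fixes f :: "int \<Rightarrow> real \<Rightarrow> real"
  assumes "finite D" "\<And>t. f t \<in> borel_measurable borel" "\<And>t y. \<bar>f t y\<bar> \<le> B"
  shows "expectation (\<lambda>\<omega>. \<Prod>t\<in>D. f t (Y t \<omega>)) = (\<Prod>t\<in>D. expectation (\<lambda>\<omega>. f t (Y t \<omega>)))"
proof (rule indep_vars_lebesgue_integral[OF assms(1)])
  show "indep_vars (\<lambda>_. borel) (\<lambda>t \<omega>. f t (Y t \<omega>)) D"
    by (rule indep_vars_compose2[OF indep_vars_subset[OF indep_Y]]) (use assms in auto)
  show "integrable M (\<lambda>\<omega>. f t (Y t \<omega>))" for t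
    by (rule integrable_const_bound[where B = B]) (use assms measurable_compose[OF measurable_Y] in auto)
qed

lemma integrable_excess: "integrable M (\<lambda>\<omega>. of_bool (u < Y t \<omega>) :: real)"
  by (rule integrable_const_bound[where B = 1]) auto

lemma expectation_excess_pair:
  assumes "s \<noteq> t"
  shows "expectation (\<lambda>\<omega>. of_bool (u < Y s \<omega>) * of_bool (u < Y t \<omega>)) = (excess u)\<^sup>2"
proof -
  have "expectation (\<lambda>\<omega>. \<Prod>t\<in>{s, t}. (of_bool (u < Y t \<omega>) :: real)) = (\<Prod>t\<in>{s, t}. expectation (\<lambda>\<omega>. of_bool (u < Y t \<omega>)))"
    by (rule expectation_prod_Y[where B = 1]) auto
  thus ?thesis using assms by (simp add: expectation_excess power2_eq_square)
qed

lemma prob_moving_max: "prob {\<omega> \<in> space M. u < moving_max Y k s \<omega>} = 1 - (1 - excess u) ^ Suc k"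
proof -
  have ev: "{\<omega> \<in> space M. u < moving_max Y k s \<omega>} \<in> events" unfolding moving_max_exceeds by measurable
  have "1 - prob {\<omega> \<in> space M. u < moving_max Y k s \<omega>} = expectation (\<lambda>\<omega>. 1 - of_bool (u < moving_max Y k s \<omega>))"
    using expectation_of_bool[OF ev] ev
    by (subst Bochner_Integration.integral_diff) (auto simp: prob_space intro!: integrable_const_bound[where B = 1])
  also have "\<dots> = expectation (\<lambda>\<omega>. \<Prod>t\<in>{s..s + int k}. 1 - of_bool (u < Y t \<omega>))"
    by (intro Bochner_Integration.integral_cong) (auto simp: moving_max_exceeds prod_zero_iff)
  also have "\<dots> = (\<Prod>t\<in>{s..s + int k}. expectation (\<lambda>\<omega>. 1 - of_bool (u < Y t \<omega>)))"
    by (rule expectation_prod_Y[where B = 1]) auto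
  also have "\<dots> = (\<Prod>t\<in>{s..s + int k}. 1 - excess u)"
    using integrable_excess by (simp add: expectation_excess prob_space)
  also have "\<dots> = (1 - excess u) ^ Suc k" by (simp add: Suc_nat_eq_nat_zadd1 nat_add_distrib)
  finally show ?thesis by simp
qed

text \<open>The indicator is at most the number of ordered pairs of distinct exceeding sites; by
  independence each pair has probability \<open>(excess u)\<^sup>2\<close>.\<close>

lemma prob_two_exceedances:
  "expectation (\<lambda>\<omega>. of_bool (2 \<le> card {t\<in>{s..s + int k}. u < Y t \<omega>})) \<le> (real k + 1)\<^sup>2 * (excess u)\<^sup>2"
proof -
  let ?I = "{s..s + int k}"
  let ?e = "\<lambda>t \<omega>. of_bool (u < Y t \<omega>) :: real"
  have int: "integrable M (\<lambda>\<omega>. if t = t' then 0 else ?e t \<omega> * ?e t' \<omega>)" for t t'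
    by (rule integrable_const_bound[where B = 1]) auto
  have "(\<lambda>\<omega>. card {t\<in>?I. u < Y t \<omega>}) = (\<lambda>\<omega>. \<Sum>t\<in>?I. of_bool (u < Y t \<omega>))"
    by (intro ext card_filter_eq_sum) simp
  moreover have "(\<lambda>\<omega>. \<Sum>t\<in>?I. of_bool (u < Y t \<omega>) :: nat) \<in> measurable M (count_space UNIV)" by measurable
  ultimately have [measurable]: "(\<lambda>\<omega>. card {t\<in>?I. u < Y t \<omega>}) \<in> measurable M (count_space UNIV)" by simp
  have "expectation (\<lambda>\<omega>. of_bool (2 \<le> card {t\<in>?I. u < Y t \<omega>}))
      \<le> expectation (\<lambda>\<omega>. \<Sum>t\<in>?I. \<Sum>t'\<in>?I. if t = t' then 0 else ?e t \<omega> * ?e t' \<omega>)"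
  proof (rule integral_mono)
    show "integrable M (\<lambda>\<omega>. of_bool (2 \<le> card {t\<in>?I. u < Y t \<omega>}) :: real)"
    proof (rule integrable_const_bound[where B = 1])
      show "(\<lambda>\<omega>. of_bool (2 \<le> card {t\<in>?I. u < Y t \<omega>}) :: real) \<in> borel_measurable M" by measurable
    qed simp
    show "integrable M (\<lambda>\<omega>. \<Sum>t\<in>?I. \<Sum>t'\<in>?I. if t = t' then 0 else ?e t \<omega> * ?e t' \<omega>)"
      by (intro Bochner_Integration.integrable_sum int)
    fix \<omega>
    have nn: "0 \<le> (\<Sum>t'\<in>?I. if t = t' then 0 else ?e t \<omega> * ?e t' \<omega>)" for t by (intro sum_nonneg) auto
    show "of_bool (2 \<le> card {t\<in>?I. u < Y t \<omega>}) \<le> (\<Sum>t\<in>?I. \<Sum>t'\<in>?I. if t = t' then 0 else ?e t \<omega> * ?e t' \<omega>)"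
    proof (cases "2 \<le> card {t\<in>?I. u < Y t \<omega>}")
      case True
      from obtain_subset_with_card_n[OF this]
      obtain B where B: "B \<subseteq> {t\<in>?I. u < Y t \<omega>}" "card B = 2" .
      then obtain t t' where "B = {t, t'}" "t \<noteq> t'" by (auto simp: card_2_iff)
      with B have t: "t \<in> ?I" "u < Y t \<omega>" "t' \<in> ?I" "u < Y t' \<omega>" "t \<noteq> t'" by auto
      have "1 = (if t = t' then 0 else ?e t \<omega> * ?e t' \<omega>)" using t by simp
      also have "\<dots> \<le> (\<Sum>t'\<in>?I. if t = t' then 0 else ?e t \<omega> * ?e t' \<omega>)"
        by (rule member_le_sum[OF t(3)]) auto
      also have "\<dots> \<le> (\<Sum>t\<in>?I. \<Sum>t'\<in>?I. if t = t' then 0 else ?e t \<omega> * ?e t' \<omega>)"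
        by (rule member_le_sum[OF t(1)]) (use nn in auto)
      finally show ?thesis by simp
    qed (use nn in \<open>simp add: sum_nonneg\<close>)
  qed
  also have "\<dots> = (\<Sum>t\<in>?I. \<Sum>t'\<in>?I. expectation (\<lambda>\<omega>. if t = t' then 0 else ?e t \<omega> * ?e t' \<omega>))"
    using int by (simp add: Bochner_Integration.integral_sum Bochner_Integration.integrable_sum)
  also have "\<dots> \<le> (\<Sum>t\<in>?I. \<Sum>t'\<in>?I. (excess u)\<^sup>2)"
  proof (intro sum_mono)
    fix t t'
    show "expectation (\<lambda>\<omega>. if t = t' then 0 else ?e t \<omega> * ?e t' \<omega>) \<le> (excess u)\<^sup>2"
      by (cases "t = t'") (auto simp: expectation_excess_pair)
  qed
  also have "\<dots> = (real k + 1)\<^sup>2 * (excess u)\<^sup>2" by (simp add: power2_eq_square algebra_simps)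
  finally show ?thesis .
qed

text \<open>\<open>Z\<close> charges \<open>w i\<close> once if any site in range exceeds, while
  \<open>Z'\<close> charges it once per exceeding site. They differ only at times with at least two
  such sites. \<open>Z'\<close> is a product over independent sites, so its mean is a product of
  factors 1 - x, each replaced by exp(-x) at cost x squared.\<close>

lemma fixed_path_bound:
  assumes \<sigma>: "nn_path \<sigma> n" and w: "\<And>i. 0 \<le> w i \<and> w i \<le> (1 :: real)"
  shows "\<bar>expectation (\<lambda>\<omega>. \<Prod>i\<le>n. if u < moving_max Y k (\<sigma> i) \<omega> then w i else 1)
      - exp (- (excess u * (\<Sum>s\<in>site_range k n. 1 - (\<Prod>i\<in>hits k n \<sigma> s. w i))))\<bar>
    \<le> ((real n + 1) * (real k + 1)\<^sup>2 + (2 * real n + real k + 1)) * (excess u)\<^sup>2"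
proof -
  let ?D = "site_range k n"
  define \<phi> where "\<phi> t = (\<Prod>i\<in>hits k n \<sigma> t. w i)" for t
  have \<phi>: "0 \<le> \<phi> t" "\<phi> t \<le> 1" for t unfolding \<phi>_def using w by (auto intro!: prod_nonneg prod_le_1)
  define c where "c i \<omega> = card {t\<in>{\<sigma> i..\<sigma> i + int k}. u < Y t \<omega>}" for i \<omega>
  define Z where "Z \<omega> = (\<Prod>i\<le>n. if u < moving_max Y k (\<sigma> i) \<omega> then w i else 1)" for \<omega>
  define Z' where "Z' \<omega> = (\<Prod>t\<in>?D. if u < Y t \<omega> then \<phi> t else 1)" for \<omega>
  have [measurable]: "Measurable.pred M (\<lambda>\<omega>. u < moving_max Y k s \<omega>)" for s unfolding moving_max_exceeds by measurable
  have Zm[measurable]: "Z \<in> borel_measurable M" "Z' \<in> borel_measurable M"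
    unfolding Z_def[abs_def] Z'_def[abs_def] by measurable
  have Z01: "0 \<le> Z \<omega>" "Z \<omega> \<le> 1" "0 \<le> Z' \<omega>" "Z' \<omega> \<le> 1" for \<omega>
    unfolding Z_def Z'_def using w \<phi> by (auto intro!: prod_nonneg prod_le_1)
  have Zi: "integrable M Z" "integrable M Z'"
    by (rule integrable_const_bound[where B = 1]; use Z01 in auto)+
  have cm: "(\<lambda>\<omega>. c i \<omega>) \<in> measurable M (count_space UNIV)" for i
  proof -
    have "(\<lambda>\<omega>. c i \<omega>) = (\<lambda>\<omega>. \<Sum>t\<in>{\<sigma> i..\<sigma> i + int k}. of_bool (u < Y t \<omega>))"
      unfolding c_def by (intro ext card_filter_eq_sum) simp
    moreover have "(\<lambda>\<omega>. \<Sum>t\<in>{\<sigma> i..\<sigma> i + int k}. of_bool (u < Y t \<omega>) :: nat) \<in> measurable M (count_space UNIV)" by measurable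
    ultimately show ?thesis by simp
  qed
  note [measurable] = cm
  have Zc: "Z \<omega> = (\<Prod>i\<le>n. w i ^ min 1 (c i \<omega>))" for \<omega>
    unfolding Z_def
  proof (intro prod.cong refl)
    fix i
    have "finite {t\<in>{\<sigma> i..\<sigma> i + int k}. u < Y t \<omega>}" by (rule finite_subset[of _ "{\<sigma> i..\<sigma> i + int k}"]) auto
    hence "u < moving_max Y k (\<sigma> i) \<omega> \<longleftrightarrow> c i \<omega> > 0"
      unfolding c_def card_gt_0_iff moving_max_exceeds by blast
    thus "(if u < moving_max Y k (\<sigma> i) \<omega> then w i else 1) = w i ^ min 1 (c i \<omega>)" by (auto simp: min_def Suc_le_eq)
  qed
  \<comment> \<open>Products over sites and times are exchanged: \<open>w i\<close> appears once for
    every exceeding site \<open>t\<close> whose window contains the position at time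
    \<open>i\<close>.\<close>
  have Z'c: "Z' \<omega> = (\<Prod>i\<le>n. w i ^ c i \<omega>)" for \<omega>
  proof -
    have "Z' \<omega> = (\<Prod>t\<in>?D. \<Prod>i\<le>n. if u < Y t \<omega> \<and> \<sigma> i \<in> {t - int k..t} then w i else 1)"
      unfolding Z'_def
    proof (intro prod.cong refl)
      fix t
      have "\<phi> t = (\<Prod>i\<le>n. if \<sigma> i \<in> {t - int k..t} then w i else 1)"
        unfolding \<phi>_def hits_def by (rule prod.inter_filter) simp
      thus "(if u < Y t \<omega> then \<phi> t else 1) = (\<Prod>i\<le>n. if u < Y t \<omega> \<and> \<sigma> i \<in> {t - int k..t} then w i else 1)" by simp
    qed
    also have "\<dots> = (\<Prod>i\<le>n. \<Prod>t\<in>?D. if u < Y t \<omega> \<and> \<sigma> i \<in> {t - int k..t} then w i else 1)" by (rule prod.swap)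
    also have "\<dots> = (\<Prod>i\<le>n. w i ^ c i \<omega>)"
    proof (intro prod.cong refl)
      fix i assume i: "i \<in> {..n}"
      have "(\<Prod>t\<in>?D. if u < Y t \<omega> \<and> \<sigma> i \<in> {t - int k..t} then w i else 1)
          = (\<Prod>t\<in>{t\<in>?D. u < Y t \<omega> \<and> \<sigma> i \<in> {t - int k..t}}. w i)"
        by (rule prod.inter_filter[symmetric]) simp
      also have "{t\<in>?D. u < Y t \<omega> \<and> \<sigma> i \<in> {t - int k..t}} = {t\<in>{\<sigma> i..\<sigma> i + int k}. u < Y t \<omega>}"
        using nn_path_bound[OF \<sigma>, of i] i by (auto simp: site_range_def)
      finally show "(\<Prod>t\<in>?D. if u < Y t \<omega> \<and> \<sigma> i \<in> {t - int k..t} then w i else 1) = w i ^ c i \<omega>"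
        by (simp add: c_def)
    qed
    finally show ?thesis .
  qed
  have diff: "\<bar>Z \<omega> - Z' \<omega>\<bar> \<le> (\<Sum>i\<le>n. of_bool (2 \<le> c i \<omega>))" for \<omega>
  proof -
    have "\<bar>Z \<omega> - Z' \<omega>\<bar> \<le> (\<Sum>i\<le>n. \<bar>w i ^ min 1 (c i \<omega>) - w i ^ c i \<omega>\<bar>)"
      unfolding Zc Z'c using w by (intro abs_prod_diff_le) (auto intro: power_le_one)
    also have "\<dots> \<le> (\<Sum>i\<le>n. of_bool (2 \<le> c i \<omega>))"
    proof (rule sum_mono)
      fix i
      have "0 \<le> w i ^ m \<and> w i ^ m \<le> 1" for m using w[of i] by (auto intro: power_le_one)
      from this[of "min 1 (c i \<omega>)"] this[of "c i \<omega>"]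
      have "\<bar>w i ^ min 1 (c i \<omega>) - w i ^ c i \<omega>\<bar> \<le> 1" by auto
      thus "\<bar>w i ^ min 1 (c i \<omega>) - w i ^ c i \<omega>\<bar> \<le> of_bool (2 \<le> c i \<omega>)"
        by (cases "2 \<le> c i \<omega>") (auto simp: min_def not_le less_Suc_eq numeral_2_eq_2)
    qed
    finally show ?thesis .
  qed
  have ci: "integrable M (\<lambda>\<omega>. of_bool (2 \<le> c i \<omega>) :: real)" for i
    by (rule integrable_const_bound[where B = 1]) auto
  have "\<bar>expectation Z - expectation Z'\<bar> = \<bar>expectation (\<lambda>\<omega>. Z \<omega> - Z' \<omega>)\<bar>" using Zi by simp
  also have "\<dots> \<le> expectation (\<lambda>\<omega>. \<bar>Z \<omega> - Z' \<omega>\<bar>)" by (rule integral_abs_bound)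
  also have "\<dots> \<le> expectation (\<lambda>\<omega>. \<Sum>i\<le>n. of_bool (2 \<le> c i \<omega>))"
    using Zi ci diff by (intro integral_mono Bochner_Integration.integrable_sum integrable_abs Bochner_Integration.integrable_diff)
  also have "\<dots> = (\<Sum>i\<le>n. expectation (\<lambda>\<omega>. of_bool (2 \<le> c i \<omega>)))"
    using ci by (rule Bochner_Integration.integral_sum)
  also have "\<dots> \<le> (\<Sum>i\<le>n. (real k + 1)\<^sup>2 * (excess u)\<^sup>2)"
    unfolding c_def by (intro sum_mono prob_two_exceedances)
  finally have d1: "\<bar>expectation Z - expectation Z'\<bar> \<le> (real n + 1) * ((real k + 1)\<^sup>2 * (excess u)\<^sup>2)"
    by (simp add: algebra_simps)
  have E': "expectation Z' = (\<Prod>t\<in>?D. 1 - excess u * (1 - \<phi> t))"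
  proof -
    have "expectation Z' = (\<Prod>t\<in>?D. expectation (\<lambda>\<omega>. if u < Y t \<omega> then \<phi> t else 1))"
      unfolding Z'_def by (rule expectation_prod_Y[where B = 1]) (use \<phi> in auto)
    also have "\<dots> = (\<Prod>t\<in>?D. 1 - excess u * (1 - \<phi> t))"
    proof (intro prod.cong refl)
      fix t
      have "expectation (\<lambda>\<omega>. if u < Y t \<omega> then \<phi> t else 1) = expectation (\<lambda>\<omega>. 1 - (1 - \<phi> t) * of_bool (u < Y t \<omega>))"
        by (intro Bochner_Integration.integral_cong) auto
      also have "\<dots> = 1 - (1 - \<phi> t) * excess u"
        using integrable_excess by (simp add: prob_space expectation_excess)
      finally show "expectation (\<lambda>\<omega>. if u < Y t \<omega> then \<phi> t else 1) = 1 - excess u * (1 - \<phi> t)" by (simp add: mult.commute)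
    qed
    finally show ?thesis .
  qed
  have x01: "0 \<le> excess u * (1 - \<phi> t)" "excess u * (1 - \<phi> t) \<le> excess u" for t
    using \<phi>[of t] excess_bounds[of u] by (auto intro: mult_left_le)
  have u1: "0 \<le> 1 - excess u * (1 - \<phi> t) \<and> 1 - excess u * (1 - \<phi> t) \<le> 1" for t
    using x01[of t] excess_bounds[of u] by linarith
  have u2: "0 \<le> exp (- (excess u * (1 - \<phi> t))) \<and> exp (- (excess u * (1 - \<phi> t))) \<le> 1" for t
    using x01(1)[of t] by simp
  have e: "exp (- (excess u * (\<Sum>t\<in>?D. 1 - \<phi> t))) = (\<Prod>t\<in>?D. exp (- (excess u * (1 - \<phi> t))))"
    unfolding sum_distrib_left sum_negf[symmetric] by (rule exp_sum) simp
  have "\<bar>expectation Z' - exp (- (excess u * (\<Sum>t\<in>?D. 1 - \<phi> t)))\<bar>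
      \<le> (\<Sum>t\<in>?D. \<bar>1 - excess u * (1 - \<phi> t) - exp (- (excess u * (1 - \<phi> t)))\<bar>)"
    unfolding E' e by (rule abs_prod_diff_le[OF u1 u2])
  also have "\<dots> \<le> (\<Sum>t\<in>?D. (excess u)\<^sup>2)"
  proof (rule sum_mono)
    fix t
    have "\<bar>1 - excess u * (1 - \<phi> t) - exp (- (excess u * (1 - \<phi> t)))\<bar> \<le> (excess u * (1 - \<phi> t))\<^sup>2"
      by (rule exp_minus_bounds[OF x01(1)])
    also have "\<dots> \<le> (excess u)\<^sup>2" using x01 by (intro power_mono) auto
    finally show "\<bar>1 - excess u * (1 - \<phi> t) - exp (- (excess u * (1 - \<phi> t)))\<bar> \<le> (excess u)\<^sup>2" .
  qed
  also have "\<dots> = (2 * real n + real k + 1) * (excess u)\<^sup>2" by (simp add: card_site_range)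
  finally have d2: "\<bar>expectation Z' - exp (- (excess u * (\<Sum>t\<in>?D. 1 - \<phi> t)))\<bar> \<le> (2 * real n + real k + 1) * (excess u)\<^sup>2" .
  have "((real n + 1) * (real k + 1)\<^sup>2 + (2 * real n + real k + 1)) * (excess u)\<^sup>2 =
      (real n + 1) * ((real k + 1)\<^sup>2 * (excess u)\<^sup>2) + (2 * real n + real k + 1) * (excess u)\<^sup>2"
    by (simp add: algebra_simps)
  thus ?thesis using d1 d2 unfolding Z_def[abs_def] \<phi>_def by linarith
qed

end

section \<open>Convergence of the exceedances\<close>

text \<open>Composition with real-valued test functions brings both elements to the same value type.
  The preimages under the compositions are among the original ones, so independence is inherited and
  the product rule for \<open>indep_var\<close> applies.\<close>

lemma (in prob_space) indep_elements_expectation: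
  fixes \<phi> :: "'b \<Rightarrow> real" and \<psi> :: "'c \<Rightarrow> real"
  assumes ind: "indep_elements M N f N' g"
    and \<phi>[measurable]: "\<phi> \<in> borel_measurable N" "\<And>x. \<bar>\<phi> x\<bar> \<le> B"
    and \<psi>[measurable]: "\<psi> \<in> borel_measurable N'" "\<And>x. \<bar>\<psi> x\<bar> \<le> B"
  shows "expectation (\<lambda>\<omega>. \<phi> (f \<omega>) * \<psi> (g \<omega>)) = expectation (\<lambda>\<omega>. \<phi> (f \<omega>)) * expectation (\<lambda>\<omega>. \<psi> (g \<omega>))"
proof (rule indep_var_lebesgue_integral)
  have f[measurable]: "f \<in> measurable M N" and g[measurable]: "g \<in> measurable M N'"
    and set: "indep_set {f -` A \<inter> space M | A. A \<in> sets N} {g -` B \<inter> space M | B. B \<in> sets N'}"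
    using ind by (auto simp: indep_elements_def)
  have \<phi>f: "(\<lambda>\<omega>. \<phi> (f \<omega>)) \<in> borel_measurable M" and \<psi>g: "(\<lambda>\<omega>. \<psi> (g \<omega>)) \<in> borel_measurable M" by measurable
  show "integrable M (\<lambda>\<omega>. \<phi> (f \<omega>))" by (rule integrable_const_bound[where B = B]) (use \<phi> \<phi>f in auto)
  show "integrable M (\<lambda>\<omega>. \<psi> (g \<omega>))" by (rule integrable_const_bound[where B = B]) (use \<psi> \<psi>g in auto)
  have stable: "Int_stable {h -` A \<inter> space M | A. A \<in> sets borel}" for h :: "'a \<Rightarrow> real"
    unfolding Int_stable_def
  proof (intro ballI)
    fix a b assume "a \<in> {h -` A \<inter> space M | A. A \<in> sets borel}" "b \<in> {h -` A \<inter> space M | A. A \<in> sets borel}"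
    then obtain A B where "A \<in> sets borel" "a = h -` A \<inter> space M" "B \<in> sets borel" "b = h -` B \<inter> space M" by auto
    hence "a \<inter> b = h -` (A \<inter> B) \<inter> space M" "A \<inter> B \<in> sets borel" by auto
    thus "a \<inter> b \<in> {h -` A \<inter> space M | A. A \<in> sets borel}" by blast
  qed
  have sub: "{(\<lambda>\<omega>. \<theta> (h \<omega>)) -` A \<inter> space M | A. A \<in> sets borel} \<subseteq> {h -` A \<inter> space M | A. A \<in> sets K}"
    if h: "h \<in> measurable M K" and \<theta>: "\<theta> \<in> borel_measurable K" for h :: "'a \<Rightarrow> 'z" and \<theta> :: "'z \<Rightarrow> real" and K
  proof safe
    fix A :: "real set" assume A: "A \<in> sets borel"
    have "(\<lambda>\<omega>. \<theta> (h \<omega>)) -` A \<inter> space M = h -` (\<theta> -` A \<inter> space K) \<inter> space M"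
      using measurable_space[OF h] by auto
    moreover have "\<theta> -` A \<inter> space K \<in> sets K" by (rule measurable_sets[OF \<theta> A])
    ultimately show "\<exists>A'. (\<lambda>\<omega>. \<theta> (h \<omega>)) -` A \<inter> space M = h -` A' \<inter> space M \<and> A' \<in> sets K" by blast
  qed
  have "indep_set {(\<lambda>\<omega>. \<phi> (f \<omega>)) -` A \<inter> space M | A. A \<in> sets borel} {(\<lambda>\<omega>. \<psi> (g \<omega>)) -` A \<inter> space M | A. A \<in> sets borel}"
    unfolding indep_sets2_eq
  proof (intro conjI ballI)
    fix a b assume a: "a \<in> {(\<lambda>\<omega>. \<phi> (f \<omega>)) -` A \<inter> space M | A. A \<in> sets borel}"
      and b: "b \<in> {(\<lambda>\<omega>. \<psi> (g \<omega>)) -` A \<inter> space M | A. A \<in> sets borel}"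
    from subsetD[OF sub[OF f \<phi>(1)] a] subsetD[OF sub[OF g \<psi>(1)] b]
    show "prob (a \<inter> b) = prob a * prob b" using set unfolding indep_sets2_eq by blast
  qed (use measurable_sets[OF \<phi>f] measurable_sets[OF \<psi>g] in blast)+
  hence "indep_set (sigma_sets (space M) {(\<lambda>\<omega>. \<phi> (f \<omega>)) -` A \<inter> space M | A. A \<in> sets borel})
      (sigma_sets (space M) {(\<lambda>\<omega>. \<psi> (g \<omega>)) -` A \<inter> space M | A. A \<in> sets borel})"
    by (rule indep_set_sigma_sets) (rule stable)+
  thus "indep_var borel (\<lambda>\<omega>. \<phi> (f \<omega>)) borel (\<lambda>\<omega>. \<psi> (g \<omega>))"
    unfolding indep_var_eq using \<phi>f \<psi>g by blast
qed

text \<open>Independence is between the steps and the field of moving maxima. Averaging over the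
  walk is therefore done with functionals of that field, and the i.i.d. variables \<open>Y\<close>
  enter through bounds for fixed paths.\<close>

locale walk_in_scenery = biased_walk M X p + iid_scenery M Y
  for M :: "'a measure" and X :: "nat \<Rightarrow> 'a \<Rightarrow> int" and p :: real and Y :: "int \<Rightarrow> 'a \<Rightarrow> real" +
  fixes k :: nat
  assumes indep_walk_scenery: "indep_elements M
     (PiM {1..} (\<lambda>_. count_space UNIV)) (\<lambda>\<omega>. \<lambda>i\<in>{1..}. X i \<omega>)
     (PiM UNIV (\<lambda>_. borel)) (\<lambda>\<omega> s. moving_max Y k s \<omega>)"
begin

lemma pred_exceeds [measurable]: "Measurable.pred M (\<lambda>\<omega>. u < moving_max Y k s \<omega>)"
  unfolding moving_max_exceeds by measurable

lemma pred_exceeds_walk [measurable]: "Measurable.pred M (\<lambda>\<omega>. u < moving_max Y k (walk X i \<omega>) \<omega>)"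
  by (rule measurable_compose_countable[where f = "\<lambda>s \<omega>. u < moving_max Y k s \<omega>" and g = "walk X i"]) auto

definition exceed_prod :: "real \<Rightarrow> nat \<Rightarrow> (nat \<Rightarrow> real) \<Rightarrow> (nat \<Rightarrow> int) \<Rightarrow> 'a \<Rightarrow> real" where
  "exceed_prod u n w \<sigma> \<omega> = (\<Prod>i\<le>n. if u < moving_max Y k (\<sigma> i) \<omega> then w i else 1)"

definition path_of :: "(nat \<Rightarrow> int) \<Rightarrow> nat \<Rightarrow> int" where "path_of x i = (\<Sum>j=1..i. x j)"

text \<open>Up to time \<open>n\<close> the walk has finitely many step sequences, so conditioning
  on it is a finite sum over indicators.\<close>

definition paths :: "nat \<Rightarrow> (nat \<Rightarrow> int) set" where "paths n = PiE {1..n} (\<lambda>_. {1, -1})"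

lemma finite_paths [simp]: "finite (paths n)" unfolding paths_def by (intro finite_PiE) auto

lemma nn_path_of: "x \<in> paths n \<Longrightarrow> nn_path (path_of x) n"
  unfolding nn_path_def path_of_def paths_def
proof (intro conjI allI impI)
  fix i assume x: "x \<in> PiE {1..n} (\<lambda>_. {1, -1})" and i: "i < n"
  have "x (Suc i) \<in> {1, -1}" using PiE_mem[OF x, of "Suc i"] i by simp
  thus "\<bar>(\<Sum>j=1..Suc i. x j) - (\<Sum>j=1..i. x j)\<bar> = 1" by auto
qed simp

text \<open>Almost surely all steps are 1 or -1, so exactly one indicator in the sum is 1. The
  quantifier over \<open>G\<close> lets the same \<open>x\<close> serve for every functional
  evaluated along the path.\<close>

lemma path_decomposition:
  "AE \<omega> in M. \<exists>x\<in>paths n. (\<forall>i\<le>n. walk X i \<omega> = path_of x i) \<and>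
     (\<forall>G :: (nat \<Rightarrow> int) \<Rightarrow> real. (\<Sum>y\<in>paths n. of_bool (\<forall>j\<in>{1..n}. X j \<omega> = y j) * G y) = G x)"
  using AE_steps
proof eventually_elim
  case (elim \<omega>)
  define x where "x = (\<lambda>j\<in>{1..n}. X j \<omega>)"
  have "X j \<omega> \<in> {1, -1}" if "j \<in> {1..n}" for j using elim[rule_format, of "j - 1"] that by auto
  hence x: "x \<in> paths n" unfolding x_def paths_def by (intro restrict_PiE_iff[THEN iffD2]) auto
  have "walk X i \<omega> = path_of x i" if "i \<le> n" for i
    unfolding walk_def path_of_def x_def using that by (intro sum.cong) auto
  moreover have "(\<Sum>y\<in>paths n. of_bool (\<forall>j\<in>{1..n}. X j \<omega> = y j) * G y) = G x" for G :: "(nat \<Rightarrow> int) \<Rightarrow> real"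
  proof -
    have eq: "(\<forall>j\<in>{1..n}. X j \<omega> = y j) \<longleftrightarrow> y = x" if "y \<in> paths n" for y
    proof
      assume "\<forall>j\<in>{1..n}. X j \<omega> = y j"
      thus "y = x" using that unfolding paths_def x_def by (intro extensionalityI[of y "{1..n}"]) (auto simp: PiE_def)
    qed (simp add: x_def)
    have "(\<Sum>y\<in>paths n. of_bool (\<forall>j\<in>{1..n}. X j \<omega> = y j) * G y) = (\<Sum>y\<in>paths n. if y = x then G y else 0)"
      by (intro sum.cong refl) (simp only: eq of_bool_def if_distrib mult_1 mult_zero_left if_True if_False, simp)
    thus ?thesis using x by simp
  qed
  ultimately show ?case using x by blast
qed

lemma exceed_prod_bounds:
  assumes "\<And>i. 0 \<le> w i \<and> w i \<le> 1"
  shows "0 \<le> exceed_prod u n w \<sigma> \<omega>" "exceed_prod u n w \<sigma> \<omega> \<le> 1"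
  unfolding exceed_prod_def using assms by (auto intro!: prod_nonneg prod_le_1)

text \<open>The average of \<open>fixed_path_bound\<close> over the walk: its error does not depend
  on the path, and the path probabilities add up to 1.\<close>

lemma annealed_bound:
  assumes w: "\<And>i. 0 \<le> w i \<and> w i \<le> (1 :: real)"
  shows "\<bar>expectation (\<lambda>\<omega>. exceed_prod u n w (\<lambda>i. walk X i \<omega>) \<omega>) - expectation (\<lambda>\<omega>. exp (- (excess u * cluster_sum k n w \<omega>)))\<bar>
    \<le> ((real n + 1) * (real k + 1)\<^sup>2 + (2 * real n + real k + 1)) * (excess u)\<^sup>2"
proof -
  let ?err = "((real n + 1) * (real k + 1)\<^sup>2 + (2 * real n + real k + 1)) * (excess u)\<^sup>2"
  define C where "C x = (\<Sum>s\<in>site_range k n. 1 - (\<Prod>i\<in>hits k n (path_of x) s. w i))" for x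
  define I where "I x \<omega> = (of_bool (\<forall>j\<in>{1..n}. X j \<omega> = x j) :: real)" for x \<omega>
  have mX: "j \<in> {1..n} \<Longrightarrow> X j \<in> measurable M (count_space UNIV)" for j by (rule measurable_X) simp
  have Im: "I x \<in> borel_measurable M" for x
  proof -
    have "Measurable.pred M (\<lambda>\<omega>. X j \<omega> = x j)" if "j \<in> {1..n}" for j
      by (rule measurable_compose[OF mX[OF that]]) simp
    hence "Measurable.pred M (\<lambda>\<omega>. \<forall>j\<in>{1..n}. X j \<omega> = x j)" by (intro pred_intros_finite) auto
    thus ?thesis unfolding I_def[abs_def] by measurable
  qed
  have I01: "0 \<le> I x \<omega>" "I x \<omega> \<le> 1" for x \<omega> by (auto simp: I_def)
  have Ii: "integrable M (I x)" for x by (rule integrable_const_bound[where B = 1]) (use Im I01 in auto)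
  have Em[measurable]: "exceed_prod u n w \<sigma> \<in> borel_measurable M" for \<sigma> unfolding exceed_prod_def[abs_def] by measurable
  have IE: "integrable M (\<lambda>\<omega>. I x \<omega> * exceed_prod u n w \<sigma> \<omega>)" for x \<sigma>
  proof (rule integrable_const_bound[where B = 1])
    show "AE \<omega> in M. norm (I x \<omega> * exceed_prod u n w \<sigma> \<omega>) \<le> 1"
      using I01 exceed_prod_bounds[OF w] by (intro AE_I2) (auto simp: abs_mult intro!: mult_le_one)
  qed (use Im in measurable)
  have ind: "expectation (\<lambda>\<omega>. I x \<omega> * exceed_prod u n w \<sigma> \<omega>) = expectation (I x) * expectation (exceed_prod u n w \<sigma>)" for x \<sigma>
  proof -
    define \<phi> where "\<phi> f = (of_bool (\<forall>j\<in>{1..n}. f j = x j) :: real)" for f :: "nat \<Rightarrow> int"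
    define \<psi> where "\<psi> f = (\<Prod>i\<le>n. if u < f (\<sigma> i) then w i else 1)" for f :: "int \<Rightarrow> real"
    have \<phi>m: "\<phi> \<in> borel_measurable (PiM {1..} (\<lambda>_. count_space UNIV))"
    proof -
      have "Measurable.pred (PiM {1..} (\<lambda>_. count_space UNIV)) (\<lambda>f. f j = x j)" if "j \<in> {1..n}" for j
        using that by (intro measurable_compose[OF measurable_component_singleton]) auto
      hence "Measurable.pred (PiM {1..} (\<lambda>_. count_space UNIV)) (\<lambda>f. \<forall>j\<in>{1..n}. f j = x j)" by (intro pred_intros_finite) auto
      thus ?thesis unfolding \<phi>_def[abs_def] by measurable
    qed
    have \<psi>m: "\<psi> \<in> borel_measurable (PiM UNIV (\<lambda>_. borel))" unfolding \<psi>_def[abs_def] by measurable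
    have "expectation (\<lambda>\<omega>. \<phi> (\<lambda>i\<in>{1..}. X i \<omega>) * \<psi> (\<lambda>s. moving_max Y k s \<omega>)) =
        expectation (\<lambda>\<omega>. \<phi> (\<lambda>i\<in>{1..}. X i \<omega>)) * expectation (\<lambda>\<omega>. \<psi> (\<lambda>s. moving_max Y k s \<omega>))"
    proof (rule indep_elements_expectation[OF indep_walk_scenery \<phi>m _ \<psi>m, where B = 1])
      show "\<bar>\<psi> f\<bar> \<le> 1" for f unfolding \<psi>_def abs_prod using w by (intro prod_le_1) auto
    qed (simp add: \<phi>_def)
    moreover have "\<phi> (\<lambda>i\<in>{1..}. X i \<omega>) = I x \<omega>" for \<omega> unfolding \<phi>_def I_def by (intro arg_cong[where f = of_bool] ball_cong) auto
    moreover have "\<psi> (\<lambda>s. moving_max Y k s \<omega>) = exceed_prod u n w \<sigma> \<omega>" for \<omega> by (simp add: \<psi>_def exceed_prod_def)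
    ultimately show ?thesis by simp
  qed
  have hits_cong: "hits k n \<sigma> s = hits k n \<sigma>' s" if "\<And>i. i \<le> n \<Longrightarrow> \<sigma> i = \<sigma>' i" for \<sigma> \<sigma>' s
    using that by (auto simp: hits_def)
  have e1: "expectation (\<lambda>\<omega>. exceed_prod u n w (\<lambda>i. walk X i \<omega>) \<omega>) = (\<Sum>x\<in>paths n. expectation (I x) * expectation (exceed_prod u n w (path_of x)))"
  proof -
    have "expectation (\<lambda>\<omega>. exceed_prod u n w (\<lambda>i. walk X i \<omega>) \<omega>) = expectation (\<lambda>\<omega>. \<Sum>x\<in>paths n. I x \<omega> * exceed_prod u n w (path_of x) \<omega>)"
    proof (rule integral_cong_AE)
      show "(\<lambda>\<omega>. exceed_prod u n w (\<lambda>i. walk X i \<omega>) \<omega>) \<in> borel_measurable M"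
        unfolding exceed_prod_def[abs_def] by measurable
      show "(\<lambda>\<omega>. \<Sum>x\<in>paths n. I x \<omega> * exceed_prod u n w (path_of x) \<omega>) \<in> borel_measurable M"
        using Im by measurable
      show "AE \<omega> in M. exceed_prod u n w (\<lambda>i. walk X i \<omega>) \<omega> = (\<Sum>x\<in>paths n. I x \<omega> * exceed_prod u n w (path_of x) \<omega>)"
        using path_decomposition[of n]
      proof eventually_elim
        case (elim \<omega>)
        then obtain x where x: "\<forall>i\<le>n. walk X i \<omega> = path_of x i"
          "\<And>G :: (nat \<Rightarrow> int) \<Rightarrow> real. (\<Sum>y\<in>paths n. of_bool (\<forall>j\<in>{1..n}. X j \<omega> = y j) * G y) = G x" by blast
        have "exceed_prod u n w (\<lambda>i. walk X i \<omega>) \<omega> = exceed_prod u n w (path_of x) \<omega>"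
          unfolding exceed_prod_def using x(1) by (intro prod.cong) auto
        thus ?case unfolding I_def using x(2)[of "\<lambda>y. exceed_prod u n w (path_of y) \<omega>"] by simp
      qed
    qed
    also have "\<dots> = (\<Sum>x\<in>paths n. expectation (\<lambda>\<omega>. I x \<omega> * exceed_prod u n w (path_of x) \<omega>))"
      by (rule Bochner_Integration.integral_sum) (rule IE)
    finally show ?thesis by (simp add: ind)
  qed
  have e2: "expectation (\<lambda>\<omega>. exp (- (excess u * cluster_sum k n w \<omega>))) = (\<Sum>x\<in>paths n. expectation (I x) * exp (- (excess u * C x)))"
  proof -
    have "expectation (\<lambda>\<omega>. exp (- (excess u * cluster_sum k n w \<omega>))) = expectation (\<lambda>\<omega>. \<Sum>x\<in>paths n. I x \<omega> * exp (- (excess u * C x)))"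
    proof (rule integral_cong_AE)
      show "(\<lambda>\<omega>. \<Sum>x\<in>paths n. I x \<omega> * exp (- (excess u * C x))) \<in> borel_measurable M" using Im by measurable
      show "AE \<omega> in M. exp (- (excess u * cluster_sum k n w \<omega>)) = (\<Sum>x\<in>paths n. I x \<omega> * exp (- (excess u * C x)))"
        using path_decomposition[of n] AE_nn_path
      proof eventually_elim
        case (elim \<omega>)
        then obtain x where x: "\<forall>i\<le>n. walk X i \<omega> = path_of x i"
          "\<And>G :: (nat \<Rightarrow> int) \<Rightarrow> real. (\<Sum>y\<in>paths n. of_bool (\<forall>j\<in>{1..n}. X j \<omega> = y j) * G y) = G x" by blast
        have nn: "nn_path (\<lambda>i. walk X i \<omega>) n" using elim by blast
        have h: "hits k n (\<lambda>i. walk X i \<omega>) s = hits k n (path_of x) s" for s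
          using x(1) by (intro hits_cong) auto
        have "cluster_sum k n w \<omega> = C x"
          unfolding cluster_sum_eq[OF nn] C_def h ..
        thus ?case unfolding I_def using x(2)[of "\<lambda>y. exp (- (excess u * C y))"] by simp
      qed
    qed measurable
    also have "\<dots> = (\<Sum>x\<in>paths n. expectation (\<lambda>\<omega>. I x \<omega> * exp (- (excess u * C x))))"
      by (rule Bochner_Integration.integral_sum) (use Ii in auto)
    finally show ?thesis by simp
  qed
  have one: "(\<Sum>x\<in>paths n. expectation (I x)) = 1"
  proof -
    have "(\<Sum>x\<in>paths n. expectation (I x)) = expectation (\<lambda>\<omega>. \<Sum>x\<in>paths n. I x \<omega>)"
      by (rule Bochner_Integration.integral_sum[symmetric]) (rule Ii)
    also have "\<dots> = expectation (\<lambda>\<omega>. 1)"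
    proof (rule integral_cong_AE)
      show "AE \<omega> in M. (\<Sum>x\<in>paths n. I x \<omega>) = 1"
        using path_decomposition[of n]
      proof eventually_elim
        case (elim \<omega>)
        then obtain x where "\<And>G :: (nat \<Rightarrow> int) \<Rightarrow> real. (\<Sum>y\<in>paths n. of_bool (\<forall>j\<in>{1..n}. X j \<omega> = y j) * G y) = G x" by blast
        from this[of "\<lambda>_. 1"] show ?case unfolding I_def by (simp only: mult_1_right)
      qed
    qed (use Im in measurable)
    finally show ?thesis by (simp add: prob_space)
  qed
  have "\<bar>(\<Sum>x\<in>paths n. expectation (I x) * expectation (exceed_prod u n w (path_of x))) - (\<Sum>x\<in>paths n. expectation (I x) * exp (- (excess u * C x)))\<bar>
      = \<bar>\<Sum>x\<in>paths n. expectation (I x) * (expectation (exceed_prod u n w (path_of x)) - exp (- (excess u * C x)))\<bar>"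
    by (simp only: sum_subtractf[symmetric] right_diff_distrib)
  also have "\<dots> \<le> (\<Sum>x\<in>paths n. expectation (I x) * ?err)"
  proof (rule order_trans[OF sum_abs], rule sum_mono)
    fix x assume x: "x \<in> paths n"
    have "\<bar>expectation (exceed_prod u n w (path_of x)) - exp (- (excess u * C x))\<bar> \<le> ?err"
      unfolding exceed_prod_def[abs_def] C_def by (rule fixed_path_bound[OF nn_path_of[OF x] w])
    moreover have "0 \<le> expectation (I x)" by (rule Bochner_Integration.integral_nonneg) (rule I01)
    ultimately show "\<bar>expectation (I x) * (expectation (exceed_prod u n w (path_of x)) - exp (- (excess u * C x)))\<bar> \<le> expectation (I x) * ?err"
      by (simp only: abs_mult abs_of_nonneg) (intro mult_left_mono)
  qed
  also have "\<dots> = ?err" by (simp only: sum_distrib_right[symmetric] one mult_1)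
  finally show ?thesis unfolding e1 e2 .
qed

lemma exceedances_eq_prod:
  "(\<Prod>x\<in>#exceedances X (moving_max Y k) v n \<omega>. f x) =
    (\<Prod>i\<le>n. if v n < moving_max Y k (walk X i \<omega>) \<omega> then f (real i / real n) else (1 :: real))"
proof -
  have "(\<Prod>x\<in>#exceedances X (moving_max Y k) v n \<omega>. f x) = (\<Prod>i\<in>{i\<in>{..n}. v n < moving_max Y k (walk X i \<omega>) \<omega>}. f (real i / real n))"
    by (simp add: exceedances_def prod_unfold_prod_mset image_mset.compositionality comp_def)
  also have "\<dots> = (\<Prod>i\<le>n. if v n < moving_max Y k (walk X i \<omega>) \<omega> then f (real i / real n) else 1)"
    by (rule prod.inter_filter) simp
  finally show ?thesis .
qed

lemma point_process_exceedances: "point_process M (exceedances X (moving_max Y k) v n)"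
  unfolding point_process_def
proof (intro conjI ballI prob_space_axioms)
  \<comment> \<open>This includes \<open>n = 0\<close>, where the only time is 0 and
    \<open>0 / 0 = 0\<close>.\<close>
  show "set_mset (exceedances X (moving_max Y k) v n \<omega>) \<subseteq> {0..1}" for \<omega>
    by (auto simp: exceedances_def divide_le_eq)
  fix B :: "real set" assume "B \<in> sets borel"
  have p: "points_in (image_mset f (mset_set A)) B = (\<Sum>i\<in>A. of_bool (f i \<in> B))" if "finite A" for A and f :: "nat \<Rightarrow> real"
    using that by induction auto
  have "points_in (exceedances X (moving_max Y k) v n \<omega>) B =
      (\<Sum>i\<in>{i\<in>{..n}. v n < moving_max Y k (walk X i \<omega>) \<omega>}. of_bool (real i / real n \<in> B))" for \<omega>
    unfolding exceedances_def by (subst p) (auto intro!: sum.cong)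
  also have "\<dots> \<omega> = (\<Sum>i\<in>{..n}. if v n < moving_max Y k (walk X i \<omega>) \<omega> then of_bool (real i / real n \<in> B) else 0)" for \<omega>
    by (rule sum.inter_filter) simp
  finally have "(\<lambda>\<omega>. points_in (exceedances X (moving_max Y k) v n \<omega>) B) =
    (\<lambda>\<omega>. \<Sum>i\<in>{..n}. if v n < moving_max Y k (walk X i \<omega>) \<omega> then of_bool (real i / real n \<in> B) else 0)" by (intro ext)
  also have "\<dots> \<in> measurable M (count_space UNIV)" by measurable
  finally show "(\<lambda>\<omega>. points_in (exceedances X (moving_max Y k) v n \<omega>) B) \<in> measurable M (count_space UNIV)" .
qed

text \<open>The exceedance probability of the maximum is \<open>1 - (1 - e) ^ Suc k\<close>, which
  is \<open>(k + 1) * e\<close> up to a multiple of the square of \<open>e\<close>. It dominates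
  \<open>e\<close> and tends to 0, so n times that square vanishes.\<close>

lemma excess_asymptotics:
  assumes "(\<lambda>n. real n * prob {\<omega> \<in> space M. v n < moving_max Y k 0 \<omega>}) \<longlonglongrightarrow> \<tau>"
  shows "(\<lambda>n. real n * excess (v n)) \<longlonglongrightarrow> \<tau> / real (k + 1)" "(\<lambda>n. real n * (excess (v n))\<^sup>2) \<longlonglongrightarrow> 0"
proof -
  define a where "a n = prob {\<omega> \<in> space M. v n < moving_max Y k 0 \<omega>}" for n
  define e where "e n = excess (v n)" for n
  have a: "a n = 1 - (1 - e n) ^ Suc k" for n unfolding a_def e_def by (rule prob_moving_max)
  have e01: "0 \<le> e n" "e n \<le> 1" for n by (auto simp: e_def excess_bounds)
  have ea: "e n \<le> a n" for n
    using power_decreasing[of 1 "Suc k" "1 - e n"] e01[of n] by (simp add: a del: power_Suc)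
  have na: "(\<lambda>n. real n * a n) \<longlonglongrightarrow> \<tau>" using assms by (simp add: a_def)
  have "(\<lambda>n. (real n * a n) * (1 / real n)) \<longlonglongrightarrow> \<tau> * 0" by (intro tendsto_mult na lim_1_over_n)
  moreover have "\<forall>\<^sub>F n in sequentially. (real n * a n) * (1 / real n) = a n"
    using eventually_gt_at_top[of 0] by eventually_elim simp
  ultimately have a0: "a \<longlonglongrightarrow> 0" by (simp add: filterlim_cong[OF refl refl])
  have "(\<lambda>n. (real n * a n) * a n) \<longlonglongrightarrow> \<tau> * 0" by (intro tendsto_mult na a0)
  hence 0: "(\<lambda>n. real n * a n * a n) \<longlonglongrightarrow> 0" by simp
  have ne2: "(\<lambda>n. real n * (e n)\<^sup>2) \<longlonglongrightarrow> 0"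
  proof (rule tendsto_sandwich[OF _ _ tendsto_const 0])
    show "\<forall>\<^sub>F n in sequentially. 0 \<le> real n * (e n)\<^sup>2" by simp
    have "(e n)\<^sup>2 \<le> a n * a n" for n unfolding power2_eq_square using ea[of n] e01[of n] by (intro mult_mono) auto
    thus "\<forall>\<^sub>F n in sequentially. real n * (e n)\<^sup>2 \<le> real n * a n * a n" by (simp add: mult_left_mono mult.assoc)
  qed
  thus "(\<lambda>n. real n * (excess (v n))\<^sup>2) \<longlonglongrightarrow> 0" by (simp add: e_def)
  have "(\<lambda>n. real n * a n - real n * (real (Suc k) * e n)) \<longlonglongrightarrow> 0"
  proof (rule Lim_null_comparison)
    show "\<forall>\<^sub>F n in sequentially. norm (real n * a n - real n * (real (Suc k) * e n)) \<le> (real (Suc k))\<^sup>2 * (real n * (e n)\<^sup>2)"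
    proof (intro always_eventually allI)
      fix n
      have "\<bar>a n - real (Suc k) * e n\<bar> \<le> (real (Suc k))\<^sup>2 * (e n)\<^sup>2"
        unfolding a by (rule one_minus_power_bound[OF e01])
      hence "real n * \<bar>a n - real (Suc k) * e n\<bar> \<le> real n * ((real (Suc k))\<^sup>2 * (e n)\<^sup>2)" by (intro mult_left_mono) auto
      moreover have "norm (real n * a n - real n * (real (Suc k) * e n)) = real n * \<bar>a n - real (Suc k) * e n\<bar>"
        by (simp add: abs_mult flip: right_diff_distrib)
      ultimately show "norm (real n * a n - real n * (real (Suc k) * e n)) \<le> (real (Suc k))\<^sup>2 * (real n * (e n)\<^sup>2)"
        by (simp only: mult_ac)
    qed
    show "(\<lambda>n. (real (Suc k))\<^sup>2 * (real n * (e n)\<^sup>2)) \<longlonglongrightarrow> 0" using tendsto_mult_right_zero[OF ne2] .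
  qed
  from tendsto_diff[OF na this] have "(\<lambda>n. real n * (real (Suc k) * e n)) \<longlonglongrightarrow> \<tau>" by simp
  hence "(\<lambda>n. real n * (real (Suc k) * e n) / real (Suc k)) \<longlonglongrightarrow> \<tau> / real (Suc k)" by (intro tendsto_divide tendsto_const) auto
  thus "(\<lambda>n. real n * excess (v n)) \<longlonglongrightarrow> \<tau> / real (k + 1)" by (simp add: e_def)
qed

lemma cluster_rate_nonneg: "0 \<le> z \<Longrightarrow> z < 1 \<Longrightarrow> 0 \<le> cluster_rate k z"
proof -
  assume z: "0 \<le> z" "z < 1"
  let ?\<pi> = "\<lambda>j. cluster_size_distr M X k (Suc j)"
  have le: "?\<pi> j * z ^ Suc j \<le> ?\<pi> j" for j
    using cluster_size_distr_nonneg[of k j] z power_le_one[of z "Suc j"] by (simp add: mult_left_le del: power_Suc)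
  have "summable (\<lambda>j. ?\<pi> j * z ^ Suc j)"
    by (rule summable_comparison_test'[OF sums_summable[OF cluster_size_distr_sums[of k]]])
      (use le cluster_size_distr_nonneg[of k] z in auto)
  hence "(\<Sum>j. ?\<pi> j * z ^ Suc j) \<le> (\<Sum>j. ?\<pi> j)"
    by (intro suminf_le le sums_summable[OF cluster_size_distr_sums])
  hence "(\<Sum>j. ?\<pi> j * z ^ Suc j) \<le> 1" by (simp only: sums_unique[OF cluster_size_distr_sums, symmetric])
  thus ?thesis using no_return_prob_pos by (simp add: cluster_rate_def)
qed

lemma cluster_sum_nonneg:
  assumes "\<And>i. 0 \<le> w i \<and> w i \<le> 1"
  shows "0 \<le> cluster_sum k n w \<omega>"
  unfolding cluster_sum_def using assms forward_prod_bounds(1)[OF assms]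
  by (intro sum_nonneg mult_nonneg_nonneg) auto

text \<open>Once \<open>annealed_bound\<close> has produced the exponential, the Lipschitz property
  of exp(-x) splits the error into the L1 deviation of the cluster sum, weighted by the bounded
  \<open>n * e n\<close>, and the convergence of \<open>n * e n\<close>.\<close>

lemma exceedances_pgf_tendsto:
  fixes W :: "nat \<Rightarrow> real"
  assumes v: "(\<lambda>n. real n * prob {\<omega> \<in> space M. v n < moving_max Y k 0 \<omega>}) \<longlonglongrightarrow> \<tau>" and \<tau>: "0 \<le> \<tau>"
    and L: "L > 0" and W: "\<And>l. 0 \<le> W l \<and> W l < 1"
  shows "(\<lambda>n. expectation (\<lambda>\<omega>. \<Prod>x\<in>#exceedances X (moving_max Y k) v n \<omega>. W (grid_index L x))) \<longlonglongrightarrow>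
    exp (- (\<tau> / real (k + 1) * ((\<Sum>l<L. cluster_rate k (W l)) / real L)))"
proof -
  define c0 where "c0 = (\<Sum>l<L. cluster_rate k (W l)) / real L"
  have c0: "0 \<le> c0" unfolding c0_def using W by (intro divide_nonneg_nonneg sum_nonneg cluster_rate_nonneg) auto
  define w where "w n i = W (L * i div n)" for n i
  have w: "0 \<le> w n i \<and> w n i \<le> 1" for n i using W by (auto simp: w_def less_imp_le)
  define e where "e n = excess (v n)" for n
  define \<rho> where "\<rho> = \<tau> / real (k + 1)"
  have \<rho>: "0 \<le> \<rho>" using \<tau> by (simp add: \<rho>_def)
  have e01: "0 \<le> e n" for n by (simp add: e_def excess_bounds)
  have ne: "(\<lambda>n. real n * e n) \<longlonglongrightarrow> \<rho>" and ne2: "(\<lambda>n. real n * (e n)\<^sup>2) \<longlonglongrightarrow> 0"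
    using excess_asymptotics[OF v] by (simp_all add: e_def \<rho>_def)
  define err where "err n = ((real n + 1) * (real k + 1)\<^sup>2 + (2 * real n + real k + 1)) * (e n)\<^sup>2" for n
  define lln where "lln n = expectation (\<lambda>\<omega>. \<bar>cluster_sum k n (w n) \<omega> / real n - c0\<bar>)" for n
  have lln: "lln \<longlonglongrightarrow> 0" 
    unfolding lln_def[abs_def] c0_def w_def[abs_def] by (rule cluster_sum_tendsto[where W = W, OF L W])
  have err: "err \<longlonglongrightarrow> 0"
  proof (rule Lim_null_comparison)
    let ?K = "2 * (real k + 1)\<^sup>2 + 3 + real k"
    show "\<forall>\<^sub>F n in sequentially. norm (err n) \<le> ?K * (real n * (e n)\<^sup>2)"
      using eventually_ge_at_top[of 1]
    proof eventually_elim
      case (elim n)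
      have "(real n + 1) * (real k + 1)\<^sup>2 \<le> (2 * real n) * (real k + 1)\<^sup>2" using elim by (intro mult_right_mono) auto
      moreover have "real k + 1 \<le> real n * (real k + 1)" using elim by simp
      moreover have "?K * real n = (2 * real n) * (real k + 1)\<^sup>2 + (2 * real n + real n * (real k + 1))"
        by (simp add: algebra_simps)
      ultimately have "(real n + 1) * (real k + 1)\<^sup>2 + (2 * real n + real k + 1) \<le> ?K * real n" by linarith
      hence "err n \<le> ?K * real n * (e n)\<^sup>2" unfolding err_def by (rule mult_right_mono) simp
      moreover have "0 \<le> err n" unfolding err_def by simp
      ultimately show ?case by (simp add: mult.assoc)
    qed
    show "(\<lambda>n. ?K * (real n * (e n)\<^sup>2)) \<longlonglongrightarrow> 0" using tendsto_mult_right_zero[OF ne2] .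
  qed
  have bound: "\<bar>expectation (\<lambda>\<omega>. \<Prod>x\<in>#exceedances X (moving_max Y k) v n \<omega>. W (grid_index L x)) - exp (- (\<rho> * c0))\<bar>
      \<le> err n + (real n * e n * lln n + \<bar>real n * e n - \<rho>\<bar> * c0)" if n: "n > 0" for n
  proof -
    have 1: "(\<Prod>x\<in>#exceedances X (moving_max Y k) v n \<omega>. W (grid_index L x)) = exceed_prod (v n) n (w n) (\<lambda>i. walk X i \<omega>) \<omega>" for \<omega>
      unfolding exceedances_eq_prod exceed_prod_def w_def grid_index_frac[OF n] ..
    have 2: "\<bar>expectation (\<lambda>\<omega>. exceed_prod (v n) n (w n) (\<lambda>i. walk X i \<omega>) \<omega>) - expectation (\<lambda>\<omega>. exp (- (e n * cluster_sum k n (w n) \<omega>)))\<bar> \<le> err n"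
      unfolding err_def e_def by (rule annealed_bound[OF w])
    have csi: "integrable M (cluster_sum k n (w n))" by (rule integrable_cluster_sum[OF w])
    have cs: "0 \<le> cluster_sum k n (w n) \<omega>" for \<omega> by (rule cluster_sum_nonneg[OF w])
    have ei: "integrable M (\<lambda>\<omega>. exp (- (e n * cluster_sum k n (w n) \<omega>)))"
      by (rule integrable_const_bound[where B = 1]) (use cs e01 in auto)
    have "\<bar>expectation (\<lambda>\<omega>. exp (- (e n * cluster_sum k n (w n) \<omega>))) - exp (- (\<rho> * c0))\<bar>
        = \<bar>expectation (\<lambda>\<omega>. exp (- (e n * cluster_sum k n (w n) \<omega>)) - exp (- (\<rho> * c0)))\<bar>"
      using ei by (simp add: prob_space)
    also have "\<dots> \<le> expectation (\<lambda>\<omega>. \<bar>exp (- (e n * cluster_sum k n (w n) \<omega>)) - exp (- (\<rho> * c0))\<bar>)"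
      by (rule integral_abs_bound)
    also have "\<dots> \<le> expectation (\<lambda>\<omega>. real n * e n * \<bar>cluster_sum k n (w n) \<omega> / real n - c0\<bar> + \<bar>real n * e n - \<rho>\<bar> * c0)"
    proof (rule integral_mono)
      fix \<omega>
      have "\<bar>exp (- (e n * cluster_sum k n (w n) \<omega>)) - exp (- (\<rho> * c0))\<bar> \<le> \<bar>e n * cluster_sum k n (w n) \<omega> - \<rho> * c0\<bar>"
        using cs e01 \<rho> c0 by (intro abs_exp_minus_diff_le) auto
      also have "e n * cluster_sum k n (w n) \<omega> - \<rho> * c0 =
          real n * e n * (cluster_sum k n (w n) \<omega> / real n - c0) + (real n * e n - \<rho>) * c0"
        using n by (simp add: field_simps)
      also have "\<bar>\<dots>\<bar> \<le> real n * e n * \<bar>cluster_sum k n (w n) \<omega> / real n - c0\<bar> + \<bar>real n * e n - \<rho>\<bar> * c0"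
      proof (rule order_trans[OF abs_triangle_ineq])
        show "\<bar>real n * e n * (cluster_sum k n (w n) \<omega> / real n - c0)\<bar> + \<bar>(real n * e n - \<rho>) * c0\<bar>
          \<le> real n * e n * \<bar>cluster_sum k n (w n) \<omega> / real n - c0\<bar> + \<bar>real n * e n - \<rho>\<bar> * c0"
          using e01[of n] c0 by (simp only: abs_mult abs_of_nonneg of_nat_0_le_iff order_refl)
      qed
      finally show "\<bar>exp (- (e n * cluster_sum k n (w n) \<omega>)) - exp (- (\<rho> * c0))\<bar>
        \<le> real n * e n * \<bar>cluster_sum k n (w n) \<omega> / real n - c0\<bar> + \<bar>real n * e n - \<rho>\<bar> * c0" .
    qed (use ei csi in auto)
    also have "\<dots> = real n * e n * lln n + \<bar>real n * e n - \<rho>\<bar> * c0"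
      unfolding lln_def using csi by (simp add: prob_space)
    finally show ?thesis using 2 unfolding 1 by linarith
  qed
  have "(\<lambda>n. err n + (real n * e n * lln n + \<bar>real n * e n - \<rho>\<bar> * c0)) \<longlonglongrightarrow> 0 + (\<rho> * 0 + \<bar>\<rho> - \<rho>\<bar> * c0)"
    by (intro tendsto_intros err lln ne)
  hence lim: "(\<lambda>n. err n + (real n * e n * lln n + \<bar>real n * e n - \<rho>\<bar> * c0)) \<longlonglongrightarrow> 0" by simp
  have "(\<lambda>n. expectation (\<lambda>\<omega>. \<Prod>x\<in>#exceedances X (moving_max Y k) v n \<omega>. W (grid_index L x)) - exp (- (\<rho> * c0))) \<longlonglongrightarrow> 0"
    by (rule Lim_null_comparison[OF _ lim])
      (rule eventually_mono[OF eventually_gt_at_top[of 0]], use bound in simp)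
  thus ?thesis unfolding \<rho>_def[symmetric] c0_def[symmetric] by (simp add: LIM_zero_iff)
qed

theorem exceedances_converge:
  fixes v :: "nat \<Rightarrow> real"
  assumes \<tau>: "0 < \<tau>" and v: "(\<lambda>n. real n * prob {\<omega> \<in> space M. v n < moving_max Y k 0 \<omega>}) \<longlonglongrightarrow> \<tau>"
  shows "\<exists>(M' :: (nat \<times> (nat \<Rightarrow> real) \<times> (nat \<Rightarrow> nat)) measure) \<Psi>.
    compound_poisson_process M' (no_return_prob M X / real (k + 1) * \<tau>) (cluster_size_distr M X k) \<Psi> \<and>
    converges_in_distribution M (exceedances X (moving_max Y k) v) M' \<Psi>"
proof -
  define q where "q = no_return_prob M X"
  let ?\<pi> = "cluster_size_distr M X k"
  let ?lam = "q / real (k + 1) * \<tau>"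
  have q: "q > 0" by (simp add: q_def no_return_prob_pos)
  have lam: "0 < ?lam" using \<tau> q by simp
  obtain M' :: "(nat \<times> (nat \<Rightarrow> real) \<times> (nat \<Rightarrow> nat)) measure" and \<Psi>
    where cp: "compound_poisson_process M' ?lam ?\<pi> \<Psi>" and pp: "point_process M' \<Psi>"
      and pgf: "\<And>L (w :: nat \<Rightarrow> real). L > 0 \<Longrightarrow> (\<And>l. 0 \<le> w l \<and> w l < 1) \<Longrightarrow>
        (\<integral>\<omega>. (\<Prod>y\<in>#\<Psi> \<omega>. w (grid_index L y)) \<partial>M') =
          exp (- (?lam * (1 - (\<Sum>l<L. \<Sum>j. ?\<pi> (Suc j) * w l ^ Suc j) / real L)))"
  proof (rule exists_compound_poisson_process[OF lam cluster_size_distr_nonneg cluster_size_distr_sums])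
    fix M' :: "(nat \<times> (nat \<Rightarrow> real) \<times> (nat \<Rightarrow> nat)) measure" and \<Psi>
    assume 1: "compound_poisson_process M' ?lam ?\<pi> \<Psi>" and 2: "point_process M' \<Psi>"
      and 3: "\<And>L (w :: nat \<Rightarrow> real). L > 0 \<Longrightarrow> (\<And>l. 0 \<le> w l \<and> w l < 1) \<Longrightarrow>
        (\<integral>\<omega>. (\<Prod>y\<in>#\<Psi> \<omega>. w (grid_index L y)) \<partial>M') =
          exp (- (?lam * (1 - (\<Sum>l<L. \<Sum>j. ?\<pi> (Suc j) * w l ^ Suc j) / real L)))"
    show thesis by (rule that[OF 1 2 3])
  qed
  have "converges_in_distribution M (exceedances X (moving_max Y k) v) M' \<Psi>"
  proof (rule converges_in_distributionI[OF point_process_exceedances pp])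
    fix L :: nat and W :: "nat \<Rightarrow> real" assume L: "L > 0" and W: "\<And>l. 0 \<le> W l \<and> W l < 1"
    \<comment> \<open>Matching of exponents: the factor \<open>q\<close> in
      \<open>cluster_rate\<close> and the \<open>\<tau> / real (k + 1)\<close> from the scenery
      combine to the intensity \<open>?lam\<close>.\<close>
    have "(\<Sum>l<L. cluster_rate k (W l)) / real L = q * (1 - (\<Sum>l<L. \<Sum>j. ?\<pi> (Suc j) * W l ^ Suc j) / real L)"
    proof -
      have "(\<Sum>l<L. cluster_rate k (W l)) = q * (real L - (\<Sum>l<L. \<Sum>j. ?\<pi> (Suc j) * W l ^ Suc j))"
        unfolding cluster_rate_def q_def sum_distrib_left[symmetric] sum_subtractf by simp
      thus ?thesis using L by (simp add: right_diff_distrib diff_divide_distrib)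
    qed
    hence "\<tau> / real (k + 1) * ((\<Sum>l<L. cluster_rate k (W l)) / real L) =
        ?lam * (1 - (\<Sum>l<L. \<Sum>j. ?\<pi> (Suc j) * W l ^ Suc j) / real L)" by simp
    with exceedances_pgf_tendsto[where W = W, OF v less_imp_le[OF \<tau>] L W] pgf[of L W, OF L W]
    show "(\<lambda>n. expectation (\<lambda>\<omega>. \<Prod>x\<in>#exceedances X (moving_max Y k) v n \<omega>. W (grid_index L x))) \<longlonglongrightarrow>
        (\<integral>\<omega>. (\<Prod>y\<in>#\<Psi> \<omega>. W (grid_index L y)) \<partial>M')" by simp
  qed
  thus ?thesis using cp unfolding q_def by blast
qed

end

theorem proposition5:
  fixes M :: "'a measure" and p :: real and k :: nat
    and X :: "nat \<Rightarrow> 'a \<Rightarrow> int" and Y \<xi> :: "int \<Rightarrow> 'a \<Rightarrow> real"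
    and u :: "real \<Rightarrow> nat \<Rightarrow> real"
  assumes "prob_space M"
    and "0 < p" and "p < 1" and "p \<noteq> 1 / 2"
    and "prob_space.indep_vars M (\<lambda>_. count_space UNIV) X {1..}"
    and "\<And>i. i \<ge> 1 \<Longrightarrow> \<P>(\<omega> in M. X i \<omega> = 1) = p"
    and "\<And>i. i \<ge> 1 \<Longrightarrow> \<P>(\<omega> in M. X i \<omega> = -1) = 1 - p"
    and "prob_space.indep_vars M (\<lambda>_. borel) Y UNIV"
    and "\<And>s t. distr M borel (Y s) = distr M borel (Y t)"
    and "\<xi> = moving_max Y k"
    and "indep_elements M
           (PiM {1..} (\<lambda>_. count_space UNIV)) (\<lambda>\<omega>. \<lambda>i\<in>{1..}. X i \<omega>)
           (PiM UNIV (\<lambda>_. borel)) (\<lambda>\<omega> s. \<xi> s \<omega>)"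
    and "\<And>\<tau>. \<tau> > 0 \<Longrightarrow> (\<lambda>n. real n * \<P>(\<omega> in M. \<xi> 0 \<omega> > u \<tau> n)) \<longlonglongrightarrow> \<tau>"
  shows "\<forall>\<tau>>0. \<exists>(M' :: (nat \<times> (nat \<Rightarrow> real) \<times> (nat \<Rightarrow> nat)) measure) \<Psi>.
           compound_poisson_process M' (no_return_prob M X / real (k + 1) * \<tau>)
             (cluster_size_distr M X k) \<Psi> \<and>
           converges_in_distribution M (exceedances X \<xi> (u \<tau>)) M' \<Psi>"
proof (intro allI impI)
  fix \<tau> :: real assume \<tau>: "\<tau> > 0"
  interpret prob_space M by fact
  have indep: "indep_elements M
      (PiM {1..} (\<lambda>_. count_space UNIV)) (\<lambda>\<omega>. \<lambda>i\<in>{1..}. X i \<omega>)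
      (PiM UNIV (\<lambda>_. borel)) (\<lambda>\<omega> s. moving_max Y k s \<omega>)"
    using assms(11) unfolding assms(10) .
  interpret walk_in_scenery M X p Y k
    by unfold_locales (fact assms(2-9) indep)+
  show "\<exists>(M' :: (nat \<times> (nat \<Rightarrow> real) \<times> (nat \<Rightarrow> nat)) measure) \<Psi>.
      compound_poisson_process M' (no_return_prob M X / real (k + 1) * \<tau>) (cluster_size_distr M X k) \<Psi> \<and>
      converges_in_distribution M (exceedances X \<xi> (u \<tau>)) M' \<Psi>"
    using exceedances_converge[OF \<tau>, of "u \<tau>"] assms(12)[OF \<tau>] unfolding assms(10) by blast
qed

end
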